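(* Let $\ell\in\mathbb N$, let $(G,+)$ be a countable abelian group and let $(X,\mathcal A,\mu,(T_g)_{g\in G})$ be a measure preserving system. The following statements are equivalent: (i) $(T_g)_{g\in G}$ is mildly mixing. (ii) For any $\tilde{\mathrm{IP}}$ set $E\subseteq G^\ell$ and any $m\in\mathbb N$, there exist non-degenerated and essentially distinct sequences $(\mathbf g^{(j)}_k)_{k\in\mathbb N}=(g^{(j)}_{k,1},\dots,g^{(j)}_{k,m})_{k\in\mathbb N}$, $j\in\{1,\dots,\ell\}$, in $G^m$ with the properties: (a) $\{(g^{(1)}_\alpha,\dots,g^{(\ell)}_\alpha) : \alpha\in\mathbb N^{(m)}\}\subseteq E$; (b) for any $t\in\{1,\dots,m\}$ and any $j\in\{1,\dots,\ell\}$, $(T_{g^{(j)}_{k,t}})_{k\in\mathbb N}$ has the mixing property; (c) for any $t\in\{1,\dots,m\}$ and any $i\neq j$, $(T_{g^{(j)}_{k,t}-g^{(i)}_{k,t}})_{k\in\mathbb N}$ has the mixing property. (iii) For any $\tilde{\mathrm{IP}}$ set $E\subseteq G^\ell$, there exist an $m\in\mathbb N$ and non-degenerated and essentially distinct sequences $(\mathbf g^{(1)}_k)_{k\in\mathbb N},\dots,(\mathbf g^{(\ell)}_k)_{k\in\mathbb N}$ in $G^m$ with $\{(g^{(1)}_\alpha,\dots,g^{(\ell)}_\alpha) : \alpha\in\mathbb N^{(m)}\}\subseteq E$ and such that for any $A_0,\dots,A_\ell\in\mathcal A$, $$\mathop{\mathcal R\text{-}\lim}_{\alpha\in\mathbb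 N^{(m)}}\mu\big(A_0\cap T_{g^{(1)}_\alpha}A_1\cap\cdots\cap T_{g^{(\ell)}_\alpha}A_\ell\big)=\prod_{j=0}^\ell\mu(A_j).$$ (iv) Given sequences $(g^{(1)}_k)_{k\in\mathbb N},\dots,(g^{(\ell)}_k)_{k\in\mathbb N}$ in $G$ such that for any $j\in\{1,\dots,\ell\}$, $\lim_{\alpha\to\infty}g^{(j)}_\alpha=\infty$ and for any $i\neq j$, $\lim_{\alpha\to\infty}(g^{(j)}_\alpha-g^{(i)}_\alpha)=\infty$ (limits along $\alpha\in\mathcal F$), there exists an IP-ring $\mathcal F^{(1)}$ such that for any $A_0,\dots,A_\ell\in\mathcal A$, $$\mathop{\mathrm{IP}\text{-}\lim}_{\alpha\in\mathcal F^{(1)}}\mu\big(A_0\cap T_{g^{(1)}_\alpha}A_1\cap\cdots\cap T_{g^{(\ell)}_\alpha}A_\ell\big)=\prod_{j=0}^\ell\mu(A_j).$$ (v) For any $A_0,\dots,A_\ell\in\mathcal A$ and any $\epsilon>0$, the set $$R_\epsilon(A_0,\dots,A_\ell)=\Big\{(g_1,\dots,g_\ell)\in G^\ell : \Big|\mu(A_0\cap T_{g_1}A_1\cap\cdots\cap T_{g_\ell}A_\ell)-\prod_{j=0}^\ell\mu(A_j)\Big|<\epsilon\Big\}$$ is an $\tilde{\mathrm{IP}}^*$ set.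
   Context: $\mathbb N=\{1,2,\dots\}$. A measure preserving system $(X,\mathcal A,\mu,(T_g)_{g\in G})$ consists of a separable probability space and an action of the countable discrete abelian group $G$ on it by (invertible) $\mu$-preserving transformations; as a standing assumption the space is regular, i.e. $X$ is a compact metric space and $\mathcal A=\mathrm{Borel}(X)$. $T_g$ acts on $L^2(\mu)$ by $T_gf=f\circ T_g$. $\lim_{k\to\infty}g_k=\infty$ in $G$ means that for every finite $F\subseteq G$, $g_k\notin F$ for all large $k$. A sequence $(T_k)_{k\in\mathbb N}$ of measure preserving transformations of $(X,\mathcal A,\mu)$ has the mixing property if $\lim_{k\to\infty}\mu(A_0\cap T_k^{-1}A_1)=\mu(A_0)\mu(A_1)$ for all $A_0,A_1\in\mathcal A$. Sequences in $G^m$: $(g_{k,1},\dots,g_{k,m})_{k\in\mathbb N}$ is non-degenerated if $\lim_{k\to\infty}g_{k,t}=\infty$ for each $t$; two sequences $(g_{k,1},\dots,g_{k,m})_k$, $(h_{k,1},\dots,h_{k,m})_k$ are essentially distinct if $\lim_{k\to\infty}(g_{k,t}-h_{k,t})=\infty$ for each $t$; several are essentially distinct if any two with distinct indices are. $\mathbb N^{(m)}$ is the family of $m$-element subsets of $\mathbb N$, and for $\alpha=\{k_1<\cdots<k_m\}\in\mathbb N^{(m)}$ and a sequence $(g_{k,1},\dots,g_{k,m})_k$ in $G^m$, $g_\alpha=g_{k_1,1}+\cdots+g_{k_m,m}$. For $(x_\alpha)_{\alpha\in\mathbb N^{(m)}}$ in a compact metric space $(Y,d)$, $\mathcal R\text{-}\lim_{\alpha\in\mathbb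 N^{(m)}}x_\alpha=x$ means: for every $\epsilon>0$ there is $\alpha_0\in\mathbb N^{(m)}$ with $d(x_\alpha,x)<\epsilon$ for all $\alpha\in\mathbb N^{(m)}$ with $\min\alpha>\max\alpha_0$. $\mathcal F$ is the set of non-empty finite subsets of $\mathbb N$; $\alpha>\beta$ means $\min\alpha>\max\beta$. For a sequence $(g_k)_{k\in\mathbb N}$ in $G$ and $\alpha\in\mathcal F$, $g_\alpha=\sum_{k\in\alpha}g_k$. $\lim_{\alpha\to\infty}g_\alpha=\infty$ means: for every finite $K\subseteq G$ there is $\alpha_0\in\mathcal F$ such that $g_\alpha\notin K$ for all $\alpha\in\mathcal F$ with $\alpha>\alpha_0$. A set $E\subseteq G^d$ is an $\tilde{\mathrm{IP}}$ set if $E=\{(g^{(1)}_\alpha,\dots,g^{(d)}_\alpha) : \alpha\in\mathcal F\}$ for sequences $(g^{(j)}_k)_{k\in\mathbb N}$ in $G$, $j=1,\dots,d$, with $\lim_{\alpha\to\infty}g^{(j)}_\alpha=\infty$ for every $j$ and $\lim_{\alpha\to\infty}(g^{(j)}_\alpha-g^{(i)}_\alpha)=\infty$ for $i\ne j$. A subset of $G^d$ is $\tilde{\mathrm{IP}}^*$ if it has non-empty intersection with every $\tilde{\mathrm{IP}}$ set in $G^d$. An IP-ring is a set $\mathcal F^{(1)}=\{\bigcup_{j\in\alpha}\alpha_j : \alpha\in\mathcal F\}$ for some sequence $(\alpha_k)_{k\in\mathbb N}$ in $\mathcal F$ with $\alpha_k<\alpha_{k+1}$ for all $k$. $\mathrm{IP}\text{-}\lim_{\alpha\in\mathcal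 F^{(1)}}x_\alpha=x$ means: for every neighbourhood $U$ of $x$ there is $\alpha_0\in\mathcal F^{(1)}$ such that $x_\alpha\in U$ for all $\alpha\in\mathcal F^{(1)}$ with $\alpha>\alpha_0$. $(T_g)_{g\in G}$ is mildly mixing if for any sequence $(g_k)_{k\in\mathbb N}$ in $G$ with $\lim_{\alpha\to\infty}g_\alpha=\infty$ there exists an IP-ring $\mathcal F^{(1)}$ such that for any $f\in L^2(\mu)$, $\mathrm{IP}\text{-}\lim_{\alpha\in\mathcal F^{(1)}}T_{g_\alpha}f=\int_Xf\,d\mu$ in the weak topology of $L^2(\mu)$. *)

theory Defs
  imports "HOL-Probability.Probability"
begin

section \<open>Measure preserving systems\<close>

text \<open>
  The acting group is the additive group of the type \<open>'g\<close> (countable and abelian, discrete).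
  The standing regularity assumption is part of the notion of system: the underlying space is the
  whole type \<open>'x\<close>, which is a compact metric space carrying its Borel sigma-algebra.
\<close>

definition mp_transformation :: "'x measure \<Rightarrow> ('x \<Rightarrow> 'x) \<Rightarrow> bool" where
  "mp_transformation M S \<longleftrightarrow> S \<in> measurable M M \<and> distr M M S = M"

text \<open>Invertibility of each \<open>T g\<close>, with inverse \<open>T (- g)\<close>, follows from the action laws.\<close>

definition mp_system ::
  "'x::metric_space measure \<Rightarrow> ('g::{ab_group_add, countable} \<Rightarrow> 'x \<Rightarrow> 'x) \<Rightarrow> bool" where
  "mp_system M T \<longleftrightarrow>
     compact (UNIV :: 'x set) \<and> sets M = sets borel \<and> prob_space M \<and>
     (\<forall>g. mp_transformation M (T g)) \<and>
     T 0 = id \<and> (\<forall>g h. T (g + h) = T g \<circ> T h)"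

definition mixing_property :: "'x measure \<Rightarrow> (nat \<Rightarrow> 'x \<Rightarrow> 'x) \<Rightarrow> bool" where
  "mixing_property M S \<longleftrightarrow>
     (\<forall>A\<^sub>0\<in>sets M. \<forall>A\<^sub>1\<in>sets M.
        (\<lambda>k. measure M (A\<^sub>0 \<inter> (S k -` A\<^sub>1 \<inter> space M))) \<longlonglongrightarrow> measure M A\<^sub>0 * measure M A\<^sub>1)"

definition multi_corr ::
  "'x measure \<Rightarrow> ('g \<Rightarrow> 'x \<Rightarrow> 'x) \<Rightarrow> nat \<Rightarrow> (nat \<Rightarrow> 'x set) \<Rightarrow> (nat \<Rightarrow> 'g) \<Rightarrow> real" where
  "multi_corr M T l A g = measure M (A 0 \<inter> (\<Inter>j\<in>{1..l}. T (g j) ` A j))"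

section \<open>The weak topology of complex \<open>L\<^sup>2\<close>\<close>

definition L2 :: "'x measure \<Rightarrow> ('x \<Rightarrow> complex) set" where
  "L2 M = {f \<in> borel_measurable M. integrable M (\<lambda>x. (cmod (f x))\<^sup>2)}"

text \<open>
  Elements are functions rather than almost-everywhere classes. The topology is the coarsest one
  making all functionals \<open>f \<mapsto> \<langle>f, h\<rangle>\<close>, for square-integrable \<open>h\<close>, continuous; it does not
  separate functions that agree almost everywhere and induces the usual weak topology on classes.
\<close>

definition L2_weak :: "'x measure \<Rightarrow> ('x \<Rightarrow> complex) topology" where
  "L2_weak M = topology_generated_by
     {{f \<in> L2 M. (LINT x|M. f x * cnj (h x)) \<in> V} | h V. h \<in> L2 M \<and> open V}"

lemma topspace_L2_weak: "topspace (L2_weak M) = L2 M"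
proof -
  have "(\<lambda>x. 0) \<in> L2 M" by (simp add: L2_def)
  then have "L2 M \<in> {{f \<in> L2 M. (LINT x|M. f x * cnj (h x)) \<in> V} | h V. h \<in> L2 M \<and> open V}"
    by (intro CollectI exI[of _ "\<lambda>x. 0"] exI[of _ UNIV]) auto
  then show ?thesis
    unfolding L2_weak_def topology_generated_by_topspace by blast
qed

section \<open>Convergence along sequences and along \<open>\<nat>\<^sup>(\<^sup>m\<^sup>)\<close>\<close>

text \<open>
  Natural numbers start at 1: sequences are functions on the type \<open>nat\<close> whose value
  at 0 is never used, and all index sets are subsets of \<open>{1..}\<close>.
\<close>

definition tends_infinity :: "(nat \<Rightarrow> 'g) \<Rightarrow> bool" where
  "tends_infinity g \<longleftrightarrow> (\<forall>F. finite F \<longrightarrow> (\<forall>\<^sub>F k in sequentially. g k \<notin> F))"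

text \<open>A sequence in \<open>G\<^sup>m\<close> is \<open>g k t\<close> with \<open>t \<in> {1..m}\<close>.\<close>

definition non_degenerated :: "nat \<Rightarrow> (nat \<Rightarrow> nat \<Rightarrow> 'g) \<Rightarrow> bool" where
  "non_degenerated m g \<longleftrightarrow> (\<forall>t\<in>{1..m}. tends_infinity (\<lambda>k. g k t))"

definition ess_distinct ::
  "nat \<Rightarrow> (nat \<Rightarrow> nat \<Rightarrow> 'g::ab_group_add) \<Rightarrow> (nat \<Rightarrow> nat \<Rightarrow> 'g) \<Rightarrow> bool" where
  "ess_distinct m g h \<longleftrightarrow> (\<forall>t\<in>{1..m}. tends_infinity (\<lambda>k. g k t - h k t))"

text \<open>Families of \<open>l\<close> sequences in \<open>G\<^sup>m\<close>, written \<open>g j k t\<close> with \<open>j \<in> {1..l}\<close>.\<close>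

definition nondeg_ess_distinct_family ::
  "nat \<Rightarrow> nat \<Rightarrow> (nat \<Rightarrow> nat \<Rightarrow> nat \<Rightarrow> 'g::ab_group_add) \<Rightarrow> bool" where
  "nondeg_ess_distinct_family l m g \<longleftrightarrow>
     (\<forall>j\<in>{1..l}. non_degenerated m (g j)) \<and>
     (\<forall>i\<in>{1..l}. \<forall>j\<in>{1..l}. i \<noteq> j \<longrightarrow> ess_distinct m (g j) (g i))"

definition nat_subsets :: "nat \<Rightarrow> nat set set" where
  "nat_subsets m = {\<alpha>. \<alpha> \<subseteq> {1..} \<and> finite \<alpha> \<and> card \<alpha> = m}"

text \<open>
  For \<open>\<alpha> = {k\<^sub>1 < \<dots> < k\<^sub>m}\<close> this is \<open>g k\<^sub>1 1 + \<dots> + g k\<^sub>m m\<close>; list positions start at 0.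
\<close>

definition ordered_sum :: "(nat \<Rightarrow> nat \<Rightarrow> 'g::ab_group_add) \<Rightarrow> nat set \<Rightarrow> 'g" where
  "ordered_sum g \<alpha> = (\<Sum>t\<in>{1..card \<alpha>}. g (sorted_list_of_set \<alpha> ! (t - 1)) t)"

text \<open>\<open>before \<beta> \<alpha>\<close> is \<open>\<alpha> > \<beta>\<close>; it is only used for non-empty finite sets.\<close>

definition before :: "nat set \<Rightarrow> nat set \<Rightarrow> bool" where
  "before \<beta> \<alpha> \<longleftrightarrow> Max \<beta> < Min \<alpha>"

definition R_limit :: "nat \<Rightarrow> (nat set \<Rightarrow> 'y::metric_space) \<Rightarrow> 'y \<Rightarrow> bool" where
  "R_limit m x l \<longleftrightarrow>
     (\<forall>\<epsilon>>0. \<exists>\<alpha>\<^sub>0\<in>nat_subsets m. \<forall>\<alpha>\<in>nat_subsets m. before \<alpha>\<^sub>0 \<alpha> \<longrightarrow> dist (x \<alpha>) l < \<epsilon>)"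

section \<open>IP notions\<close>

definition fin_sets :: "nat set set" where
  "fin_sets = {\<alpha>. \<alpha> \<subseteq> {1..} \<and> finite \<alpha> \<and> \<alpha> \<noteq> {}}"

definition fs_tends_infinity :: "(nat set \<Rightarrow> 'g) \<Rightarrow> bool" where
  "fs_tends_infinity x \<longleftrightarrow>
     (\<forall>K. finite K \<longrightarrow> (\<exists>\<alpha>\<^sub>0\<in>fin_sets. \<forall>\<alpha>\<in>fin_sets. before \<alpha>\<^sub>0 \<alpha> \<longrightarrow> x \<alpha> \<notin> K))"

text \<open>The \<open>l\<close> sequences are \<open>g j\<close> with \<open>j \<in> {1..l}\<close>; \<open>g\<^sub>\<alpha>\<close> is the library's \<open>sum g \<alpha>\<close>.\<close>

definition IP_tilde_gen :: "nat \<Rightarrow> (nat \<Rightarrow> nat \<Rightarrow> 'g::ab_group_add) \<Rightarrow> bool" where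
  "IP_tilde_gen l g \<longleftrightarrow>
     (\<forall>j\<in>{1..l}. fs_tends_infinity (\<lambda>\<alpha>. sum (g j) \<alpha>)) \<and>
     (\<forall>i\<in>{1..l}. \<forall>j\<in>{1..l}. i \<noteq> j \<longrightarrow> fs_tends_infinity (\<lambda>\<alpha>. sum (g j) \<alpha> - sum (g i) \<alpha>))"

text \<open>
  \<open>G\<^sup>d\<close> is the set \<open>{1..d} \<rightarrow>\<^sub>E UNIV\<close> of extensional functions.
\<close>

definition IP_tilde_set :: "nat \<Rightarrow> (nat \<Rightarrow> 'g::ab_group_add) set \<Rightarrow> bool" where
  "IP_tilde_set d E \<longleftrightarrow>
     (\<exists>g. IP_tilde_gen d g \<and> E = {(\<lambda>j\<in>{1..d}. sum (g j) \<alpha>) | \<alpha>. \<alpha> \<in> fin_sets})"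

definition IP_tilde_star :: "nat \<Rightarrow> (nat \<Rightarrow> 'g::ab_group_add) set \<Rightarrow> bool" where
  "IP_tilde_star d R \<longleftrightarrow>
     R \<subseteq> ({1..d} \<rightarrow>\<^sub>E UNIV) \<and> (\<forall>E. IP_tilde_set d E \<longrightarrow> R \<inter> E \<noteq> {})"

definition IP_ring :: "nat set set \<Rightarrow> bool" where
  "IP_ring \<R> \<longleftrightarrow>
     (\<exists>a :: nat \<Rightarrow> nat set. (\<forall>k\<ge>1. a k \<in> fin_sets \<and> before (a k) (a (k + 1))) \<and>
        \<R> = {(\<Union>j\<in>\<alpha>. a j) | \<alpha>. \<alpha> \<in> fin_sets})"

definition IP_limit :: "'y topology \<Rightarrow> nat set set \<Rightarrow> (nat set \<Rightarrow> 'y) \<Rightarrow> 'y \<Rightarrow> bool" where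
  "IP_limit Y \<R> x l \<longleftrightarrow> l \<in> topspace Y \<and>
     (\<forall>U. openin Y U \<and> l \<in> U \<longrightarrow> (\<exists>\<alpha>\<^sub>0\<in>\<R>. \<forall>\<alpha>\<in>\<R>. before \<alpha>\<^sub>0 \<alpha> \<longrightarrow> x \<alpha> \<in> U))"

definition mildly_mixing ::
  "'x measure \<Rightarrow> ('g::ab_group_add \<Rightarrow> 'x \<Rightarrow> 'x) \<Rightarrow> bool" where
  "mildly_mixing M T \<longleftrightarrow>
     (\<forall>g :: nat \<Rightarrow> 'g. fs_tends_infinity (\<lambda>\<alpha>. sum g \<alpha>) \<longrightarrow>
        (\<exists>\<R>. IP_ring \<R> \<and>
           (\<forall>f\<in>L2 M. IP_limit (L2_weak M) \<R> (\<lambda>\<alpha>. f \<circ> T (sum g \<alpha>)) (\<lambda>_. LINT x|M. f x))))"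

end

theory Submission
  imports Defs
begin

text \<open>
  Two principles carry the proof.

  The first is Hindman's theorem (\<open>hindman\<close>). It implies that the sets of index sets \<open>\<alpha>\<close> which meet
  every IP-ring, the IP* sets, are closed under finite intersections (\<open>IP_star_Int\<close>), and by a diagonal
  argument that for countably many IP* sets there is one IP-ring which eventually lies in each of
  them (\<open>IP_star_diagonal\<close>). Thus a statement "for every sequence and every single test some \<open>\<alpha>\<close> is
  good" improves itself to "for every sequence there is an IP-ring along which all tests converge":
  the hypothesis applies to the sums over the blocks of every sub-ring, so the good \<open>\<alpha>\<close> form an
  IP* set, and countably many tests suffice because the measure algebra is separable
  (\<open>countable_dense_sets\<close>, \<open>ring_of_IP_star\<close>).

  The second is a van der Corput argument (\<open>van_der_corput\<close>). If \<open>f\<close> is one of the functions in a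
  multiple correlation and has mean zero, mild mixing gives blocks \<open>\<beta>\<^sub>1 < \<dots> < \<beta>\<^sub>N\<close> for which the
  shifts of \<open>f\<close> are almost orthogonal. Splitting \<open>\<alpha> = \<beta>\<^sub>i \<union> \<gamma>\<close> with \<open>\<gamma>\<close> far out and using multiple
  mixing of one order less for the \<open>\<gamma>\<close>-shifts, the product functions belonging to \<open>\<beta>\<^sub>i \<union> \<gamma>\<close> become
  almost orthogonal as well, and Bessel's inequality shows that the correlation is small for some
  \<open>i\<close>. As one good \<open>\<alpha>\<close> is all that the first principle asks for, induction on the number of
  factors proves that (i) implies (v) (\<open>multiple_mixing_sets\<close>).

  The first principle turns (v) into (iv). For generators \<open>a\<^sub>1 < a\<^sub>2 < \<dots>\<close> taken from the IP-ring in (iv),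
  the sequences \<open>k \<mapsto> g\<^sub>a\<^sub>k\<close>, repeated in all components, have the properties in (ii), and with
  \<open>m = 1\<close> those in (iii). Conversely, a sequence in \<open>G\<close> whose finite sums tend to infinity can be
  completed to \<open>l\<close> essentially distinct ones (\<open>IP_tilde_gen_extend\<close>), since new elements can be
  chosen outside finite sets. So (ii) and (iii) provide, for each sequence and each pair of
  sets, one good \<open>\<alpha>\<close>; by the first principle and the density of simple functions this
  is enough for (i) (\<open>mildly_mixing_of_pair_recurrent\<close>).
\<close>

section \<open>Block families and Hindman's theorem\<close>

text \<open>
  An index-free form of IP-rings: an IP-ring is a block family, and a block family contains an
  IP-ring. Block families can be cut down to what lies beyond a given number without choosing
  new generators.
\<close>

definition block_family :: "nat set set \<Rightarrow> bool" where
  "block_family S \<longleftrightarrow> S \<subseteq> fin_sets \<and>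
     (\<forall>\<alpha>\<in>S. \<forall>\<beta>\<in>S. before \<alpha> \<beta> \<longrightarrow> \<alpha> \<union> \<beta> \<in> S) \<and> (\<forall>n. \<exists>\<alpha>\<in>S. n < Min \<alpha>)"

definition block_seq :: "(nat \<Rightarrow> nat set) \<Rightarrow> bool" where
  "block_seq a \<longleftrightarrow> (\<forall>k. a k \<in> fin_sets \<and> before (a k) (a (Suc k)))"

text \<open>
  Index sets lie in \<open>{1..}\<close>, so the generators are \<open>a 1, a 2, \<dots>\<close>.
\<close>

definition finite_unions :: "(nat \<Rightarrow> nat set) \<Rightarrow> nat set set" where
  "finite_unions a = {(\<Union>k\<in>\<alpha>. a k) | \<alpha>. \<alpha> \<in> fin_sets}"

text \<open>
  The notion of largeness in Baumgartner's proof of Hindman's theorem. For \<open>S = fin_sets\<close> it says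
  that \<open>C\<close> meets every IP-ring.
\<close>

definition large :: "nat set set \<Rightarrow> nat set set \<Rightarrow> bool" where
  "large C S \<longleftrightarrow> (\<forall>S'. S' \<subseteq> S \<longrightarrow> block_family S' \<longrightarrow> C \<inter> S' \<noteq> {})"

abbreviation IP_star :: "nat set set \<Rightarrow> bool" where
  "IP_star C \<equiv> large C fin_sets"

lemma fin_setsD: "\<alpha> \<in> fin_sets \<Longrightarrow> finite \<alpha>" "\<alpha> \<in> fin_sets \<Longrightarrow> \<alpha> \<noteq> {}" "\<alpha> \<in> fin_sets \<Longrightarrow> 1 \<le> Min \<alpha>"
proof -
  assume "\<alpha> \<in> fin_sets"
  then have "finite \<alpha>" "\<alpha> \<noteq> {}" "\<alpha> \<subseteq> {1..}" by (auto simp: fin_sets_def)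
  then show "1 \<le> Min \<alpha>" using Min_in[of \<alpha>] by auto
qed (auto simp: fin_sets_def)

lemma empty_fin_sets [simp]: "{} \<notin> fin_sets"
  by (simp add: fin_sets_def)

lemma before_iff:
  assumes "\<alpha> \<in> fin_sets" "\<beta> \<in> fin_sets"
  shows "before \<alpha> \<beta> \<longleftrightarrow> (\<forall>x\<in>\<alpha>. \<forall>y\<in>\<beta>. x < y)"
  using assms by (auto simp: before_def fin_sets_def)

lemma before_trans:
  assumes "\<beta> \<in> fin_sets" "before \<alpha> \<beta>" "before \<beta> \<gamma>"
  shows "before \<alpha> \<gamma>"
  using assms Max_ge[of \<beta> "Min \<beta>"] Min_in[of \<beta>] by (fastforce simp: before_def fin_sets_def)

lemma block_familyD: "block_family S \<Longrightarrow> \<alpha> \<in> S \<Longrightarrow> \<alpha> \<in> fin_sets"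
  by (auto simp: block_family_def)

lemma block_family_unbounded: "block_family S \<Longrightarrow> \<exists>\<alpha>\<in>S. n < Min \<alpha>"
  by (simp add: block_family_def)

lemma UN_fin_sets:
  assumes "finite I" "I \<noteq> {}" "\<And>i. i \<in> I \<Longrightarrow> a i \<in> fin_sets"
  shows "(\<Union>i\<in>I. a i) \<in> fin_sets"
  using assms by (fastforce simp: fin_sets_def)

text \<open>
  Closure under unions of two consecutive blocks gives closure under finite unions: the union of
  all blocks but the last one lies before the last one.
\<close>

lemma UN_in_block_family:
  fixes a :: "nat \<Rightarrow> nat set"
  assumes S: "block_family S" and I: "finite I" "I \<noteq> {}"
    and a: "\<And>i. i \<in> I \<Longrightarrow> a i \<in> S"
    and lt: "\<And>i j. i \<in> I \<Longrightarrow> j \<in> I \<Longrightarrow> i < j \<Longrightarrow> before (a i) (a j)"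
  shows "(\<Union>i\<in>I. a i) \<in> S"
  using I a lt
proof (induction I rule: finite_linorder_max_induct)
  case (insert b I)
  show ?case
  proof (cases "I = {}")
    case False
    have fin: "a i \<in> fin_sets" if "i \<in> insert b I" for i
      using S insert.prems(2)[OF that] by (auto simp: block_family_def)
    have U: "(\<Union>i\<in>I. a i) \<in> S"
      using insert.IH False insert.prems by simp
    have "before (\<Union>i\<in>I. a i) (a b)"
    proof (subst before_iff)
      show "(\<Union>i\<in>I. a i) \<in> fin_sets"
        using U S by (auto simp: block_family_def)
      show "\<forall>x\<in>\<Union> (a ` I). \<forall>y\<in>a b. x < y"
        using insert.prems(3)[of _ b] insert.hyps(2) before_iff[OF fin fin] by blast
    qed (use fin in auto)
    then have "(\<Union>i\<in>I. a i) \<union> a b \<in> S"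
      using S U insert.prems(2)[of b] by (auto simp: block_family_def)
    then show ?thesis by (simp add: Un_commute)
  qed (use insert.prems in auto)
qed simp

lemma block_seq_before:
  assumes "block_seq a" "i < j"
  shows "before (a i) (a j)"
  using \<open>i < j\<close>
proof (induction j rule: less_Suc_induct)
  case (1 i)
  then show ?case using assms by (simp add: block_seq_def)
next
  case (2 i j k)
  then show ?case using assms before_trans by (meson block_seq_def)
qed

lemma block_seq_Min_ge:
  assumes a: "block_seq a"
  shows "k < Min (a k)"
proof (induction k)
  case 0
  then show ?case using a fin_setsD(3)[of "a 0"] by (simp add: block_seq_def)
next
  case (Suc k)
  have "Min (a k) \<le> Max (a k)"
    using a fin_setsD by (simp add: block_seq_def)
  also have "\<dots> < Min (a (Suc k))"
    using a by (simp add: block_seq_def before_def)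
  finally show ?case using Suc by simp
qed

text \<open>
  Passing from index sets to unions of blocks moves minima to the right. Hence conditions "for
  all \<open>\<alpha>\<close> far enough to the right" are inherited by sub-rings with the same bound.
\<close>

lemma Min_UN_block_seq:
  assumes a: "block_seq a" and \<alpha>: "\<alpha> \<in> fin_sets"
  shows "Min \<alpha> < Min (\<Union>k\<in>\<alpha>. a k)"
proof -
  have "(\<Union>k\<in>\<alpha>. a k) \<in> fin_sets"
    using a \<alpha> fin_setsD by (intro UN_fin_sets) (auto simp: block_seq_def)
  then have "Min (\<Union>k\<in>\<alpha>. a k) \<in> (\<Union>k\<in>\<alpha>. a k)"
    by (intro Min_in) (auto dest: fin_setsD)
  then obtain k where k: "k \<in> \<alpha>" "Min (\<Union>k\<in>\<alpha>. a k) \<in> a k" by auto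
  have "Min \<alpha> \<le> k" using k \<alpha> fin_setsD by simp
  also have "k < Min (a k)" using block_seq_Min_ge[OF a] .
  also have "\<dots> \<le> Min (\<Union>k\<in>\<alpha>. a k)"
    using a k by (intro Min_le) (auto simp: block_seq_def fin_setsD)
  finally show ?thesis .
qed

lemma singleton_fin_sets [simp]: "{k} \<in> fin_sets \<longleftrightarrow> 1 \<le> k"
  by (auto simp: fin_sets_def)

lemma Un_fin_sets: "\<alpha> \<in> fin_sets \<Longrightarrow> \<beta> \<in> fin_sets \<Longrightarrow> \<alpha> \<union> \<beta> \<in> fin_sets"
  by (auto simp: fin_sets_def)

lemma block_family_fin_sets: "block_family fin_sets"
proof -
  have "\<exists>\<alpha>\<in>fin_sets. n < Min \<alpha>" for n
    by (rule bexI[of _ "{Suc n}"]) auto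
  then show ?thesis by (auto simp: block_family_def Un_fin_sets)
qed

lemma block_family_finite_unions:
  assumes a: "block_seq a"
  shows "block_family (finite_unions a)"
  unfolding block_family_def
proof (intro conjI ballI impI allI)
  show "finite_unions a \<subseteq> fin_sets"
    using a UN_fin_sets[of _ a] by (auto simp: finite_unions_def block_seq_def fin_setsD)
  show "\<alpha> \<union> \<beta> \<in> finite_unions a" if U: "\<alpha> \<in> finite_unions a" "\<beta> \<in> finite_unions a" for \<alpha> \<beta>
  proof -
    obtain I J where "I \<in> fin_sets" "J \<in> fin_sets" "\<alpha> = (\<Union>k\<in>I. a k)" "\<beta> = (\<Union>k\<in>J. a k)"
      using U by (auto simp: finite_unions_def)
    then show ?thesis
      by (auto simp: finite_unions_def intro!: exI[of _ "I \<union> J"] Un_fin_sets)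
  qed
  show "\<exists>\<alpha>\<in>finite_unions a. n < Min \<alpha>" for n
    using block_seq_Min_ge[OF a, of "Suc n"]
    by (intro bexI[of _ "a (Suc n)"]) (auto simp: finite_unions_def intro!: exI[of _ "{Suc n}"])
qed

lemma finite_unions_subset:
  assumes "block_family S" "block_seq a" "\<And>k. a k \<in> S"
  shows "finite_unions a \<subseteq> S"
  using assms by (auto simp: finite_unions_def fin_setsD intro!: UN_in_block_family block_seq_before)

lemma block_family_tail:
  assumes "block_family S"
  shows "block_family {\<alpha>\<in>S. n < Min \<alpha>}"
  unfolding block_family_def
proof (intro conjI ballI impI allI)
  show "{\<alpha>\<in>S. n < Min \<alpha>} \<subseteq> fin_sets" using assms by (auto simp: block_family_def)
  show "\<alpha> \<union> \<beta> \<in> {\<alpha>\<in>S. n < Min \<alpha>}"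
    if "\<alpha> \<in> {\<alpha>\<in>S. n < Min \<alpha>}" "\<beta> \<in> {\<alpha>\<in>S. n < Min \<alpha>}" "before \<alpha> \<beta>" for \<alpha> \<beta>
  proof -
    have "\<alpha> \<in> fin_sets" "\<beta> \<in> fin_sets" using that assms by (auto simp: block_family_def)
    then have "Min (\<alpha> \<union> \<beta>) = min (Min \<alpha>) (Min \<beta>)"
      by (intro Min_Un) (auto dest: fin_setsD)
    then show ?thesis using that assms by (auto simp: block_family_def)
  qed
  show "\<exists>\<alpha>\<in>{\<alpha>\<in>S. n < Min \<alpha>}. m < Min \<alpha>" for m
    using assms unfolding block_family_def by (metis (mono_tags, lifting) max_less_iff_conj mem_Collect_eq)
qed

lemma block_seq_in_family:
  assumes S: "block_family S"
  obtains a where "block_seq a" "\<And>k. a k \<in> S"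
proof -
  have "\<exists>a. \<forall>n. a n \<in> S \<and> before (a n) (a (Suc n))"
    using S by (intro dependent_nat_choice) (auto simp: block_family_def before_def)
  then obtain a where "\<forall>n. a n \<in> S \<and> before (a n) (a (Suc n))" by blast
  with that[of a] S show thesis by (auto simp: block_seq_def block_family_def)
qed

lemma large_mono:
  assumes "large C S" "S' \<subseteq> S" "C \<inter> S' \<subseteq> C'"
  shows "large C' S'"
  unfolding large_def
proof (intro allI impI)
  fix S'' assume S'': "S'' \<subseteq> S'" "block_family S''"
  then have "C \<inter> S'' \<noteq> {}" using assms(1,2) unfolding large_def by (meson order_trans)
  moreover have "C \<inter> S'' \<subseteq> C' \<inter> S''" using assms(3) S''(1) by auto
  ultimately show "C' \<inter> S'' \<noteq> {}" by auto
qed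

text \<open>
  Largeness is partition regular: if the first part is not large, some subfamily avoids it, and
  within that subfamily the other parts already do the work.
\<close>

lemma large_UN:
  assumes "finite E" "block_family S" "large (\<Union>d\<in>E. K d) S"
  shows "\<exists>d\<in>E. \<exists>S'\<subseteq>S. block_family S' \<and> large (K d) S'"
  using assms
proof (induction E arbitrary: S rule: finite_induct)
  case empty
  then show ?case by (auto simp: large_def)
next
  case (insert e E)
  show ?case
  proof (cases "large (K e) S")
    case False
    then obtain S' where S': "S' \<subseteq> S" "block_family S'" "K e \<inter> S' = {}"
      by (auto simp: large_def)
    have "large (\<Union>d\<in>E. K d) S'"
      using insert.prems(2) S' by (auto intro: large_mono)
    from insert.IH[OF S'(2) this] S' show ?thesis by (meson insertCI order_trans)
  qed (use insert.prems in auto)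
qed

text \<open>
  If no finite \<open>E\<close> worked, one could choose blocks \<open>f 0 < f 1 < \<dots>\<close> in \<open>S\<close> such that no union
  of \<open>f n\<close> with earlier blocks lies in \<open>C\<close>. The pairs \<open>f (2 n) \<union> f (2 n + 1)\<close> would then generate a
  subfamily that avoids \<open>C\<close>: the last block of a finite union of pairs is an \<open>f (2 m + 1)\<close>, and
  it is preceded at least by its partner.
\<close>

lemma large_absorb:
  assumes S: "block_family S" and C: "large C S"
  shows "\<exists>E n. finite E \<and> E \<subseteq> S \<and> (\<forall>x\<in>S. n < Min x \<longrightarrow> (\<exists>d\<in>E. d \<union> x \<in> C))"
proof (rule ccontr)
  assume neg: "\<not> ?thesis"
  have H: "\<exists>x\<in>S. n < Min x \<and> (\<forall>d\<in>E. d \<union> x \<notin> C)" if "finite E" "E \<subseteq> S" for E n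
  proof (rule ccontr)
    assume "\<not> ?thesis"
    then have "\<forall>x\<in>S. n < Min x \<longrightarrow> (\<exists>d\<in>E. d \<union> x \<in> C)" by metis
    with that have "finite E \<and> E \<subseteq> S \<and> (\<forall>x\<in>S. n < Min x \<longrightarrow> (\<exists>d\<in>E. d \<union> x \<in> C))" by (intro conjI)
    then have "\<exists>E n. finite E \<and> E \<subseteq> S \<and> (\<forall>x\<in>S. n < Min x \<longrightarrow> (\<exists>d\<in>E. d \<union> x \<in> C))"
      by (intro exI)
    with neg show False by (rule notE)
  qed
  have "\<exists>f. \<forall>n::nat. f n \<in> S \<and> (\<forall>i<n. before (f i) (f n)) \<and>
      (\<forall>I\<subseteq>{..<n}. I \<noteq> {} \<longrightarrow> (\<Union>i\<in>I. f i) \<union> f n \<notin> C)"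
  proof (rule dependent_wellorder_choice)
    fix n :: nat and f :: "nat \<Rightarrow> nat set"
    assume IH: "\<And>i. i < n \<Longrightarrow> f i \<in> S \<and> (\<forall>j<i. before (f j) (f i)) \<and>
      (\<forall>I\<subseteq>{..<i}. I \<noteq> {} \<longrightarrow> (\<Union>j\<in>I. f j) \<union> f i \<notin> C)"
    let ?E = "(\<lambda>I. \<Union>i\<in>I. f i) ` {I. I \<subseteq> {..<n} \<and> I \<noteq> {}}"
    have "(\<Union>i\<in>I. f i) \<in> S" if "I \<subseteq> {..<n}" "I \<noteq> {}" for I
      using that IH finite_subset[OF that(1)] by (intro UN_in_block_family S) auto
    then have sub: "?E \<subseteq> S" by auto
    have "finite {I. I \<subseteq> {..<n} \<and> I \<noteq> {}}"
      by (rule finite_subset[of _ "Pow {..<n}"]) auto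
    then have fin: "finite ?E" by simp
    define N where "N = Max (insert 0 ((\<lambda>i. Max (f i)) ` {..<n}))"
    have N: "Max (f i) \<le> N" if "i < n" for i using that by (auto simp: N_def)
    obtain x where x: "x \<in> S" "N < Min x" and xE: "\<forall>d\<in>?E. d \<union> x \<notin> C"
      using H[OF fin sub, of N] by metis
    have "(\<Union>i\<in>I. f i) \<union> x \<notin> C" if "I \<subseteq> {..<n}" "I \<noteq> {}" for I
      using that by (intro bspec[OF xE] imageI) simp
    moreover have "before (f i) x" if "i < n" for i
      using N[OF that] x(2) by (simp add: before_def)
    ultimately show "\<exists>x. x \<in> S \<and> (\<forall>i<n. before (f i) x) \<and>
        (\<forall>I\<subseteq>{..<n}. I \<noteq> {} \<longrightarrow> (\<Union>i\<in>I. f i) \<union> x \<notin> C)"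
      using x(1) by blast
  next
    fix r and f g :: "nat \<Rightarrow> nat set" and n :: nat
    assume eq: "\<And>i. i < n \<Longrightarrow> f i = g i"
    have "(\<Union>i\<in>I. f i) = (\<Union>i\<in>I. g i)" if "I \<subseteq> {..<n}" for I
      using that eq by (intro SUP_cong) auto
    with eq show "(r \<in> S \<and> (\<forall>i<n. before (f i) r) \<and> (\<forall>I\<subseteq>{..<n}. I \<noteq> {} \<longrightarrow> (\<Union>i\<in>I. f i) \<union> r \<notin> C)) =
       (r \<in> S \<and> (\<forall>i<n. before (g i) r) \<and> (\<forall>I\<subseteq>{..<n}. I \<noteq> {} \<longrightarrow> (\<Union>i\<in>I. g i) \<union> r \<notin> C))"
      by (intro arg_cong2[of _ _ _ _ "(\<and>)"] refl all_cong1) auto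
  qed
  then obtain f :: "nat \<Rightarrow> nat set" where f: "\<And>n. f n \<in> S \<and> (\<forall>i<n. before (f i) (f n)) \<and>
      (\<forall>I\<subseteq>{..<n}. I \<noteq> {} \<longrightarrow> (\<Union>i\<in>I. f i) \<union> f n \<notin> C)" by metis
  have fS: "f n \<in> S" for n using f by blast
  have fb: "before (f i) (f n)" if "i < n" for i n using f that by blast
  have fC: "(\<Union>i\<in>I. f i) \<union> f n \<notin> C" if "I \<subseteq> {..<n}" "I \<noteq> {}" for n I using f that by blast
  have ff: "f n \<in> fin_sets" for n using fS S by (auto simp: block_family_def)
  define y where "y n = f (2*n) \<union> f (2*n+1)" for n
  have yS: "y n \<in> S" for n
    using S fS fb[of "2*n" "2*n+1"] by (auto simp: y_def block_family_def)
  have yf: "y n \<in> fin_sets" for n using yS S by (auto simp: block_family_def)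
  have fb': "x < z" if "x \<in> f i" "z \<in> f j" "i < j" for x z i j
    using fb[OF \<open>i < j\<close>] before_iff[OF ff ff] that by blast
  have "before (y n) (y (Suc n))" for n
    unfolding before_iff[OF yf yf] by (auto simp: y_def intro: fb')
  with yf have y: "block_seq y" by (simp add: block_seq_def)
  have "C \<inter> finite_unions y \<noteq> {}"
    using C block_family_finite_unions[OF y] finite_unions_subset[OF S y yS] unfolding large_def by blast
  then obtain \<alpha> where \<alpha>: "\<alpha> \<in> fin_sets" "(\<Union>n\<in>\<alpha>. y n) \<in> C" by (auto simp: finite_unions_def)
  define m where "m = Max \<alpha>"
  have m: "m \<in> \<alpha>" "\<And>k. k \<in> \<alpha> \<Longrightarrow> k \<le> m"
    using \<alpha> by (auto simp: m_def fin_setsD)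
  \<comment> \<open>The last pair contributes its second half \<open>f (2m+1)\<close>, all other pieces come before it.\<close>
  define I where "I = ((\<lambda>k. 2*k) ` \<alpha>) \<union> ((\<lambda>k. 2*k+1) ` (\<alpha> - {m}))"
  have "(\<Union>n\<in>\<alpha>. y n) = (\<Union>i\<in>I. f i) \<union> f (2*m+1)"
    using m by (auto simp: I_def y_def)
  moreover have "I \<subseteq> {..<2*m+1}"
  proof
    fix i assume "i \<in> I"
    then show "i \<in> {..<2*m+1}"
      using m(2) by (fastforce simp: I_def)
  qed
  moreover have "I \<noteq> {}" using m by (auto simp: I_def)
  ultimately show False using fC \<alpha>(2) by metis
qed

text \<open>
  The finitely many shifts from the previous lemma cover the large set \<open>C\<close> beyond them, so one of
  the shifted sets is large by partition regularity.
\<close>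

lemma large_shift:
  assumes S: "block_family S" and C: "large C S"
  shows "\<exists>d\<in>S. \<exists>S'\<subseteq>S. block_family S' \<and> (\<forall>x\<in>S'. before d x) \<and> large {x\<in>C. d \<union> x \<in> C} S'"
proof -
  obtain E n where E: "finite E" "E \<subseteq> S" "\<And>x. x \<in> S \<Longrightarrow> n < Min x \<Longrightarrow> \<exists>d\<in>E. d \<union> x \<in> C"
    using large_absorb[OF assms] by blast
  define N where "N = Max (insert n (Max ` E))"
  have N: "n \<le> N" "\<And>d. d \<in> E \<Longrightarrow> Max d \<le> N" using E(1) by (auto simp: N_def)
  let ?S = "{x\<in>S. N < Min x}"
  have "C \<inter> ?S \<subseteq> (\<Union>d\<in>E. {x\<in>C. d \<union> x \<in> C})"
    using E(3) N(1) by fastforce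
  then have "large (\<Union>d\<in>E. {x\<in>C. d \<union> x \<in> C}) ?S"
    by (rule large_mono[OF C, rotated]) auto
  from large_UN[OF E(1) block_family_tail[OF S] this]
  obtain d S' where "d \<in> E" "S' \<subseteq> ?S" "block_family S'" "large {x\<in>C. d \<union> x \<in> C} S'" by auto
  with E N show ?thesis
    by (intro bexI[of _ d] exI[of _ S']) (fastforce simp: before_def)+
qed

text \<open>
  Hindman's finite unions theorem, following Baumgartner. Iterating the previous lemma gives blocks
  \<open>d 0 < d 1 < \<dots>\<close> and sets \<open>C = Cs 0 \<supseteq> Cs 1 \<supseteq> \<dots>\<close>, large in smaller and smaller families, such that elements of
  \<open>Cs n\<close> stay in \<open>C\<close> after adding any union of \<open>d 0, \<dots>, d (n - 1)\<close>. Largeness of \<open>Cs k\<close> provides a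
  union \<open>e\<close> of some \<open>d i\<close> with \<open>i \<ge> k\<close> that lies in \<open>Cs k\<close>; doing this with \<open>k\<close> beyond all
  indices used before, every finite union of the resulting \<open>e j\<close> is the last \<open>e j\<close> plus a union of
  earlier \<open>d i\<close>, hence lies in \<open>C\<close>.
\<close>

theorem hindman:
  assumes S: "block_family S" and C: "large C S"
  shows "\<exists>S'\<subseteq>S \<inter> C. block_family S'"
proof -
  (* States are triples of a large set, the family it is large in, and the next shift. *)
  define P where "P = (\<lambda>(C, S, d). block_family S \<and> large C S \<and> d \<in> S \<and>
    (\<exists>S'\<subseteq>S. block_family S' \<and> (\<forall>x\<in>S'. before d x) \<and> large {x\<in>C. d \<union> x \<in> C} S'))"
  define Q :: "nat set set \<times> nat set set \<times> nat set \<Rightarrow> nat set set \<times> nat set set \<times> nat set \<Rightarrow> bool" 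
    where "Q = (\<lambda>(C, S, d) (C', S', d'). S' \<subseteq> S \<and> (\<forall>x\<in>S'. before d x) \<and> C' = {x\<in>C. d \<union> x \<in> C})"
  obtain d0 where d0: "P (C, S, d0)"
    using large_shift[OF S C] S C by (auto simp: P_def)
  have "\<exists>f. \<forall>n::nat. (P (f n) \<and> (n = 0 \<longrightarrow> fst (f n) = C \<and> fst (snd (f n)) = S)) \<and> Q (f n) (f (Suc n))"
  proof (rule dependent_nat_choice)
    show "\<exists>x. P x \<and> ((0::nat) = 0 \<longrightarrow> fst x = C \<and> fst (snd x) = S)"
      using d0 by auto
  next
    fix x :: "nat set set \<times> nat set set \<times> nat set" and n :: nat
    assume "P x \<and> (n = 0 \<longrightarrow> fst x = C \<and> fst (snd x) = S)"
    then obtain C1 S1 d1 S' where x: "x = (C1, S1, d1)" and 1: "S' \<subseteq> S1" "block_family S'" 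
      "\<forall>x\<in>S'. before d1 x" "large {x\<in>C1. d1 \<union> x \<in> C1} S'"
      by (cases x) (auto simp: P_def)
    from large_shift[OF 1(2,4)] obtain d' where "P ({x\<in>C1. d1 \<union> x \<in> C1}, S', d')"
      using 1 by (auto simp: P_def)
    then show "\<exists>y. (P y \<and> (Suc n = 0 \<longrightarrow> fst y = C \<and> fst (snd y) = S)) \<and> Q x y"
      using 1 x by (intro exI[of _ "({x\<in>C1. d1 \<union> x \<in> C1}, S', d')"]) (auto simp: Q_def)
  qed
  then obtain f where f: "\<And>n. P (f n)" "\<And>n. Q (f n) (f (Suc n))" "fst (f 0) = C" "fst (snd (f 0)) = S"
    by blast
  define Cs Ss d where "Cs n = fst (f n)" and "Ss n = fst (snd (f n))" and "d n = snd (snd (f n))" for n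
  have P: "block_family (Ss n)" "large (Cs n) (Ss n)" "d n \<in> Ss n" for n
    using f(1)[of n] by (auto simp: P_def Cs_def Ss_def d_def split: prod.splits)
  have Q: "Ss (Suc n) \<subseteq> Ss n" "\<And>x. x \<in> Ss (Suc n) \<Longrightarrow> before (d n) x" 
    "Cs (Suc n) = {x\<in>Cs n. d n \<union> x \<in> Cs n}" for n
    using f(2)[of n] by (auto simp: Q_def Cs_def Ss_def d_def split: prod.splits)
  have 0: "Cs 0 = C" "Ss 0 = S" using f by (auto simp: Cs_def Ss_def)
  have mono: "Ss j \<subseteq> Ss i" if "i \<le> j" for i j
    using Q(1) that by (rule lift_Suc_antimono_le)
  have dfin: "d n \<in> fin_sets" for n using P(1,3) by (rule block_familyD)
  have dseq: "block_seq (\<lambda>i. d (k + i))" for k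
    using dfin Q(2) P(3) by (auto simp: block_seq_def)
  have dlt: "x < y" if "x \<in> d i" "y \<in> d j" "i < j" for x y i j
    using block_seq_before[OF dseq[of 0] \<open>i < j\<close>] before_iff[OF dfin dfin] that by auto
  \<comment> \<open>Membership in \<open>Cs n\<close> means being in \<open>C\<close> after adding any union of the first \<open>n\<close> shifts.\<close>
  have absorb: "x \<union> (\<Union>i\<in>I. d i) \<in> C" if "x \<in> Cs n" "I \<subseteq> {..<n}" for x n I
    using that
  proof (induction n arbitrary: x I)
    case 0
    then show ?case using \<open>Cs 0 = C\<close> by simp
  next
    case (Suc n)
    have x: "x \<in> Cs n" "d n \<union> x \<in> Cs n" using Suc.prems(1) Q(3) by auto
    have I: "I - {n} \<subseteq> {..<n}" using Suc.prems(2) by (auto simp: less_Suc_eq)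
    show ?case
    proof (cases "n \<in> I")
      case True
      then have "x \<union> (\<Union>i\<in>I. d i) = (d n \<union> x) \<union> (\<Union>i\<in>I-{n}. d i)" by auto
      then show ?thesis using Suc.IH[OF x(2) I] by simp
    next
      case False
      then show ?thesis using Suc.IH[OF x(1) I] by simp
    qed
  qed
  have "\<exists>J. finite J \<and> J \<noteq> {} \<and> J \<subseteq> {k..} \<and> (\<Union>i\<in>J. d i) \<in> Cs k" for k
  proof -
    have "finite_unions (\<lambda>i. d (k + i)) \<subseteq> Ss k"
      using mono P(3) by (intro finite_unions_subset P dseq) (metis le_add1 subsetD)
    with P(2)[of k] block_family_finite_unions[OF dseq] have "Cs k \<inter> finite_unions (\<lambda>i. d (k + i)) \<noteq> {}"
      by (auto simp: large_def)
    then obtain \<alpha> where "\<alpha> \<in> fin_sets" "(\<Union>i\<in>\<alpha>. d (k + i)) \<in> Cs k" by (auto simp: finite_unions_def)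
    then show ?thesis
      by (intro exI[of _ "(\<lambda>i. k + i) ` \<alpha>"]) (auto simp: fin_setsD image_image)
  qed
  then obtain J where J: "\<And>k. finite (J k)" "\<And>k. J k \<noteq> {}" "\<And>k. J k \<subseteq> {k..}"
     "\<And>k. (\<Union>i\<in>J k. d i) \<in> Cs k" by metis
  define kk where "kk = rec_nat 0 (\<lambda>_ k. Suc (Max (J k)))"
  have kk: "kk (Suc j) = Suc (Max (J (kk j)))" for j by (simp add: kk_def)
  have Jlt: "i < kk (Suc j)" if "i \<in> J (kk j)" for i j
    using that J(1) by (simp add: kk less_Suc_eq_le)
  have kkmono: "kk i \<le> kk j" if "i \<le> j" for i j
  proof (rule lift_Suc_mono_le[OF _ that])
    show "kk n \<le> kk (Suc n)" for n
      using Jlt J(2,3) by (metis all_not_in_conv atLeast_iff less_imp_le_nat order_le_less_trans subsetD)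
  qed
  define e where "e j = (\<Union>i\<in>J (kk j). d i)" for j
  have eS: "e j \<in> S" for j
    unfolding e_def
    using P(3) mono[of 0] 0 J by (intro UN_in_block_family[OF S] block_seq_before[OF dseq[of 0, simplified]]) auto
  have efin: "e j \<in> fin_sets" for j using S eS by (rule block_familyD)
  have "before (e j) (e (Suc j))" for j
    unfolding before_iff[OF efin efin]
    using Jlt J(3)[of "kk (Suc j)"] by (fastforce simp: e_def intro: dlt)
  with efin have e: "block_seq e" by (simp add: block_seq_def)
  have "finite_unions e \<subseteq> C"
  proof
    fix x assume "x \<in> finite_unions e"
    then obtain \<alpha> where \<alpha>: "\<alpha> \<in> fin_sets" "x = (\<Union>n\<in>\<alpha>. e n)" by (auto simp: finite_unions_def)
    define m where "m = Max \<alpha>"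
    have m: "m \<in> \<alpha>" "\<And>k. k \<in> \<alpha> \<Longrightarrow> k \<le> m"
      using \<alpha> by (auto simp: m_def fin_setsD)
    have "(\<Union>j\<in>\<alpha>-{m}. J (kk j)) \<subseteq> {..<kk m}"
    proof
      fix i assume "i \<in> (\<Union>j\<in>\<alpha>-{m}. J (kk j))"
      then obtain j where "j \<in> \<alpha>" "j \<noteq> m" "i \<in> J (kk j)" by auto
      then show "i \<in> {..<kk m}"
        using Jlt[of i j] kkmono[of "Suc j" m] m(2)[of j] by auto
    qed
    with J(4) have "e m \<union> (\<Union>i\<in>(\<Union>j\<in>\<alpha>-{m}. J (kk j)). d i) \<in> C"
      unfolding e_def by (rule absorb)
    moreover have "e m \<union> (\<Union>i\<in>(\<Union>j\<in>\<alpha>-{m}. J (kk j)). d i) = x"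
      using m \<alpha> by (auto simp: e_def)
    ultimately show "x \<in> C" by simp
  qed
  with block_family_finite_unions[OF e] finite_unions_subset[OF S e eS] show ?thesis
    by (intro exI[of _ "finite_unions e"]) auto
qed

lemma largeD: "large C S \<Longrightarrow> S' \<subseteq> S \<Longrightarrow> block_family S' \<Longrightarrow> C \<inter> S' \<noteq> {}"
  unfolding large_def by blast

lemma block_family_subset: "block_family S \<Longrightarrow> S \<subseteq> fin_sets"
  by (simp add: block_family_def)

lemma IP_star_large:
  assumes "IP_star B" "block_family S"
  shows "large B S"
  by (rule large_mono[OF assms(1) block_family_subset[OF assms(2)]]) simp

text \<open>
  This is where Hindman's theorem enters: inside any block family there is one contained in \<open>B\<close>,
  and \<open>C\<close> meets it.
\<close>

lemma IP_star_Int: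
  assumes B: "IP_star B" and C: "IP_star C"
  shows "IP_star (B \<inter> C)"
  unfolding large_def
proof (intro allI impI)
  fix S assume S: "S \<subseteq> fin_sets" "block_family S"
  obtain S' where S': "S' \<subseteq> S \<inter> B" "block_family S'"
    using hindman[OF S(2) IP_star_large[OF B S(2)]] by auto
  have "C \<inter> S' \<noteq> {}"
    using C block_family_subset[OF S'(2)] S'(2) by (rule largeD)
  with S'(1) show "B \<inter> C \<inter> S \<noteq> {}" by auto
qed

lemma IP_star_INT:
  assumes "finite I" "\<And>i. i \<in> I \<Longrightarrow> IP_star (B i)"
  shows "IP_star (\<Inter>i\<in>I. B i)"
  using assms
proof (induction I rule: finite_induct)
  case empty
  have "S \<noteq> {}" if "block_family S" for S using that by (auto simp: block_family_def)
  then show ?case by (auto simp: large_def)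
next
  case (insert i I)
  then have "IP_star (B i \<inter> (\<Inter>i\<in>I. B i))" by (intro IP_star_Int) simp_all
  then show ?case by simp
qed

lemma IP_star_mono: "IP_star B \<Longrightarrow> B \<inter> fin_sets \<subseteq> C \<Longrightarrow> IP_star C"
  by (rule large_mono[OF _ order_refl])

lemma IP_starD:
  assumes "IP_star B" "block_family S"
  shows "\<exists>\<alpha>\<in>S. \<alpha> \<in> B \<and> n < Min \<alpha>"
proof -
  have "B \<inter> {\<alpha>\<in>S. n < Min \<alpha>} \<noteq> {}"
    using block_family_tail[OF assms(2), of n]
    by (intro largeD[OF assms(1)]) (auto dest: block_family_subset)
  then show ?thesis by auto
qed

text \<open>
  It is enough to find one index set for every sub-ring. Statements that are quantified over all
  sequences in the group apply to the sums over the blocks of the sub-ring.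
\<close>

lemma IP_starI:
  assumes "\<And>a. block_seq a \<Longrightarrow> \<exists>\<alpha>\<in>fin_sets. (\<Union>k\<in>\<alpha>. a k) \<in> B"
  shows "IP_star B"
  unfolding large_def
proof (intro allI impI)
  fix S assume "S \<subseteq> fin_sets" and S: "block_family S"
  obtain a where a: "block_seq a" "\<And>k. a k \<in> S" using block_seq_in_family[OF S] by metis
  from assms[OF a(1)] finite_unions_subset[OF S a] show "B \<inter> S \<noteq> {}" by (auto simp: finite_unions_def)
qed

text \<open>
  Choose decreasing block families with the \<open>n\<close>-th one inside \<open>B n\<close>, and one generator from each.
\<close>

lemma IP_star_diagonal:
  fixes B :: "nat \<Rightarrow> nat set set"
  assumes B: "\<And>n. IP_star (B n)"
  shows "\<exists>a. block_seq a \<and> (\<forall>n. \<forall>\<alpha>\<in>fin_sets. n < Min \<alpha> \<longrightarrow> (\<Union>k\<in>\<alpha>. a k) \<in> B n)"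
proof -
  define P where "P n X = (block_family (fst X) \<and> fst X \<subseteq> B n \<and> snd X \<in> fst X)" for n X
  define Q where "Q X Y = (fst Y \<subseteq> fst X \<and> before (snd X) (snd Y))" 
    for X Y :: "nat set set \<times> nat set"
  have step: "\<exists>Y. P n Y \<and> fst Y \<subseteq> S \<and> m < Min (snd Y)" if S: "block_family S" for n S m
  proof -
    obtain S' where S': "S' \<subseteq> S \<inter> B n" "block_family S'"
      using hindman[OF S IP_star_large[OF B S], of n] by auto
    obtain \<alpha> where "\<alpha> \<in> S'" "m < Min \<alpha>" using block_family_unbounded[OF S'(2)] by metis
    with S' show ?thesis by (intro exI[of _ "(S', \<alpha>)"]) (auto simp: P_def)
  qed
  have "\<exists>f. \<forall>n. P n (f n) \<and> Q (f n) (f (Suc n))"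
  proof (rule dependent_nat_choice)
    show "\<exists>x. P 0 x" using step[OF block_family_fin_sets, of 0 0] by auto
    show "\<exists>y. P (Suc n) y \<and> Q x y" if x: "P n x" for x n
    proof -
      have "block_family (fst x)" using x by (simp add: P_def)
      from step[OF this, of "Suc n" "Max (snd x)"] show ?thesis
        unfolding Q_def before_def by metis
    qed
  qed
  then obtain f where f: "\<And>n. P n (f n)" "\<And>n. Q (f n) (f (Suc n))" by metis
  define a where "a n = snd (f n)" for n
  have afin: "a n \<in> fin_sets" for n
    using f(1)[of n] block_familyD[of "fst (f n)"] by (simp add: P_def a_def)
  have a: "block_seq a" using afin f(2) by (auto simp: block_seq_def Q_def a_def)
  have mono: "fst (f j) \<subseteq> fst (f i)" if "i \<le> j" for i j
    using f(2) by (intro lift_Suc_antimono_le[OF _ that]) (auto simp: Q_def)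
  have "(\<Union>k\<in>\<alpha>. a k) \<in> B n" if \<alpha>: "\<alpha> \<in> fin_sets" "n < Min \<alpha>" for n \<alpha>
  proof -
    have "a k \<in> fst (f n)" if "k \<in> \<alpha>" for k
      using mono[of n k] f(1)[of k] that \<alpha> Min_le[of \<alpha> k] by (fastforce simp: P_def a_def fin_setsD)
    then have "(\<Union>k\<in>\<alpha>. a k) \<in> fst (f n)"
      using f(1)[of n] \<alpha> 
      by (intro UN_in_block_family block_seq_before[OF a]) (auto simp: P_def fin_setsD)
    then show ?thesis using f(1)[of n] by (auto simp: P_def)
  qed
  with a show ?thesis by blast
qed

section \<open>Sums and limits along IP-rings\<close>

lemma IP_ring_finite_unions: "block_seq a \<Longrightarrow> IP_ring (finite_unions a)"
  by (auto simp: IP_ring_def finite_unions_def block_seq_def intro!: exI[of _ a])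

lemma block_family_IP_ring:
  assumes "IP_ring R"
  shows "block_family R"
proof -
  obtain a where a: "\<And>k. k \<ge> 1 \<Longrightarrow> a k \<in> fin_sets \<and> before (a k) (a (k + 1))"
    and R: "R = {(\<Union>j\<in>\<alpha>. a j) | \<alpha>. \<alpha> \<in> fin_sets}"
    using assms by (auto simp: IP_ring_def)
  have b: "block_seq (\<lambda>k. a (Suc k))" using a by (simp add: block_seq_def)
  show ?thesis unfolding block_family_def
  proof (intro conjI ballI impI allI)
    show "R \<subseteq> fin_sets"
      using a by (auto simp: R fin_setsD intro!: UN_fin_sets) (auto simp: fin_sets_def)
    show "\<alpha> \<union> \<beta> \<in> R" if U: "\<alpha> \<in> R" "\<beta> \<in> R" for \<alpha> \<beta>
    proof -
      obtain I J where "I \<in> fin_sets" "J \<in> fin_sets" "\<alpha> = (\<Union>k\<in>I. a k)" "\<beta> = (\<Union>k\<in>J. a k)"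
        using U by (auto simp: R)
      then show ?thesis
        by (auto simp: R intro!: exI[of _ "I \<union> J"] Un_fin_sets)
    qed
    show "\<exists>\<alpha>\<in>R. n < Min \<alpha>" for n
      using block_seq_Min_ge[OF b, of n]
      by (intro bexI[of _ "a (Suc n)"]) (auto simp: R intro!: exI[of _ "{Suc n}"])
  qed
qed

text \<open>
  Turns limits along IP-rings into limits along a filter, so that the calculus of limits applies.
\<close>

definition IP_filter :: "nat set set \<Rightarrow> nat set filter" where
  "IP_filter R = (INF n. principal {\<alpha>\<in>R. n < Min \<alpha>})"

lemma eventually_IP_filter: "eventually P (IP_filter R) \<longleftrightarrow> (\<exists>n. \<forall>\<alpha>\<in>R. n < Min \<alpha> \<longrightarrow> P \<alpha>)"
  unfolding IP_filter_def
proof (subst eventually_INF_base)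
  show "\<exists>k\<in>UNIV. principal {\<alpha>\<in>R. k < Min \<alpha>}
      \<le> inf (principal {\<alpha>\<in>R. m < Min \<alpha>}) (principal {\<alpha>\<in>R. n < Min \<alpha>})" for m n
    by (rule bexI[of _ "max m n"]) auto
qed (auto simp: eventually_principal)

text \<open>
  A union of blocks that starts beyond the first \<open>n\<close> blocks uses only blocks with larger index.
\<close>

lemma eventually_IP_filter_finite_unions:
  assumes a: "block_seq a" and P: "\<And>\<beta>. \<beta> \<in> fin_sets \<Longrightarrow> n < Min \<beta> \<Longrightarrow> P (\<Union>k\<in>\<beta>. a k)"
  shows "eventually P (IP_filter (finite_unions a))"
proof -
  have af: "a k \<in> fin_sets" for k using a by (simp add: block_seq_def)
  define m where "m = Max (\<Union>k\<le>n. a k)"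
  have m: "x \<le> m" if "x \<in> a k" "k \<le> n" for x k
    unfolding m_def using that af fin_setsD by (intro Max_ge) auto
  have "P \<alpha>" if \<alpha>: "\<alpha> \<in> finite_unions a" "m < Min \<alpha>" for \<alpha>
  proof -
    obtain \<beta> where \<beta>: "\<beta> \<in> fin_sets" "\<alpha> = (\<Union>k\<in>\<beta>. a k)" using \<alpha>(1) by (auto simp: finite_unions_def)
    have b: "finite \<beta>" "\<beta> \<noteq> {}" using \<beta> fin_setsD by auto
    have "n < Min \<beta>"
    proof (rule ccontr)
      assume "\<not> n < Min \<beta>"
      then have 1: "Min \<beta> \<le> n" "Min \<beta> \<in> \<beta>" using Min_in[OF b] by linarith+
      have "a (Min \<beta>) \<noteq> {}" using af fin_setsD by blast
      then obtain x where x: "x \<in> a (Min \<beta>)" by auto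
      have "finite \<alpha>" using \<beta> b af fin_setsD by auto
      moreover have "x \<in> \<alpha>" using x 1 \<beta> by auto
      ultimately have "Min \<alpha> \<le> x" by simp
      with m[OF x 1(1)] \<alpha>(2) show False by simp
    qed
    with P \<beta> show ?thesis by simp
  qed
  then show ?thesis by (auto simp: eventually_IP_filter)
qed

text \<open>
  A threshold \<open>\<alpha>\<^sub>0\<close> may be replaced by its maximum, and a number \<open>n\<close> by any member beyond \<open>n\<close>.
\<close>

lemma beyond_iff_before:
  assumes S: "block_family S"
  shows "(\<exists>n. \<forall>\<alpha>\<in>S. n < Min \<alpha> \<longrightarrow> P \<alpha>) \<longleftrightarrow> (\<exists>\<alpha>\<^sub>0\<in>S. \<forall>\<alpha>\<in>S. before \<alpha>\<^sub>0 \<alpha> \<longrightarrow> P \<alpha>)"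
proof safe
  fix n assume n: "\<forall>\<alpha>\<in>S. n < Min \<alpha> \<longrightarrow> P \<alpha>"
  obtain \<alpha>\<^sub>0 where a0: "\<alpha>\<^sub>0 \<in> S" "n < Min \<alpha>\<^sub>0" using block_family_unbounded[OF S] by metis
  moreover have "Min \<alpha>\<^sub>0 \<le> Max \<alpha>\<^sub>0" using fin_setsD[OF block_familyD[OF S a0(1)]] by simp
  ultimately show "\<exists>\<alpha>\<^sub>0\<in>S. \<forall>\<alpha>\<in>S. before \<alpha>\<^sub>0 \<alpha> \<longrightarrow> P \<alpha>"
    using n by (intro bexI[of _ \<alpha>\<^sub>0]) (auto simp: before_def)
qed (auto simp: before_def)

lemma IP_limit_iff: "IP_ring R \<Longrightarrow> IP_limit Y R x y \<longleftrightarrow> limitin Y x y (IP_filter R)"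
  unfolding IP_limit_def limitin_def eventually_IP_filter 
  by (simp add: beyond_iff_before[OF block_family_IP_ring])

lemma fs_tends_infinity_iff:
  "fs_tends_infinity x \<longleftrightarrow> (\<forall>K. finite K \<longrightarrow> (\<exists>n. \<forall>\<alpha>\<in>fin_sets. n < Min \<alpha> \<longrightarrow> x \<alpha> \<notin> K))"
  unfolding fs_tends_infinity_def by (simp add: beyond_iff_before[OF block_family_fin_sets])

lemma fs_tends_infinityD:
  "fs_tends_infinity x \<Longrightarrow> finite K \<Longrightarrow> \<exists>n. \<forall>\<alpha>\<in>fin_sets. n < Min \<alpha> \<longrightarrow> x \<alpha> \<notin> K"
  by (simp add: fs_tends_infinity_iff)

lemma sum_UN_blocks:
  fixes g :: "nat \<Rightarrow> 'g::ab_group_add"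
  assumes a: "block_seq a" and \<alpha>: "\<alpha> \<in> fin_sets"
  shows "sum g (\<Union>k\<in>\<alpha>. a k) = (\<Sum>k\<in>\<alpha>. sum g (a k))"
proof (rule sum.UNION_disjoint)
  have fin: "a i \<in> fin_sets" for i using a by (simp add: block_seq_def)
  show "\<forall>i\<in>\<alpha>. \<forall>j\<in>\<alpha>. i \<noteq> j \<longrightarrow> a i \<inter> a j = {}"
  proof (intro ballI impI)
    fix i j :: nat assume "i \<noteq> j"
    then have "before (a i) (a j) \<or> before (a j) (a i)"
      using block_seq_before[OF a] by (meson linorder_neqE_nat)
    then show "a i \<inter> a j = {}" using before_iff[OF fin fin] by (auto dest: less_asym)
  qed
qed (use a \<alpha> in \<open>auto simp: block_seq_def fin_setsD\<close>)

lemma fs_tends_infinity_blocks: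
  assumes a: "block_seq a" and x: "fs_tends_infinity x"
  shows "fs_tends_infinity (\<lambda>\<alpha>. x (\<Union>k\<in>\<alpha>. a k))"
  unfolding fs_tends_infinity_iff
proof (intro allI impI)
  fix K :: "'a set" assume K: "finite K"
  then obtain n where n: "\<And>\<alpha>. \<alpha> \<in> fin_sets \<Longrightarrow> n < Min \<alpha> \<Longrightarrow> x \<alpha> \<notin> K"
    using fs_tends_infinityD[OF x K] by metis
  have "x (\<Union>k\<in>\<alpha>. a k) \<notin> K" if "\<alpha> \<in> fin_sets" "n < Min \<alpha>" for \<alpha>
  proof (rule n)
    show "(\<Union>k\<in>\<alpha>. a k) \<in> fin_sets"
      using that a by (intro UN_fin_sets) (auto simp: block_seq_def fin_setsD)
    show "n < Min (\<Union>k\<in>\<alpha>. a k)"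
      using that(2) Min_UN_block_seq[OF a that(1)] by (rule less_trans)
  qed
  then show "\<exists>n. \<forall>\<alpha>\<in>fin_sets. n < Min \<alpha> \<longrightarrow> x (\<Union>k\<in>\<alpha>. a k) \<notin> K" by blast
qed

lemma fs_tends_infinity_cong:
  "(\<And>\<alpha>. \<alpha> \<in> fin_sets \<Longrightarrow> x \<alpha> = y \<alpha>) \<Longrightarrow> fs_tends_infinity x = fs_tends_infinity y"
  by (simp add: fs_tends_infinity_iff)

lemma fs_tends_infinity_uminus:
  fixes x :: "nat set \<Rightarrow> 'g::ab_group_add"
  assumes "fs_tends_infinity x" shows "fs_tends_infinity (\<lambda>\<alpha>. - x \<alpha>)"
  unfolding fs_tends_infinity_iff
proof (intro allI impI)
  fix K :: "'g set" assume "finite K"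
  then obtain n where "\<forall>\<alpha>\<in>fin_sets. n < Min \<alpha> \<longrightarrow> x \<alpha> \<notin> uminus ` K"
    using fs_tends_infinityD[OF assms, of "uminus ` K"] by auto
  then show "\<exists>n. \<forall>\<alpha>\<in>fin_sets. n < Min \<alpha> \<longrightarrow> - x \<alpha> \<notin> K"
    by (metis image_eqI minus_minus)
qed

lemma tends_infinity_blocks:
  assumes a: "block_seq a" and x: "fs_tends_infinity x"
  shows "tends_infinity (\<lambda>k. x (a k))"
  unfolding tends_infinity_def
proof (intro allI impI)
  fix F :: "'a set" assume F: "finite F"
  then obtain n where n: "\<And>\<alpha>. \<alpha> \<in> fin_sets \<Longrightarrow> n < Min \<alpha> \<Longrightarrow> x \<alpha> \<notin> F"
    using fs_tends_infinityD[OF x F] by metis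
  show "\<forall>\<^sub>F k in sequentially. x (a k) \<notin> F"
    using eventually_ge_at_top[of n]
  proof eventually_elim
    case (elim k)
    show ?case
      using elim block_seq_Min_ge[OF a, of k] a by (intro n) (auto simp: block_seq_def)
  qed
qed

lemma IP_tilde_gen_blocks:
  assumes a: "block_seq a" and g: "IP_tilde_gen l g"
  shows "IP_tilde_gen l (\<lambda>j k. sum (g j) (a k))"
proof -
  have eq: "(\<Sum>k\<in>\<alpha>. sum (g j) (a k)) = sum (g j) (\<Union>k\<in>\<alpha>. a k)" if "\<alpha> \<in> fin_sets" for \<alpha> j
    using sum_UN_blocks[OF a that, of "g j"] by simp
  have "fs_tends_infinity (\<lambda>\<alpha>. \<Sum>k\<in>\<alpha>. sum (g j) (a k))" if "fs_tends_infinity (\<lambda>\<alpha>. sum (g j) \<alpha>)" for j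
    using fs_tends_infinity_blocks[OF a that] by (subst fs_tends_infinity_cong) (auto simp: eq)
  moreover have "fs_tends_infinity (\<lambda>\<alpha>. (\<Sum>k\<in>\<alpha>. sum (g j) (a k)) - (\<Sum>k\<in>\<alpha>. sum (g i) (a k)))" 
    if "fs_tends_infinity (\<lambda>\<alpha>. sum (g j) \<alpha> - sum (g i) \<alpha>)" for i j
    using fs_tends_infinity_blocks[OF a that] by (subst fs_tends_infinity_cong) (auto simp: eq)
  ultimately show ?thesis using g by (auto simp: IP_tilde_gen_def)
qed

text \<open>
  For a sequence in \<open>G\<^sup>m\<close> with equal components the ordered sum is the ordinary sum.
\<close>

lemma sum_sorted_list_nth:
  fixes \<alpha> :: "nat set" and f :: "nat \<Rightarrow> 'b::comm_monoid_add"
  assumes "finite \<alpha>"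
  shows "(\<Sum>t\<in>{1..card \<alpha>}. f (sorted_list_of_set \<alpha> ! (t - 1))) = sum f \<alpha>"
proof -
  have "(\<Sum>t\<in>{1..card \<alpha>}. f (sorted_list_of_set \<alpha> ! (t - 1))) = (\<Sum>i<card \<alpha>. f (sorted_list_of_set \<alpha> ! i))"
    by (rule sum.reindex_bij_witness[of _ Suc "\<lambda>t. t - 1"]) auto
  also have "\<dots> = sum_list (map f (sorted_list_of_set \<alpha>))"
    using assms by (simp add: sum_list_sum_nth atLeast0LessThan)
  also have "\<dots> = sum f \<alpha>"
    using assms by (simp add: sum_list_distinct_conv_sum_set)
  finally show ?thesis .
qed

text \<open>
  All \<open>m\<close> components of the sequence are \<open>k \<mapsto> sum (g j) (a k)\<close>. Its ordered sums are sums over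
  unions of \<open>m\<close> blocks, so they stay in the given IP set.
\<close>

lemma block_sequences:
  assumes a: "block_seq a" and g: "IP_tilde_gen l g"
  defines "G \<equiv> \<lambda>j k (t::nat). sum (g j) (a k)"
  shows "nondeg_ess_distinct_family l m G"
    and "m \<ge> 1 \<Longrightarrow> {(\<lambda>j\<in>{1..l}. ordered_sum (G j) \<alpha>) | \<alpha>. \<alpha> \<in> nat_subsets m} \<subseteq> 
       {(\<lambda>j\<in>{1..l}. sum (g j) \<alpha>) | \<alpha>. \<alpha> \<in> fin_sets}"
proof -
  have "tends_infinity (\<lambda>k. sum (g j) (a k))" if "j \<in> {1..l}" for j
    using g that by (intro tends_infinity_blocks[OF a]) (auto simp: IP_tilde_gen_def)
  moreover have "tends_infinity (\<lambda>k. sum (g j) (a k) - sum (g i) (a k))" if "i \<in> {1..l}" "j \<in> {1..l}" "i \<noteq> j" for i j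
    using g that by (intro tends_infinity_blocks[OF a]) (auto simp: IP_tilde_gen_def)
  ultimately show "nondeg_ess_distinct_family l m G"
    by (auto simp: G_def nondeg_ess_distinct_family_def non_degenerated_def ess_distinct_def)
  assume m: "m \<ge> 1"
  show "{(\<lambda>j\<in>{1..l}. ordered_sum (G j) \<alpha>) | \<alpha>. \<alpha> \<in> nat_subsets m} \<subseteq> 
       {(\<lambda>j\<in>{1..l}. sum (g j) \<alpha>) | \<alpha>. \<alpha> \<in> fin_sets}"
  proof clarify
    fix \<alpha> assume "\<alpha> \<in> nat_subsets m"
    then have \<alpha>: "\<alpha> \<in> fin_sets" "finite \<alpha>" using m by (auto simp: nat_subsets_def fin_sets_def)
    have "ordered_sum (G j) \<alpha> = sum (g j) (\<Union>k\<in>\<alpha>. a k)" for j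
      unfolding ordered_sum_def G_def sum_UN_blocks[OF a \<alpha>(1)] using \<alpha>(2) by (rule sum_sorted_list_nth)
    moreover have "(\<Union>k\<in>\<alpha>. a k) \<in> fin_sets" 
      using a \<alpha> by (intro UN_fin_sets) (auto simp: block_seq_def fin_setsD)
    ultimately show "\<exists>\<beta>. (\<lambda>j\<in>{1..l}. ordered_sum (G j) \<alpha>) = (\<lambda>j\<in>{1..l}. sum (g j) \<beta>) \<and> \<beta> \<in> fin_sets"
      by (intro exI[of _ "\<Union>k\<in>\<alpha>. a k"]) simp
  qed
qed

lemma tendsto_along_blocks:
  assumes S: "block_seq a" "\<And>k. a k \<in> R" and lim: "(x \<longlongrightarrow> y) (IP_filter R)"
  shows "(\<lambda>k. x (a k)) \<longlonglongrightarrow> y"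
proof (rule filterlim_compose[OF lim])
  show "filterlim a (IP_filter R) sequentially"
    unfolding filterlim_iff
  proof (intro allI impI)
    fix P assume "eventually P (IP_filter R)"
    then obtain n where n: "\<And>\<alpha>. \<alpha> \<in> R \<Longrightarrow> n < Min \<alpha> \<Longrightarrow> P \<alpha>" by (auto simp: eventually_IP_filter)
    show "eventually (\<lambda>k. P (a k)) sequentially"
      using eventually_ge_at_top[of n]
      by eventually_elim (use n S block_seq_Min_ge[OF S(1)] in \<open>meson order_le_less_trans\<close>)
  qed
qed


lemma R_limit_of_tendsto:
  assumes "x \<longlonglongrightarrow> y"
  shows "R_limit 1 (\<lambda>\<alpha>. x (Min \<alpha>)) y"
  unfolding R_limit_def
proof (intro allI impI)
  fix \<epsilon> :: real assume "\<epsilon> > 0"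
  from tendstoD[OF assms this] obtain N where N: "\<And>k. k \<ge> N \<Longrightarrow> dist (x k) y < \<epsilon>"
    by (auto simp: eventually_sequentially)
  show "\<exists>\<alpha>\<^sub>0\<in>nat_subsets 1. \<forall>\<alpha>\<in>nat_subsets 1. before \<alpha>\<^sub>0 \<alpha> \<longrightarrow> dist (x (Min \<alpha>)) y < \<epsilon>"
    by (rule bexI[of _ "{Suc N}"]) (auto simp: nat_subsets_def before_def intro!: N)
qed

lemma IP_tilde_star_iff:
  fixes R :: "(nat \<Rightarrow> 'a::ab_group_add) set"
  shows "IP_tilde_star d R \<longleftrightarrow> R \<subseteq> ({1..d} \<rightarrow>\<^sub>E UNIV) \<and>
     (\<forall>g. IP_tilde_gen d g \<longrightarrow> (\<exists>\<alpha>\<in>fin_sets. (\<lambda>j\<in>{1..d}. sum (g j) \<alpha>) \<in> R))"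
proof -
  have *: "R \<inter> {(\<lambda>j\<in>{1..d}. sum (g j) \<alpha>) | \<alpha>. \<alpha> \<in> fin_sets} \<noteq> {} \<longleftrightarrow>
      (\<exists>\<alpha>\<in>fin_sets. (\<lambda>j\<in>{1..d}. sum (g j) \<alpha>) \<in> R)" for g :: "nat \<Rightarrow> nat \<Rightarrow> 'a"
    by blast
  have "(\<forall>E. IP_tilde_set d E \<longrightarrow> R \<inter> E \<noteq> {}) \<longleftrightarrow>
      (\<forall>g. IP_tilde_gen d g \<longrightarrow> R \<inter> {(\<lambda>j\<in>{1..d}. sum (g j) \<alpha>) | \<alpha>. \<alpha> \<in> fin_sets} \<noteq> {})"
    (is "?L \<longleftrightarrow> ?R")
  proof
    assume L: ?L
    show ?R
    proof (intro allI impI)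
      fix g :: "nat \<Rightarrow> nat \<Rightarrow> 'a" assume "IP_tilde_gen d g"
      then have "IP_tilde_set d {(\<lambda>j\<in>{1..d}. sum (g j) \<alpha>) | \<alpha>. \<alpha> \<in> fin_sets}"
        unfolding IP_tilde_set_def by (intro exI[of _ g]) simp
      with L show "R \<inter> {(\<lambda>j\<in>{1..d}. sum (g j) \<alpha>) | \<alpha>. \<alpha> \<in> fin_sets} \<noteq> {}" by (elim allE impE)
    qed
  next
    assume R: ?R
    show ?L
    proof (intro allI impI)
      fix E :: "(nat \<Rightarrow> 'a) set" assume "IP_tilde_set d E"
      then obtain g where g: "IP_tilde_gen d g" and E: "E = {(\<lambda>j\<in>{1..d}. sum (g j) \<alpha>) | \<alpha>. \<alpha> \<in> fin_sets}"
        unfolding IP_tilde_set_def by (elim exE conjE)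
      show "R \<inter> E \<noteq> {}" unfolding E using R g by (elim allE impE)
    qed
  qed
  then show ?thesis unfolding IP_tilde_star_def * by (rule arg_cong)
qed

section \<open>Completing a sequence to an essentially distinct family\<close>

lemma infinite_UNIV_of_fs_tends_infinity:
  fixes x :: "nat set \<Rightarrow> 'g"
  assumes "fs_tends_infinity x"
  shows "infinite (UNIV :: 'g set)"
proof
  assume "finite (UNIV :: 'g set)"
  then obtain n where "\<forall>\<alpha>\<in>fin_sets. n < Min \<alpha> \<longrightarrow> x \<alpha> \<notin> UNIV"
    using assms unfolding fs_tends_infinity_iff by blast
  moreover obtain \<alpha> where "\<alpha> \<in> fin_sets" "n < Min \<alpha>" 
    using block_family_unbounded[OF block_family_fin_sets] by metis
  ultimately show False by blast
qed

text \<open>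
  Choose \<open>h k\<close> recursively in the infinite group outside a finite set: for every \<open>j\<close> and every set
  \<open>I\<close> of earlier indices the difference of the sums over \<open>I \<union> {k}\<close> should not be among the first
  \<open>k\<close> elements of \<open>G\<close> in a fixed enumeration. This controls all finite sums through their largest
  index.
\<close>

lemma sequence_independent_of_finitely_many:
  fixes g :: "nat \<Rightarrow> nat \<Rightarrow> 'g::{ab_group_add, countable}"
  assumes inf: "infinite (UNIV :: 'g set)" and J: "finite J"
  shows "\<exists>h. \<forall>j\<in>J. fs_tends_infinity (\<lambda>\<alpha>. sum h \<alpha> - sum (g j) \<alpha>)"
proof -
  have "\<exists>h. \<forall>k::nat. \<forall>j\<in>J. \<forall>I\<in>Pow {..<k}. k < to_nat (h k - g j k + (\<Sum>i\<in>I. h i - g j i))"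
  proof (rule dependent_wellorder_choice)
    fix k :: nat and h :: "nat \<Rightarrow> 'g"
    let ?X = "\<Union>j\<in>J. \<Union>I\<in>Pow {..<k}. (\<lambda>y. y + g j k - (\<Sum>i\<in>I. h i - g j i)) ` {y. to_nat y \<le> k}"
    have "finite {y::'g. to_nat y \<le> k}"
      using finite_vimageI[of "{..k}" "to_nat :: 'g \<Rightarrow> nat"] by (simp add: vimage_def)
    then have "finite ?X" using J by auto
    then obtain r where r: "r \<notin> ?X" using inf by (meson ex_new_if_finite)
    have "k < to_nat (r - g j k + (\<Sum>i\<in>I. h i - g j i))" if "j \<in> J" "I \<in> Pow {..<k}" for j I
    proof (rule ccontr)
      assume "\<not> ?thesis"
      then have "r - g j k + (\<Sum>i\<in>I. h i - g j i) \<in> {y. to_nat y \<le> k}" by simp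
      then have "(r - g j k + (\<Sum>i\<in>I. h i - g j i)) + g j k - (\<Sum>i\<in>I. h i - g j i) \<in> ?X"
        using that by blast
      with r show False by simp
    qed
    then show "\<exists>r. \<forall>j\<in>J. \<forall>I\<in>Pow {..<k}. k < to_nat (r - g j k + (\<Sum>i\<in>I. h i - g j i))" by blast
  next
    fix r and f h :: "nat \<Rightarrow> 'g" and k :: nat
    assume eq: "\<And>i. i < k \<Longrightarrow> f i = h i"
    have "(\<Sum>i\<in>I. f i - g j i) = (\<Sum>i\<in>I. h i - g j i)" if "I \<in> Pow {..<k}" for I j
      using that eq by (intro sum.cong) auto
    then show "(\<forall>j\<in>J. \<forall>I\<in>Pow {..<k}. k < to_nat (r - g j k + (\<Sum>i\<in>I. f i - g j i))) =
      (\<forall>j\<in>J. \<forall>I\<in>Pow {..<k}. k < to_nat (r - g j k + (\<Sum>i\<in>I. h i - g j i)))" by simp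
  qed
  then obtain h where h: "\<And>k j I. j \<in> J \<Longrightarrow> I \<subseteq> {..<k} \<Longrightarrow> 
      k < to_nat (h k - g j k + (\<Sum>i\<in>I. h i - g j i))" by blast
  have "fs_tends_infinity (\<lambda>\<alpha>. sum h \<alpha> - sum (g j) \<alpha>)" if j: "j \<in> J" for j
    unfolding fs_tends_infinity_iff
  proof (intro allI impI)
    fix K :: "'g set" assume K: "finite K"
    define n where "n = Max (insert 0 (to_nat ` K))"
    have n: "to_nat y \<le> n" if "y \<in> K" for y using K that by (auto simp: n_def)
    have "sum h \<alpha> - sum (g j) \<alpha> \<notin> K" if \<alpha>: "\<alpha> \<in> fin_sets" "n < Min \<alpha>" for \<alpha>
    proof -
      define m where "m = Max \<alpha>"
      have fin: "finite \<alpha>" "\<alpha> \<noteq> {}" using \<alpha> fin_setsD by auto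
      have m: "m \<in> \<alpha>" "\<And>k. k \<in> \<alpha> \<Longrightarrow> k \<le> m" using fin by (auto simp: m_def)
      have "sum h \<alpha> - sum (g j) \<alpha> = h m - g j m + (\<Sum>i\<in>\<alpha>-{m}. h i - g j i)"
        using sum.remove[OF fin(1) m(1), of "\<lambda>i. h i - g j i"] by (simp add: sum_subtractf)
      moreover have "\<alpha> - {m} \<subseteq> {..<m}" using m(2) by (auto simp: le_less)
      ultimately have "m < to_nat (sum h \<alpha> - sum (g j) \<alpha>)" using h[OF j] by simp
      moreover have "n < m" using \<alpha>(2) m(1) fin by simp
      ultimately show ?thesis using n by fastforce
    qed
    then show "\<exists>n. \<forall>\<alpha>\<in>fin_sets. n < Min \<alpha> \<longrightarrow> sum h \<alpha> - sum (g j) \<alpha> \<notin> K" by blast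
  qed
  then show ?thesis by blast
qed

lemma IP_tilde_gen_extend:
  fixes g :: "nat \<Rightarrow> 'g::{ab_group_add, countable}"
  assumes g: "fs_tends_infinity (\<lambda>\<alpha>. sum g \<alpha>)" and l: "l \<ge> 1"
  shows "\<exists>G. IP_tilde_gen l G \<and> G 1 = g"
  using l
proof (induction l rule: dec_induct)
  case base
  then show ?case using g by (intro exI[of _ "\<lambda>_. g"]) (auto simp: IP_tilde_gen_def)
next
  case (step l)
  then obtain G where G: "IP_tilde_gen l G" "G 1 = g" by auto
  \<comment> \<open>Index 0 carries the zero sequence, so the new sequence itself tends to infinity as well.\<close>
  obtain h where h: "\<And>j. j \<in> {0..l} \<Longrightarrow> fs_tends_infinity (\<lambda>\<alpha>. sum h \<alpha> - sum ((G(0 := \<lambda>_. 0)) j) \<alpha>)"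
    using sequence_independent_of_finitely_many[OF infinite_UNIV_of_fs_tends_infinity[OF g], of "{0..l}"] by blast
  have h0: "fs_tends_infinity (\<lambda>\<alpha>. sum h \<alpha>)" using h[of 0] by simp
  have h1: "fs_tends_infinity (\<lambda>\<alpha>. sum h \<alpha> - sum (G j) \<alpha>)" if "j \<in> {1..l}" for j
    using h[of j] that by auto
  have h2: "fs_tends_infinity (\<lambda>\<alpha>. sum (G j) \<alpha> - sum h \<alpha>)" if "j \<in> {1..l}" for j
    using fs_tends_infinity_uminus[OF h1[OF that]] by simp
  have "IP_tilde_gen (Suc l) (G(Suc l := h))"
    unfolding IP_tilde_gen_def
    using G(1) h0 h1 h2 by (auto simp: IP_tilde_gen_def atLeastAtMostSuc_conv)
  moreover have "(G(Suc l := h)) 1 = g" using G(2) step.hyps by simp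
  ultimately show ?case by blast
qed

text \<open>
  Transfers conditions on \<open>l\<close> sequences to a single sequence, which becomes the first of the \<open>l\<close>
  coordinates.
\<close>

lemma IP_tilde_set_extending:
  fixes g :: "nat \<Rightarrow> 'g::{ab_group_add, countable}"
  assumes g: "fs_tends_infinity (\<lambda>\<alpha>. sum g \<alpha>)" and l: "l \<ge> 1"
  obtains E where "IP_tilde_set l E" "\<And>e. e \<in> E \<Longrightarrow> \<exists>\<alpha>\<in>fin_sets. e 1 = sum g \<alpha>"
proof -
  obtain G where G: "IP_tilde_gen l G" "G 1 = g" using IP_tilde_gen_extend[OF g l] by blast
  let ?E = "{(\<lambda>j\<in>{1..l}. sum (G j) \<alpha>) | \<alpha>. \<alpha> \<in> fin_sets}"
  have "IP_tilde_set l ?E" using G(1) unfolding IP_tilde_set_def by blast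
  moreover have "\<exists>\<alpha>\<in>fin_sets. e 1 = sum g \<alpha>" if "e \<in> ?E" for e
    using that l G(2) by auto
  ultimately show thesis by (rule that)
qed

section \<open>Almost orthogonal functions\<close>

text \<open>
  Bounds are required pointwise, and with constant 1, so that the class is closed under products
  and under composition with any map that is measurable.
\<close>

definition unit_bounded :: "'x measure \<Rightarrow> ('x \<Rightarrow> real) \<Rightarrow> bool" where
  "unit_bounded M f \<longleftrightarrow> f \<in> borel_measurable M \<and> (\<forall>x. \<bar>f x\<bar> \<le> 1)"

lemma unit_bounded_mult: "unit_bounded M f \<Longrightarrow> unit_bounded M h \<Longrightarrow> unit_bounded M (\<lambda>x. f x * h x)"
  by (auto simp: unit_bounded_def abs_mult mult_le_one)

lemma unit_bounded_prod:
  "(\<And>j. j \<in> K \<Longrightarrow> unit_bounded M (f j)) \<Longrightarrow> unit_bounded M (\<lambda>x. \<Prod>j\<in>K. f j x)"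
  by (auto simp: unit_bounded_def abs_prod intro!: prod_le_1 borel_measurable_prod)

lemma unit_bounded_measurable: "unit_bounded M f \<Longrightarrow> f \<in> borel_measurable M"
  by (simp add: unit_bounded_def)

context prob_space
begin

lemma unit_bounded_integrable: "unit_bounded M f \<Longrightarrow> integrable M f"
  by (intro integrable_const_bound[where B = 1]) (auto simp: unit_bounded_def)

lemma unit_bounded_integral: "unit_bounded M f \<Longrightarrow> \<bar>\<integral>x. f x \<partial>M\<bar> \<le> 1"
proof -
  assume f: "unit_bounded M f"
  have "\<bar>\<integral>x. f x \<partial>M\<bar> \<le> (\<integral>x. \<bar>f x\<bar> \<partial>M)" by (rule integral_abs_bound)
  also have "\<dots> \<le> (\<integral>x. 1 \<partial>M)"
    using f unit_bounded_integrable[OF f] by (intro integral_mono) (auto simp: unit_bounded_def)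
  finally show ?thesis by (simp add: prob_space)
qed

text \<open>
  Bessel's inequality in the form of a pigeonhole principle: if all \<open>W b\<close> correlated with \<open>u\<close> by at
  least \<open>\<epsilon>\<close>, the signed sum \<open>U\<close> of the \<open>N\<close> functions would have inner product at least \<open>N \<epsilon>\<close>
  with \<open>u\<close>, whereas almost orthogonality bounds the square of its norm by \<open>N + N\<^sup>2 \<eta>\<close>.
\<close>

lemma unit_bounded_bessel:
  assumes E: "finite E" "E \<noteq> {}" and u: "unit_bounded M u"
    and W: "\<And>b. b \<in> E \<Longrightarrow> unit_bounded M (W b)"
    and orth: "\<And>b b'. b \<in> E \<Longrightarrow> b' \<in> E \<Longrightarrow> b \<noteq> b' \<Longrightarrow> \<bar>\<integral>x. W b x * W b' x \<partial>M\<bar> \<le> \<eta>"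
    and \<epsilon>: "0 < \<epsilon>" "0 \<le> \<eta>" "1 / real (card E) + \<eta> < \<epsilon>\<^sup>2"
  shows "\<exists>b\<in>E. \<bar>\<integral>x. u x * W b x \<partial>M\<bar> < \<epsilon>"
proof (rule ccontr)
  assume "\<not> ?thesis"
  then have big: "\<epsilon> \<le> \<bar>\<integral>x. u x * W b x \<partial>M\<bar>" if "b \<in> E" for b using that by auto
  define N where "N = real (card E)"
  have N: "N > 0" using E by (auto simp: N_def card_gt_0_iff)
  define s where "s b = sgn (\<integral>x. u x * W b x \<partial>M)" for b
  define U where "U x = (\<Sum>b\<in>E. s b * W b x)" for x
  have Wi [simp, intro]: "integrable M (\<lambda>x. W b x * W b' x)" if "b \<in> E" "b' \<in> E" for b b'
    using that W by (intro unit_bounded_integrable unit_bounded_mult)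
  have uWi: "integrable M (\<lambda>x. u x * W b x)" if "b \<in> E" for b
    using that W u by (intro unit_bounded_integrable unit_bounded_mult)
  have UU: "U x ^ 2 = (\<Sum>b\<in>E. \<Sum>b'\<in>E. (s b * s b') * (W b x * W b' x))" for x
    by (simp add: U_def power2_eq_square sum_product algebra_simps)
  have Ui: "integrable M (\<lambda>x. U x ^ 2)"
    unfolding UU by (intro Bochner_Integration.integrable_sum integrable_mult_right Wi)
  have Um: "U \<in> borel_measurable M"
    unfolding U_def by (intro borel_measurable_sum borel_measurable_times borel_measurable_const
        unit_bounded_measurable W)
  have uU: "(\<lambda>x. u x * U x) = (\<lambda>x. \<Sum>b\<in>E. s b * (u x * W b x))"
    by (simp add: U_def sum_distrib_left algebra_simps)
  have i1: "integrable M (\<lambda>x. u x * U x)"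
    unfolding uU by (intro Bochner_Integration.integrable_sum integrable_mult_right uWi)
  have i2: "integrable M (\<lambda>x. (u x * U x) ^ 2)"
  proof (rule Bochner_Integration.integrable_bound[OF Ui])
    show "(\<lambda>x. (u x * U x)\<^sup>2) \<in> borel_measurable M"
      using Um unit_bounded_measurable[OF u] by measurable
    show "AE x in M. norm ((u x * U x)\<^sup>2) \<le> norm ((U x)\<^sup>2)"
      using u by (auto simp: unit_bounded_def power_mult_distrib abs_mult abs_le_square_iff[symmetric]
          power2_le_iff_abs_le abs_square_le_1 intro!: mult_left_le_one_le)
  qed
  have "N * \<epsilon> \<le> (\<Sum>b\<in>E. \<bar>\<integral>x. u x * W b x \<partial>M\<bar>)"
    using sum_mono[OF big] by (simp add: N_def)
  also have "\<dots> = (\<integral>x. u x * U x \<partial>M)"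
    unfolding uU using uWi
    by (subst Bochner_Integration.integral_sum)
      (auto intro!: sum.cong integrable_mult_right simp: s_def abs_sgn mult.commute)
  finally have 1: "N * \<epsilon> \<le> (\<integral>x. u x * U x \<partial>M)" .
  have "(N * \<epsilon>)\<^sup>2 \<le> (\<integral>x. u x * U x \<partial>M)\<^sup>2"
    using 1 N \<epsilon> by (intro power_mono) auto
  also have "\<dots> \<le> (\<integral>x. (u x * U x)\<^sup>2 \<partial>M)"
    using variance_eq[OF i1 i2] variance_positive[of "\<lambda>x. u x * U x"] by simp
  also have "\<dots> \<le> (\<integral>x. (U x)\<^sup>2 \<partial>M)"
  proof (rule integral_mono[OF i2 Ui])
    show "(u x * U x)\<^sup>2 \<le> (U x)\<^sup>2" for x
      using u by (auto simp: unit_bounded_def power_mult_distrib abs_square_le_1 intro!: mult_left_le_one_le)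
  qed
  also have "\<dots> = (\<Sum>b\<in>E. \<Sum>b'\<in>E. (s b * s b') * (\<integral>x. W b x * W b' x \<partial>M))"
    unfolding UU by (subst Bochner_Integration.integral_sum, fastforce)+ simp
  also have "\<dots> \<le> (\<Sum>b\<in>E. \<Sum>b'\<in>E. (if b = b' then 1 else 0) + \<eta>)"
  proof (intro sum_mono)
    fix b b' assume b: "b \<in> E" "b' \<in> E"
    have "(s b * s b') * (\<integral>x. W b x * W b' x \<partial>M) \<le> \<bar>(s b * s b') * (\<integral>x. W b x * W b' x \<partial>M)\<bar>" by simp
    also have "\<dots> \<le> \<bar>\<integral>x. W b x * W b' x \<partial>M\<bar>"
      by (auto simp: abs_mult s_def sgn_if)
    also have "\<dots> \<le> (if b = b' then 1 else 0) + \<eta>"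
      using orth[OF b] unit_bounded_integral[OF unit_bounded_mult[OF W[OF b(1)] W[OF b(2)]]] \<epsilon>(2)
      by auto
    finally show "(s b * s b') * (\<integral>x. W b x * W b' x \<partial>M) \<le> (if b = b' then 1 else 0) + \<eta>" .
  qed
  also have "\<dots> = N + N\<^sup>2 * \<eta>"
    using E by (simp add: sum.distrib N_def power2_eq_square algebra_simps)
  also have "\<dots> = N\<^sup>2 * (1 / N + \<eta>)"
    using N by (simp add: field_simps power2_eq_square)
  also have "\<dots> < N\<^sup>2 * \<epsilon>\<^sup>2"
    using \<epsilon>(3) N by (intro mult_strict_left_mono) (auto simp: N_def)
  finally show False by (simp add: power_mult_distrib)
qed

end

section \<open>Mild mixing implies multiple mixing\<close>

locale mp_sys =
  fixes M :: "'x::metric_space measure" and T :: "'g::{ab_group_add, countable} \<Rightarrow> 'x \<Rightarrow> 'x"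
  assumes sys: "mp_system M T"
begin

sublocale prob_space M using sys by (simp add: mp_system_def)

lemma sets_M [measurable_cong]: "sets M = sets borel"
  using sys by (simp add: mp_system_def)

lemma space_M [simp]: "space M = UNIV"
  using sets_eq_imp_space_eq[OF sets_M] by simp

lemma T_measurable [measurable]: "T g \<in> measurable M M"
  using sys by (simp add: mp_system_def mp_transformation_def)

lemma T_0 [simp]: "T 0 x = x" 
  using sys by (simp add: mp_system_def)

lemma T_add: "T (g + h) x = T g (T h x)"
  using sys by (simp add: mp_system_def)

lemma T_image: "T g ` A = T (- g) -` A"
proof -
  have "T (- g) (T g x) = x" "T g (T (- g) x) = x" for x
    using T_add[of "-g" g x] T_add[of g "-g" x] by simp_all
  then show ?thesis by (auto simp: image_iff) metis
qed

lemma integral_T: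
  fixes f :: "'x \<Rightarrow> 'b::{banach, second_countable_topology}"
  assumes "f \<in> borel_measurable M"
  shows "(\<integral>x. f (T g x) \<partial>M) = (\<integral>x. f x \<partial>M)"
proof -
  have "distr M M (T g) = M" using sys by (simp add: mp_system_def mp_transformation_def)
  then show ?thesis using integral_distr[OF T_measurable, of f g] assms by simp
qed

lemma measure_T:
  assumes "A \<in> sets M" shows "measure M (T g -` A) = measure M A"
proof -
  have "distr M M (T g) = M" using sys by (simp add: mp_system_def mp_transformation_def)
  then show ?thesis using measure_distr[OF T_measurable assms, of g] by simp
qed

lemma T_vimage_sets [measurable]: "A \<in> sets M \<Longrightarrow> T g -` A \<in> sets M"
  using measurable_sets[OF T_measurable, of A g] by simp

lemma measure_preimage_eq_image:
  assumes "A \<in> sets M" "B \<in> sets M"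
  shows "measure M (A \<inter> T g -` B) = measure M (B \<inter> T g ` A)"
proof -
  have eq: "A \<inter> T g -` B = T g -` (B \<inter> T g ` A)"
    by (auto simp: T_image simp flip: T_add)
  have "B \<inter> T g ` A \<in> sets M" using assms by (auto simp: T_image)
  then show ?thesis by (subst eq) (rule measure_T)
qed

lemma unit_bounded_T: "unit_bounded M f \<Longrightarrow> unit_bounded M (\<lambda>x. f (T g x))"
  by (auto simp: unit_bounded_def)

text \<open>
  The van der Corput argument along IP-rings. Put \<open>w \<alpha> = \<Prod>\<^sub>j f\<^sub>j \<circ> T\<^sub>g\<^sub>j\<^sub>\<alpha>\<close>. Mixing of the coordinate
  \<open>q\<close> gives a long list of blocks \<open>\<beta>\<close> for which the functions \<open>f q \<circ> T (sum (g q) \<beta>)\<close> are almost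
  orthogonal, as \<open>f q\<close> has mean zero. For \<open>\<gamma>\<close> beyond these blocks, the product of
  \<open>w (\<beta> \<union> \<gamma>)\<close> and \<open>w (\<beta>' \<union> \<gamma>)\<close> is again a product over \<open>j\<close>, of functions shifted by
  \<open>sum (g j) \<gamma>\<close>; multiple mixing of these shifts makes its integral close to a product of integrals, one
  of whose factors is small. So the functions \<open>w (\<beta> \<union> \<gamma>)\<close> are almost orthogonal, and one of them
  is almost orthogonal to \<open>u\<close>.
\<close>

lemma van_der_corput:
  fixes g :: "'j \<Rightarrow> nat \<Rightarrow> 'g"
  assumes K: "finite K" "q \<in> K" and u: "unit_bounded M u"
    and f: "\<And>j. j \<in> K \<Longrightarrow> unit_bounded M (f j)" and zero: "(\<integral>x. f q x \<partial>M) = 0"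
    and mixq: "\<And>v \<delta>. unit_bounded M v \<Longrightarrow> \<delta> > 0 \<Longrightarrow>
       IP_star {\<alpha>. \<bar>\<integral>x. f q (T (sum (g q) \<alpha>) x) * v x \<partial>M\<bar> < \<delta>}"
    and mixK: "\<And>F \<delta>. (\<And>j. j \<in> K \<Longrightarrow> unit_bounded M (F j)) \<Longrightarrow> \<delta> > 0 \<Longrightarrow>
       IP_star {\<alpha>. \<bar>(\<integral>x. (\<Prod>j\<in>K. F j (T (sum (g j) \<alpha>) x)) \<partial>M) - (\<Prod>j\<in>K. \<integral>x. F j x \<partial>M)\<bar> < \<delta>}"
    and \<epsilon>: "\<epsilon> > 0"
  shows "IP_star {\<alpha>. \<bar>\<integral>x. u x * (\<Prod>j\<in>K. f j (T (sum (g j) \<alpha>) x)) \<partial>M\<bar> < \<epsilon>}"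
  unfolding large_def
proof (intro allI impI)
  fix S assume S: "block_family S"
  define w where "w \<alpha> x = (\<Prod>j\<in>K. f j (T (sum (g j) \<alpha>) x))" for \<alpha> x
  (* With N > 2 / epsilon^2 functions and inner products up to 2 delta, Bessel's inequality
     leaves 1 / N + 2 delta < epsilon^2 / 2 + 2 epsilon^2 / 5. *)
  define \<delta> where "\<delta> = \<epsilon>\<^sup>2 / 5"
  have \<delta>: "\<delta> > 0" using \<epsilon> by (simp add: \<delta>_def)
  obtain N :: nat where N: "2 / \<epsilon>\<^sup>2 < N" using reals_Archimedean2 by blast
  have "0 < 2 / \<epsilon>\<^sup>2" using \<epsilon> by simp
  with N have N0: "0 < N" by linarith
  have "1 / real N + 2 * \<delta> < \<epsilon>\<^sup>2"
  proof -
    have "2 / real N < \<epsilon>\<^sup>2" using N N0 \<epsilon> by (simp add: field_simps)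
    moreover have "1 / real N = (2 / real N) / 2" by simp
    ultimately show ?thesis unfolding \<delta>_def using zero_less_power[OF \<epsilon>, of 2] by linarith
  qed
  note N = N0 this
  let ?c = "\<lambda>\<beta> \<beta>'. \<integral>x. f q (T (sum (g q) \<beta>) x) * f q (T (sum (g q) \<beta>') x) \<partial>M"
  have "\<exists>E. finite E \<and> E \<subseteq> S \<and> card E = n \<and> (\<forall>\<beta>\<in>E. \<forall>\<beta>'\<in>E. \<beta> \<noteq> \<beta>' \<longrightarrow> \<bar>?c \<beta> \<beta>'\<bar> < \<delta>)" for n
  proof (induction n)
    case 0
    show ?case by (intro exI[of _ "{}"]) auto
  next
    case (Suc n)
    then obtain E where E: "finite E" "E \<subseteq> S" "card E = n"
      and sep: "\<And>\<beta> \<beta>'. \<beta> \<in> E \<Longrightarrow> \<beta>' \<in> E \<Longrightarrow> \<beta> \<noteq> \<beta>' \<Longrightarrow> \<bar>?c \<beta> \<beta>'\<bar> < \<delta>" by blast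
    define m where "m = Max (insert 0 (Max ` E))"
    have m: "Max \<beta> \<le> m" if "\<beta> \<in> E" for \<beta> using that E(1) by (auto simp: m_def)
    have "IP_star (\<Inter>\<beta>\<in>E. {\<alpha>. \<bar>?c \<alpha> \<beta>\<bar> < \<delta>})"
      using f[OF K(2)] \<delta> by (intro IP_star_INT E mixq unit_bounded_T)
    from IP_starD[OF this S, of m] obtain \<alpha> where \<alpha>: "\<alpha> \<in> S" "m < Min \<alpha>" 
      and \<alpha>E: "\<And>\<beta>. \<beta> \<in> E \<Longrightarrow> \<bar>?c \<alpha> \<beta>\<bar> < \<delta>" by blast
    have "Min \<alpha> \<le> Max \<alpha>" using fin_setsD[OF block_familyD[OF S \<alpha>(1)]] by simp
    then have "\<alpha> \<notin> E" using m[of \<alpha>] \<alpha>(2) by auto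
    moreover have "\<bar>?c \<beta> \<alpha>\<bar> < \<delta>" if "\<beta> \<in> E" for \<beta>
      using \<alpha>E[OF that] by (simp add: mult.commute)
    ultimately show ?case
      using E \<alpha> \<alpha>E sep by (intro exI[of _ "insert \<alpha> E"]) auto
  qed
  from this[of N] obtain E where E: "finite E" "E \<subseteq> S" "card E = N"
    and sepE: "\<forall>\<beta>\<in>E. \<forall>\<beta>'\<in>E. \<beta> \<noteq> \<beta>' \<longrightarrow> \<bar>?c \<beta> \<beta>'\<bar> < \<delta>" by metis
  have sep: "\<bar>?c \<beta> \<beta>'\<bar> < \<delta>" if "\<beta> \<in> E" "\<beta>' \<in> E" "\<beta> \<noteq> \<beta>'" for \<beta> \<beta>'
    using sepE that by simp
  define F where "F = (\<lambda>(\<beta>, \<beta>') j x. f j (T (sum (g j) \<beta>) x) * f j (T (sum (g j) \<beta>') x))"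
  have F: "unit_bounded M (F b j)" if "j \<in> K" for b j
    unfolding F_def using f[OF that] by (cases b) (auto intro!: unit_bounded_mult unit_bounded_T)
  define m where "m = Max (insert 0 (Max ` E))"
  have m: "Max \<beta> \<le> m" if "\<beta> \<in> E" for \<beta> using that E(1) by (auto simp: m_def)
  define B where "B b = {\<alpha>. \<bar>(\<integral>x. (\<Prod>j\<in>K. F b j (T (sum (g j) \<alpha>) x)) \<partial>M) - (\<Prod>j\<in>K. \<integral>x. F b j x \<partial>M)\<bar> < \<delta>}" for b
  have "IP_star (\<Inter>b\<in>E\<times>E. B b)"
    using E F \<delta> unfolding B_def by (intro IP_star_INT mixK) auto
  from IP_starD[OF this S, of m] obtain \<gamma> where \<gamma>: "\<gamma> \<in> S" "m < Min \<gamma>" 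
    and \<gamma>B: "\<And>b. b \<in> E \<times> E \<Longrightarrow> \<gamma> \<in> B b" by blast
  have \<gamma>E: "\<bar>(\<integral>x. (\<Prod>j\<in>K. F b j (T (sum (g j) \<gamma>) x)) \<partial>M) - (\<Prod>j\<in>K. \<integral>x. F b j x \<partial>M)\<bar> < \<delta>"
    if "b \<in> E \<times> E" for b
    using \<gamma>B[OF that] unfolding B_def by (rule CollectD)
  have before: "before \<beta> \<gamma>" if "\<beta> \<in> E" for \<beta> using m[OF that] \<gamma>(2) by (simp add: before_def)
  have US: "\<beta> \<union> \<gamma> \<in> S" if "\<beta> \<in> E" for \<beta>
    using S before[OF that] \<gamma>(1) that E(2) by (auto simp: block_family_def)
  have sumU: "T (sum (g j) (\<beta> \<union> \<gamma>)) x = T (sum (g j) \<beta>) (T (sum (g j) \<gamma>) x)" if "\<beta> \<in> E" for \<beta> j x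
  proof -
    have fin: "\<beta> \<in> fin_sets" "\<gamma> \<in> fin_sets" 
      using S \<gamma>(1) that E(2) by (auto intro: block_familyD)
    have "\<beta> \<inter> \<gamma> = {}" using before[OF that] before_iff[OF fin] by auto
    then show ?thesis using fin fin_setsD by (simp add: sum.union_disjoint T_add)
  qed
  have "\<bar>\<integral>x. w (\<beta> \<union> \<gamma>) x * w (\<beta>' \<union> \<gamma>) x \<partial>M\<bar> \<le> 2 * \<delta>" if b: "\<beta> \<in> E" "\<beta>' \<in> E" "\<beta> \<noteq> \<beta>'" for \<beta> \<beta>'
  proof -
    have "w (\<beta> \<union> \<gamma>) x * w (\<beta>' \<union> \<gamma>) x = (\<Prod>j\<in>K. F (\<beta>, \<beta>') j (T (sum (g j) \<gamma>) x))" for x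
      using b by (simp add: w_def F_def sumU prod.distrib)
    then have "\<bar>(\<integral>x. w (\<beta> \<union> \<gamma>) x * w (\<beta>' \<union> \<gamma>) x \<partial>M) - (\<Prod>j\<in>K. \<integral>x. F (\<beta>, \<beta>') j x \<partial>M)\<bar> < \<delta>"
      using \<gamma>E[of "(\<beta>, \<beta>')"] b by simp
    moreover have "\<bar>\<Prod>j\<in>K. \<integral>x. F (\<beta>, \<beta>') j x \<partial>M\<bar> \<le> \<delta>"
    proof -
      have "\<bar>\<Prod>j\<in>K. \<integral>x. F (\<beta>, \<beta>') j x \<partial>M\<bar> = 
          \<bar>\<integral>x. F (\<beta>, \<beta>') q x \<partial>M\<bar> * (\<Prod>j\<in>K-{q}. \<bar>\<integral>x. F (\<beta>, \<beta>') j x \<partial>M\<bar>)"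
        using K by (subst prod.remove[of _ q]) (auto simp: abs_mult abs_prod)
      also have "\<dots> \<le> \<bar>\<integral>x. F (\<beta>, \<beta>') q x \<partial>M\<bar> * 1"
        using F by (intro mult_left_mono prod_le_1) (auto intro: unit_bounded_integral)
      also have "\<dots> \<le> \<delta>" using sep[OF b] by (simp add: F_def)
      finally show ?thesis .
    qed
    ultimately show ?thesis by linarith
  qed
  moreover have "unit_bounded M (w \<alpha>)" for \<alpha>
    unfolding w_def using f by (intro unit_bounded_prod unit_bounded_T)
  ultimately have "\<exists>\<beta>\<in>E. \<bar>\<integral>x. u x * w (\<beta> \<union> \<gamma>) x \<partial>M\<bar> < \<epsilon>"
    using E N \<delta> u \<epsilon> by (intro unit_bounded_bessel[where \<eta> = "2 * \<delta>"]) auto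
  then show "{\<alpha>. \<bar>\<integral>x. u x * (\<Prod>j\<in>K. f j (T (sum (g j) \<alpha>) x)) \<partial>M\<bar> < \<epsilon>} \<inter> S \<noteq> {}"
    using US unfolding w_def by blast
qed

lemma unit_bounded_L2: 
  assumes "unit_bounded M u" shows "(\<lambda>x. complex_of_real (u x)) \<in> L2 M"
proof -
  have "integrable M (\<lambda>x. (cmod (complex_of_real (u x)))\<^sup>2)"
    using assms by (intro integrable_const_bound[where B = 1]) (auto simp: unit_bounded_def abs_square_le_1)
  then show ?thesis using assms by (auto simp: L2_def unit_bounded_def)
qed

text \<open>
  Tests the weak limit of \<open>u \<circ> T\<close> against \<open>v\<close>, along a sub-ring of any given ring.
\<close>

lemma mildly_mixing_IP_star:
  assumes mm: "mildly_mixing M T" and g: "fs_tends_infinity (\<lambda>\<alpha>. sum g \<alpha>)"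
    and u: "unit_bounded M u" and v: "unit_bounded M v" and \<delta>: "\<delta> > 0"
  shows "IP_star {\<alpha>. \<bar>(\<integral>x. u (T (sum g \<alpha>) x) * v x \<partial>M) - (\<integral>x. u x \<partial>M) * (\<integral>x. v x \<partial>M)\<bar> < \<delta>}"
proof (rule IP_starI)
  fix a assume a: "block_seq a"
  have eq: "(\<Sum>k\<in>\<alpha>. sum g (a k)) = sum g (\<Union>k\<in>\<alpha>. a k)" if "\<alpha> \<in> fin_sets" for \<alpha>
    using sum_UN_blocks[OF a that, of g] by simp
  have "fs_tends_infinity (\<lambda>\<alpha>. \<Sum>k\<in>\<alpha>. sum g (a k))"
    using fs_tends_infinity_blocks[OF a g] by (subst fs_tends_infinity_cong) (auto simp: eq)
  then obtain R where R: "IP_ring R" 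
    and lim: "\<And>f. f \<in> L2 M \<Longrightarrow> IP_limit (L2_weak M) R (\<lambda>\<alpha>. f \<circ> T (\<Sum>k\<in>\<alpha>. sum g (a k))) (\<lambda>_. LINT x|M. f x)"
    using mm unfolding mildly_mixing_def by metis
  let ?u = "\<lambda>x. complex_of_real (u x)" and ?v = "\<lambda>x. complex_of_real (v x)"
  define c where "c = (\<integral>x. u x \<partial>M) * (\<integral>x. v x \<partial>M)"
  define U where "U = {\<phi> \<in> L2 M. (LINT x|M. \<phi> x * cnj (?v x)) \<in> ball (complex_of_real c) \<delta>}"
  have "openin (L2_weak M) U"
    unfolding L2_weak_def U_def
    by (intro topology_generated_by_Basis CollectI exI[of _ ?v] 
        exI[of _ "ball (complex_of_real c) \<delta>"] conjI refl unit_bounded_L2[OF v] open_ball)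
  moreover have lu: "limitin (L2_weak M) (\<lambda>\<alpha>. ?u \<circ> T (\<Sum>k\<in>\<alpha>. sum g (a k))) (\<lambda>_. LINT x|M. ?u x) (IP_filter R)"
    using lim[OF unit_bounded_L2[OF u]] R by (simp add: IP_limit_iff)
  moreover have "(\<lambda>_. LINT x|M. ?u x) \<in> U"
  proof -
    have "(LINT y|M. (LINT x|M. ?u x) * cnj (?v y)) = complex_of_real c"
      by (simp add: c_def)
    then show ?thesis using limitin_topspace[OF lu] \<delta> by (simp add: U_def topspace_L2_weak)
  qed
  ultimately have "eventually (\<lambda>\<alpha>. ?u \<circ> T (\<Sum>k\<in>\<alpha>. sum g (a k)) \<in> U) (IP_filter R)"
    by (simp add: limitin_def)
  then obtain n where n: "\<And>\<alpha>. \<alpha> \<in> R \<Longrightarrow> n < Min \<alpha> \<Longrightarrow> ?u \<circ> T (\<Sum>k\<in>\<alpha>. sum g (a k)) \<in> U"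
    by (auto simp: eventually_IP_filter)
  obtain \<alpha> where \<alpha>: "\<alpha> \<in> R" "n < Min \<alpha>" 
    using block_family_unbounded[OF block_family_IP_ring[OF R]] by metis
  have \<alpha>f: "\<alpha> \<in> fin_sets" using block_familyD[OF block_family_IP_ring[OF R] \<alpha>(1)] .
  have "(LINT x|M. ?u (T (sum g (\<Union>k\<in>\<alpha>. a k)) x) * cnj (?v x)) =
      complex_of_real (\<integral>x. u (T (sum g (\<Union>k\<in>\<alpha>. a k)) x) * v x \<partial>M)"
    by (simp flip: of_real_mult)
  with n[OF \<alpha>] have "dist (complex_of_real c) (complex_of_real (\<integral>x. u (T (sum g (\<Union>k\<in>\<alpha>. a k)) x) * v x \<partial>M)) < \<delta>"
    by (simp add: U_def eq[OF \<alpha>f])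
  then have "\<bar>(\<integral>x. u (T (sum g (\<Union>k\<in>\<alpha>. a k)) x) * v x \<partial>M) - c\<bar> < \<delta>"
    by (simp add: dist_norm abs_minus_commute flip: of_real_diff)
  with \<alpha>f show "\<exists>\<alpha>\<in>fin_sets. (\<Union>k\<in>\<alpha>. a k) \<in> {\<alpha>. \<bar>(\<integral>x. u (T (sum g \<alpha>) x) * v x \<partial>M) - (\<integral>x. u x \<partial>M) * (\<integral>x. v x \<partial>M)\<bar> < \<delta>}"
    by (auto simp: c_def)
qed

text \<open>
  Induction on the number of factors. Distinguish two factors \<open>p\<close> and \<open>q\<close> and write \<open>f q\<close> as a mean
  zero function plus a constant. The constant leaves a correlation without the factor \<open>q\<close>. For the
  mean zero part, measure everything relative to the sequence \<open>g p\<close>; then the van der Corput lemma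
  applies to the factors other than \<open>p\<close>.
\<close>

theorem multiple_mixing_functions:
  fixes g :: "'j \<Rightarrow> nat \<Rightarrow> 'g"
  assumes mm: "mildly_mixing M T" and J: "finite J"
    and g: "\<And>i j. i \<in> J \<Longrightarrow> j \<in> J \<Longrightarrow> i \<noteq> j \<Longrightarrow> fs_tends_infinity (\<lambda>\<alpha>. sum (g i) \<alpha> - sum (g j) \<alpha>)"
    and f: "\<And>j. j \<in> J \<Longrightarrow> unit_bounded M (f j)" and \<epsilon>: "\<epsilon> > 0"
  shows "IP_star {\<alpha>. \<bar>(\<integral>x. (\<Prod>j\<in>J. f j (T (sum (g j) \<alpha>) x)) \<partial>M) - (\<Prod>j\<in>J. \<integral>x. f j x \<partial>M)\<bar> < \<epsilon>}"
  using J g f \<epsilon>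
proof (induction "card J" arbitrary: J g f \<epsilon> rule: less_induct)
  case less
  note J = less.prems(1) and g = less.prems(2) and f = less.prems(3) and \<epsilon> = less.prems(4)
  have UNIV_star: "IP_star UNIV"
    using IP_star_INT[of "{}" "\<lambda>_. UNIV"] by simp
  consider "J = {}" | p where "J = {p}" | p q where "p \<in> J" "q \<in> J" "p \<noteq> q" by blast
  then show ?case
  proof cases
    case 1
    then show ?thesis using \<epsilon> UNIV_star prob_space by simp
  next
    case 2
    have "(\<integral>x. f p (T (sum (g p) \<alpha>) x) \<partial>M) = (\<integral>x. f p x \<partial>M)" for \<alpha>
      using f 2 by (intro integral_T unit_bounded_measurable) auto
    then show ?thesis using \<epsilon> UNIV_star 2 by simp
  next
    case 3
    define K where "K = J - {p}"
    define c where "c = (\<integral>x. f q x \<partial>M)"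
    (* Halving keeps the mean zero part of f q bounded by 1. *)
    define f' where "f' = f(q := (\<lambda>x. (f q x - c) / 2))"
    define g' where "g' j k = g j k - g p k" for j k
    have K: "finite K" "q \<in> K" "p \<notin> K" "J = insert p K" using 3 J by (auto simp: K_def)
    have fq: "unit_bounded M (f q)" using f 3 by auto
    have c: "\<bar>c\<bar> \<le> 1" unfolding c_def by (rule unit_bounded_integral[OF fq])
    have f': "unit_bounded M (f' j)" if "j \<in> J" for j
    proof (cases "j = q")
      case True
      have "\<bar>(f q x - c) / 2\<bar> \<le> 1" for x
        using c fq abs_triangle_ineq4[of "f q x" c] by (auto simp: unit_bounded_def dest: spec[of _ x])
      then show ?thesis using fq True by (auto simp: f'_def unit_bounded_def)
    next
      case False
      then show ?thesis using f[OF that] by (simp add: f'_def)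
    qed
    have sum_g': "sum (g' j) \<alpha> = sum (g j) \<alpha> - sum (g p) \<alpha>" for j \<alpha>
      by (simp add: g'_def sum_subtractf)
    have "(\<integral>x. f' q x \<partial>M) = 0"
      using unit_bounded_integrable[OF fq] prob_space by (simp add: f'_def c_def)
    note zero = this
    have "IP_star {\<alpha>. \<bar>\<integral>x. f' q (T (sum (g' q) \<alpha>) x) * v x \<partial>M\<bar> < \<delta>}" 
      if "unit_bounded M v" "\<delta> > 0" for v \<delta>
    proof -
      have "fs_tends_infinity (\<lambda>\<alpha>. sum (g' q) \<alpha>)" unfolding sum_g' using g 3 by auto
      from mildly_mixing_IP_star[OF mm this f'[OF 3(2)] that] show ?thesis by (simp add: zero)
    qed
    moreover have "IP_star {\<alpha>. \<bar>(\<integral>x. (\<Prod>j\<in>K. F j (T (sum (g' j) \<alpha>) x)) \<partial>M) - (\<Prod>j\<in>K. \<integral>x. F j x \<partial>M)\<bar> < \<delta>}"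
      if "\<And>j. j \<in> K \<Longrightarrow> unit_bounded M (F j)" "\<delta> > 0" for F \<delta>
    proof (rule less.hyps)
      show "card K < card J" using K by simp
      show "fs_tends_infinity (\<lambda>\<alpha>. sum (g' i) \<alpha> - sum (g' j) \<alpha>)" if "i \<in> K" "j \<in> K" "i \<noteq> j" for i j
        using g[of i j] that K by (simp add: sum_g')
    qed (use that K in auto)
    ultimately have 1: "IP_star {\<alpha>. \<bar>\<integral>x. f p x * (\<Prod>j\<in>K. f' j (T (sum (g' j) \<alpha>) x)) \<partial>M\<bar> < \<epsilon> / 4}"
      using K f' f \<epsilon> by (intro van_der_corput[where q = q] zero) auto
    have 2: "IP_star {\<alpha>. \<bar>(\<integral>x. (\<Prod>j\<in>J-{q}. f j (T (sum (g j) \<alpha>) x)) \<partial>M) - (\<Prod>j\<in>J-{q}. \<integral>x. f j x \<partial>M)\<bar> < \<epsilon> / 2}"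
    proof (rule less.hyps)
      show "card (J - {q}) < card J" using 3 J by (meson card_Diff1_less)
    qed (use J f g \<epsilon> in auto)
    show ?thesis
    proof (rule IP_star_mono[OF IP_star_Int[OF 1 2]], safe)
      fix \<alpha>
      assume a1: "\<bar>\<integral>x. f p x * (\<Prod>j\<in>K. f' j (T (sum (g' j) \<alpha>) x)) \<partial>M\<bar> < \<epsilon> / 4"
        and a2: "\<bar>(\<integral>x. (\<Prod>j\<in>J-{q}. f j (T (sum (g j) \<alpha>) x)) \<partial>M) - (\<Prod>j\<in>J-{q}. \<integral>x. f j x \<partial>M)\<bar> < \<epsilon> / 2"
      have ub1: "unit_bounded M (\<lambda>x. \<Prod>j\<in>J. f' j (T (sum (g j) \<alpha>) x))"
        using f' by (intro unit_bounded_prod unit_bounded_T)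
      have ub2: "unit_bounded M (\<lambda>x. \<Prod>j\<in>J-{q}. f j (T (sum (g j) \<alpha>) x))"
        using f by (intro unit_bounded_prod unit_bounded_T) auto
      have "(\<integral>x. f p x * (\<Prod>j\<in>K. f' j (T (sum (g' j) \<alpha>) x)) \<partial>M) =
         (\<integral>x. f p (T (sum (g p) \<alpha>) x) * (\<Prod>j\<in>K. f' j (T (sum (g' j) \<alpha>) (T (sum (g p) \<alpha>) x))) \<partial>M)"
        by (rule integral_T[symmetric], intro unit_bounded_measurable unit_bounded_mult unit_bounded_prod unit_bounded_T)
          (use f f' K in auto)
      also have "\<dots> = (\<integral>x. (\<Prod>j\<in>J. f' j (T (sum (g j) \<alpha>) x)) \<partial>M)"
        using K 3 by (simp add: sum_g' f'_def flip: T_add)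
      finally have e1: "\<bar>\<integral>x. (\<Prod>j\<in>J. f' j (T (sum (g j) \<alpha>) x)) \<partial>M\<bar> < \<epsilon> / 4" using a1 by simp
      have split: "(\<Prod>j\<in>J. f j (T (sum (g j) \<alpha>) x)) = 
          2 * (\<Prod>j\<in>J. f' j (T (sum (g j) \<alpha>) x)) + c * (\<Prod>j\<in>J-{q}. f j (T (sum (g j) \<alpha>) x))" for x
      proof -
        have "(\<Prod>j\<in>J. h j) = h q * (\<Prod>j\<in>J-{q}. h j)" for h :: "'j \<Rightarrow> real"
          using prod.remove[OF J 3(2)] by simp
        moreover have "(\<Prod>j\<in>J-{q}. f' j (T (sum (g j) \<alpha>) x)) = (\<Prod>j\<in>J-{q}. f j (T (sum (g j) \<alpha>) x))"
          by (intro prod.cong) (auto simp: f'_def)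
        moreover have "f q y = 2 * f' q y + c" for y by (simp add: f'_def field_simps)
        ultimately show ?thesis by (simp add: algebra_simps)
      qed
      have "(\<integral>x. (\<Prod>j\<in>J. f j (T (sum (g j) \<alpha>) x)) \<partial>M) =
          2 * (\<integral>x. (\<Prod>j\<in>J. f' j (T (sum (g j) \<alpha>) x)) \<partial>M) + c * (\<integral>x. (\<Prod>j\<in>J-{q}. f j (T (sum (g j) \<alpha>) x)) \<partial>M)"
        unfolding split using unit_bounded_integrable[OF ub1] unit_bounded_integrable[OF ub2] by simp
      moreover have "(\<Prod>j\<in>J. \<integral>x. f j x \<partial>M) = c * (\<Prod>j\<in>J-{q}. \<integral>x. f j x \<partial>M)"
        using prod.remove[OF J 3(2)] by (simp add: c_def)
      ultimately have "(\<integral>x. (\<Prod>j\<in>J. f j (T (sum (g j) \<alpha>) x)) \<partial>M) - (\<Prod>j\<in>J. \<integral>x. f j x \<partial>M) =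
         2 * (\<integral>x. (\<Prod>j\<in>J. f' j (T (sum (g j) \<alpha>) x)) \<partial>M) + 
         c * ((\<integral>x. (\<Prod>j\<in>J-{q}. f j (T (sum (g j) \<alpha>) x)) \<partial>M) - (\<Prod>j\<in>J-{q}. \<integral>x. f j x \<partial>M))"
        (is "?L = 2 * ?I + c * ?D") by (simp add: algebra_simps)
      moreover have "\<bar>c * ?D\<bar> \<le> \<bar>?D\<bar>" using c by (simp add: abs_mult mult_left_le_one_le)
      ultimately show "\<bar>?L\<bar> < \<epsilon>" using e1 a2 by linarith
    qed
  qed
qed

lemma multi_corr_restrict: "multi_corr M T l A (\<lambda>j\<in>{1..l}. h j) = multi_corr M T l A h"
  by (simp add: multi_corr_def)

text \<open>
  Images under \<open>T (h j)\<close> are preimages under \<open>T (- h j)\<close>, whence the signs.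
\<close>

lemma multi_corr_integral:
  assumes A: "\<And>j. j \<in> {0..l} \<Longrightarrow> A j \<in> sets M"
  shows "multi_corr M T l A h = (\<integral>x. (\<Prod>j\<in>{0..l}. indicator (A j) (T (if j = 0 then 0 else - h j) x)) \<partial>M)"
proof -
  define B where "B = A 0 \<inter> (\<Inter>j\<in>{1..l}. T (h j) ` A j)"
  have "(\<Prod>j\<in>{0..l}. indicator (A j) (T (if j = 0 then 0 else - h j) x)) = (indicator B x :: real)" for x
  proof (cases "x \<in> B")
    case True
    then show ?thesis by (intro trans[OF prod.neutral]) (auto simp: B_def T_image indicator_def)
  next
    case False
    then have "x \<notin> A 0 \<or> (\<exists>j\<in>{1..l}. T (- h j) x \<notin> A j)"
      by (auto simp: B_def T_image)
    then obtain j where j: "j \<in> {0..l}" "T (if j = 0 then 0 else - h j) x \<notin> A j"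
    proof
      assume "x \<notin> A 0"
      then show thesis using that[of 0] by simp
    next
      assume "\<exists>j\<in>{1..l}. T (- h j) x \<notin> A j"
      then obtain j where "1 \<le> j" "j \<le> l" "T (- h j) x \<notin> A j" by auto
      then show thesis using that[of j] by simp
    qed
    then have "(\<Prod>j\<in>{0..l}. indicator (A j) (T (if j = 0 then 0 else - h j) x)) = (0::real)"
      by (intro prod_zero bexI[of _ j]) auto
    then show ?thesis using False by simp
  qed
  moreover have "B \<in> sets M"
  proof -
    have "(\<Inter>j\<in>{1..l}. T (- h j) -` A j) \<in> sets M" if "1 \<le> l"
      using that A by (intro sets.finite_INT) auto
    then show ?thesis using A[of 0] by (cases "1 \<le> l") (auto simp: B_def T_image)
  qed
  ultimately show ?thesis by (simp add: multi_corr_def B_def)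
qed

text \<open>
  The set \<open>A 0\<close> becomes a factor like the others, belonging to the zero sequence.
\<close>

lemma multiple_mixing_sets:
  assumes mm: "mildly_mixing M T" and g: "IP_tilde_gen l g"
    and A: "\<And>j. j \<in> {0..l} \<Longrightarrow> A j \<in> sets M" and \<epsilon>: "\<epsilon> > 0"
  shows "IP_star {\<alpha>. \<bar>multi_corr M T l A (\<lambda>j. sum (g j) \<alpha>) - (\<Prod>j=0..l. measure M (A j))\<bar> < \<epsilon>}"
proof -
  define G where "G j k = (if j = 0 then 0 else - g j k)" for j k
  have sumG: "sum (G j) \<alpha> = (if j = 0 then 0 else - sum (g j) \<alpha>)" for j \<alpha>
    by (simp add: G_def sum_negf)
  have "fs_tends_infinity (\<lambda>\<alpha>. sum (G i) \<alpha> - sum (G j) \<alpha>)" if "i \<in> {0..l}" "j \<in> {0..l}" "i \<noteq> j" for i j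
  proof -
    have 1: "fs_tends_infinity (\<lambda>\<alpha>. sum (g j) \<alpha>)" if "j \<noteq> 0" "j \<le> l" for j
      using g that by (auto simp: IP_tilde_gen_def)
    have 2: "fs_tends_infinity (\<lambda>\<alpha>. sum (g j) \<alpha> - sum (g i) \<alpha>)" if "j \<noteq> 0" "j \<le> l" "i \<noteq> 0" "i \<le> l" "i \<noteq> j" for i j
      using g that by (auto simp: IP_tilde_gen_def)
    show ?thesis
      using that 1[of i] 1[of j] 2[of j i] fs_tends_infinity_uminus[OF 1[of i]]
      by (cases "i = 0"; cases "j = 0") (auto simp: sumG)
  qed
  then have "IP_star {\<alpha>. \<bar>(\<integral>x. (\<Prod>j\<in>{0..l}. indicator (A j) (T (sum (G j) \<alpha>) x)) \<partial>M) 
      - (\<Prod>j\<in>{0..l}. \<integral>x. indicator (A j) x \<partial>M)\<bar> < \<epsilon>}"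
    using A \<epsilon> by (intro multiple_mixing_functions[OF mm]) (auto simp: unit_bounded_def indicator_def)
  moreover have "multi_corr M T l A h = (\<integral>x. (\<Prod>j\<in>{0..l}. indicator (A j) (T (if j = 0 then 0 else - h j) x)) \<partial>M)" for h
    using A by (rule multi_corr_integral)
  ultimately show ?thesis by (simp add: sumG)
qed

end

section \<open>Convergence along a single IP-ring for all measurable sets\<close>

lemma countable_basis:
  assumes "compact (UNIV :: 'a::metric_space set)"
  obtains b :: "nat \<Rightarrow> 'a::metric_space set" where "\<And>i. open (b i)" "\<And>U. open U \<Longrightarrow> \<exists>I. U = (\<Union>i\<in>I. b i)"
proof -
  have "\<exists>k. finite k \<and> (UNIV :: 'a set) \<subseteq> (\<Union>x\<in>k. ball x (1 / Suc n))" for n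
    using assms unfolding compact_eq_totally_bounded by (auto simp del: of_nat_Suc)
  then obtain k where k: "\<And>n. finite (k n)" "\<And>n. (UNIV :: 'a set) \<subseteq> (\<Union>x\<in>k n. ball x (1 / Suc n))"
    by metis
  define B where "B = (\<Union>n. (\<lambda>x. ball x (1 / Suc n)) ` k n)"
  have B: "countable B" using k(1) by (auto simp: B_def intro: countable_finite)
  have "k 0 \<noteq> {}" using k(2)[of 0] by auto
  then have "B \<noteq> {}" by (auto simp: B_def)
  define b where "b = from_nat_into B"
  have b: "range b = B" using range_from_nat_into[OF \<open>B \<noteq> {}\<close> B] by (simp add: b_def)
  show thesis
  proof
    show "open (b i)" for i
    proof -
      have "b i \<in> B" using b by auto
      then show ?thesis by (auto simp: B_def)
    qed
    fix U :: "'a set" assume U: "open U"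
    have "x \<in> (\<Union>i\<in>{i. b i \<subseteq> U}. b i)" if x: "x \<in> U" for x
    proof -
      obtain e where e: "e > 0" "ball x e \<subseteq> U" using U x by (auto simp: open_contains_ball)
      obtain n where n: "1 / Suc n < e / 2" using e nat_approx_posE[of "e / 2"] by auto
      have "x \<in> (\<Union>x\<in>k n. ball x (1 / Suc n))" using k(2)[of n] by blast
      then obtain y where y: "y \<in> k n" "dist y x < 1 / Suc n" by (auto simp del: of_nat_Suc)
      have "ball y (1 / Suc n) \<subseteq> ball x e"
      proof
        fix z assume "z \<in> ball y (1 / Suc n)"
        then have "dist y z < 1 / Suc n" by simp
        with y n dist_triangle3[of x z y] show "z \<in> ball x e" by simp
      qed
      moreover have "ball y (1 / Suc n) \<in> range b" using b y(1) by (auto simp: B_def)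
      then obtain i where "b i = ball y (1 / Suc n)" by (metis imageE)
      ultimately show ?thesis using e y by (intro UN_I[of i]) auto
    qed
    then have "U = (\<Union>i\<in>{i. b i \<subseteq> U}. b i)" by auto
    then show "\<exists>I. U = (\<Union>i\<in>I. b i)" by blast
  qed
qed

context mp_sys begin

text \<open>
  Measurable sets are approximated by sets that are determined by finitely many members of a
  countable basis. The latter form a countable algebra, and the approximable sets form a
  sigma-algebra that contains all open sets.
\<close>

lemma countable_dense_sets:
  obtains D where "countable D" "D \<noteq> {}" "D \<subseteq> sets M"
    "\<And>A \<epsilon>. A \<in> sets M \<Longrightarrow> 0 < \<epsilon> \<Longrightarrow> \<exists>B\<in>D. measure M (sym_diff A B) < \<epsilon>"
proof -
  have "compact (UNIV :: 'x set)" using sys by (simp add: mp_system_def)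
  then obtain b :: "nat \<Rightarrow> 'x set" where b: "\<And>i. open (b i)" "\<And>U. open U \<Longrightarrow> \<exists>I. U = (\<Union>i\<in>I. b i)"
    using countable_basis by metis
  have bM [measurable]: "b i \<in> sets M" for i using b(1) by (simp add: sets_M)
  (* Which of the first n basis sets contain x; the sets determined by this form the algebra. *)
  define code where "code n x = {i. i < n \<and> x \<in> b i}" for n x
  define D where "D = (\<Union>n. range (\<lambda>S. code n -` S))"
  have fin: "finite (range (\<lambda>S. code n -` S))" for n
  proof (rule finite_subset)
    show "range (\<lambda>S. code n -` S) \<subseteq> (\<lambda>S. code n -` S) ` Pow (Pow {..<n})"
    proof (rule image_subsetI)
      fix S show "code n -` S \<in> (\<lambda>S. code n -` S) ` Pow (Pow {..<n})"
        by (rule image_eqI[of _ _ "S \<inter> Pow {..<n}"]) (auto simp: code_def)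
    qed
  qed simp
  have D1: "code n -` S \<in> D" for n S by (auto simp: D_def)
  have DM: "D \<subseteq> sets M"
  proof -
    have "code n -` S \<in> sets M" for n S
    proof -
      have eq: "code n -` S = (\<Union>Q\<in>S \<inter> Pow {..<n}. {x \<in> space M. \<forall>i\<in>{..<n}. (x \<in> b i) = (i \<in> Q)})"
      proof (intro set_eqI iffI)
        fix x assume "x \<in> code n -` S"
        then show "x \<in> (\<Union>Q\<in>S \<inter> Pow {..<n}. {x \<in> space M. \<forall>i\<in>{..<n}. (x \<in> b i) = (i \<in> Q)})"
          by (intro UN_I[of "code n x"]) (auto simp: code_def)
      next
        fix x assume "x \<in> (\<Union>Q\<in>S \<inter> Pow {..<n}. {x \<in> space M. \<forall>i\<in>{..<n}. (x \<in> b i) = (i \<in> Q)})"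
        then obtain Q where Q: "Q \<in> S" "Q \<subseteq> {..<n}" "\<forall>i\<in>{..<n}. (x \<in> b i) = (i \<in> Q)" by auto
        then have "code n x = Q" by (auto simp: code_def)
        with Q show "x \<in> code n -` S" by simp
      qed
      have "{x \<in> space M. \<forall>i\<in>{..<n}. (x \<in> b i) = (i \<in> Q)} \<in> sets M" for Q
        by measurable
      then show ?thesis unfolding eq by (intro sets.finite_UN) auto
    qed
    then show ?thesis by (auto simp: D_def)
  qed
  have DC: "- A \<in> D" if "A \<in> D" for A
  proof -
    obtain n S where "A = code n -` S" using \<open>A \<in> D\<close> by (auto simp: D_def)
    then have "- A = code n -` (- S)" by auto
    then show ?thesis using D1 by (rule ssubst)
  qed
  have DU: "A \<union> B \<in> D" if AB: "A \<in> D" "B \<in> D" for A B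
  proof -
    obtain n S m S' where "A = code n -` S" "B = code m -` S'" using AB by (auto simp: D_def)
    moreover have "code i x = code k x \<inter> {..<i}" if "i \<le> k" for i k x using that by (auto simp: code_def)
    then have "code n x = code (max n m) x \<inter> {..<n}" "code m x = code (max n m) x \<inter> {..<m}" for x by auto
    ultimately have "A \<union> B = code (max n m) -` {Q. Q \<inter> {..<n} \<in> S \<or> Q \<inter> {..<m} \<in> S'}" by auto
    then show ?thesis using D1 by (rule ssubst)
  qed
  have D0: "{} \<in> D" using D1[of 0 "{}"] by simp
  have Db: "b i \<in> D" for i
  proof -
    have "b i = code (Suc i) -` {Q. i \<in> Q}" by (auto simp: code_def)
    then show ?thesis using D1 by (rule ssubst)
  qed
  define app where "app A \<longleftrightarrow> A \<in> sets M \<and> (\<forall>\<epsilon>>0. \<exists>B\<in>D. measure M (sym_diff A B) < \<epsilon>)" for A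
  have appD: "app A" if "A \<in> D" for A
    using that DM unfolding app_def by (auto intro!: bexI[of _ A])
  have appU: "app (A \<union> A')" if A: "app A" "app A'" for A A'
    unfolding app_def
  proof (intro conjI allI impI)
    show "A \<union> A' \<in> sets M" using A by (auto simp: app_def)
    fix \<epsilon> :: real assume "\<epsilon> > 0"
    then obtain B B' where B: "B \<in> D" "measure M (sym_diff A B) < \<epsilon> / 2" "B' \<in> D" "measure M (sym_diff A' B') < \<epsilon> / 2"
      using A unfolding app_def by (meson half_gt_zero)
    have [measurable]: "A \<in> sets M" "A' \<in> sets M" "B \<in> sets M" "B' \<in> sets M"
      using A B DM by (auto simp: app_def)
    have "measure M (sym_diff (A \<union> A') (B \<union> B')) \<le> measure M (sym_diff A B \<union> sym_diff A' B')"
      by (intro finite_measure_mono) auto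
    also have "\<dots> \<le> measure M (sym_diff A B) + measure M (sym_diff A' B')"
      by (intro measure_Un_le) auto
    finally show "\<exists>B\<in>D. measure M (sym_diff (A \<union> A') B) < \<epsilon>"
      using B by (intro bexI[of _ "B \<union> B'"] DU) auto
  qed
  have appUN: "app (\<Union>i. A i)" if A: "\<And>i. app (A i)" for A :: "nat \<Rightarrow> 'x set"
    unfolding app_def
  proof (intro conjI allI impI)
    have [measurable]: "A i \<in> sets M" for i using A by (simp add: app_def)
    show "(\<Union>i. A i) \<in> sets M" by auto
    fix \<epsilon> :: real assume \<epsilon>: "\<epsilon> > 0"
    define U where "U n = (\<Union>i<n. A i)" for n
    have U: "app (U n)" for n
      by (induction n) (auto simp: U_def lessThan_Suc intro: appU appD D0 A)
    have [measurable]: "U n \<in> sets M" for n using U by (simp add: app_def)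
    have UU: "(\<Union>n. U n) = (\<Union>i. A i)" by (auto simp: U_def)
    have "(\<lambda>n. measure M (U n)) \<longlonglongrightarrow> measure M (\<Union>n. U n)"
      by (rule finite_Lim_measure_incseq) (force simp: U_def incseq_def)+
    from tendstoD[OF this half_gt_zero[OF \<epsilon>]]
    have "eventually (\<lambda>n. dist (measure M (U n)) (measure M (\<Union>i. A i)) < \<epsilon> / 2) sequentially"
      unfolding UU .
    then obtain n where n: "dist (measure M (U n)) (measure M (\<Union>i. A i)) < \<epsilon> / 2"
      by (auto simp: eventually_sequentially)
    obtain B where B: "B \<in> D" "measure M (sym_diff (U n) B) < \<epsilon> / 2"
      using U[of n] \<epsilon> unfolding app_def by (meson half_gt_zero)
    have [measurable]: "B \<in> sets M" using B DM by auto
    have "measure M (sym_diff (\<Union>i. A i) B) \<le> measure M (((\<Union>i. A i) - U n) \<union> sym_diff (U n) B)"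
      by (intro finite_measure_mono) (auto simp: U_def)
    also have "\<dots> \<le> measure M ((\<Union>i. A i) - U n) + measure M (sym_diff (U n) B)"
      by (intro measure_Un_le) auto
    also have "measure M ((\<Union>i. A i) - U n) = measure M (\<Union>i. A i) - measure M (U n)"
      by (intro finite_measure_Diff) (auto simp: U_def)
    also have "\<dots> < \<epsilon> / 2" using n unfolding dist_real_def by linarith
    finally show "\<exists>B\<in>D. measure M (sym_diff (\<Union>i. A i) B) < \<epsilon>"
      using B by (intro bexI[of _ B]) auto
  qed
  have main: "app A" if "A \<in> sets M" for A
  proof -
    have "A \<in> sigma_sets UNIV {U. open U}"
      using that by (simp add: sets_M borel_def sets_measure_of)
    then show ?thesis
    proof (induction rule: sigma_sets.induct)
      case (Basic U)
      then obtain I where "U = (\<Union>i\<in>I. b i)" using b(2) by blast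
      then have "U = (\<Union>i. if i \<in> I then b i else {})" by (auto split: if_splits)
      moreover have "app (\<Union>i. if i \<in> I then b i else {})"
        by (rule appUN) (simp add: appD Db D0)
      ultimately show ?case by (rule ssubst)
    next
      case Empty
      then show ?case by (simp add: appD D0)
    next
      case (Compl A)
      have "\<exists>B\<in>D. measure M (sym_diff (UNIV - A) B) < \<epsilon>" if pos: "\<epsilon> > 0" for \<epsilon>
      proof -
        obtain B where B: "B \<in> D" "measure M (sym_diff A B) < \<epsilon>" using Compl.IH pos unfolding app_def by metis
        moreover have "sym_diff (UNIV - A) (- B) = sym_diff A B" by auto
        ultimately show ?thesis using DC by (intro bexI[of _ "- B"]) auto
      qed
      moreover have "UNIV - A \<in> sets M" 
        using Compl.IH sets.compl_sets[of A M] by (simp add: app_def)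
      ultimately show ?case by (simp add: app_def)
    next
      case (Union A)
      then show ?case by (intro appUN)
    qed
  qed
  show thesis
  proof (rule that[of D])
    show "countable D" using fin by (auto simp: D_def intro: countable_finite)
    show "\<exists>B\<in>D. measure M (sym_diff A B) < \<epsilon>" if "A \<in> sets M" "0 < \<epsilon>" for A \<epsilon>
      using main[OF that(1)] that(2) by (simp add: app_def)
  qed (use D0 DM in auto)
qed

lemma measure_diff_le_sym_diff:
  assumes [measurable]: "A \<in> sets M" "B \<in> sets M"
  shows "\<bar>measure M A - measure M B\<bar> \<le> measure M (sym_diff A B)"
proof -
  have "measure M C \<le> measure M C' + measure M (sym_diff C C')" 
    if [measurable]: "C \<in> sets M" "C' \<in> sets M" for C C'
  proof -
    have "measure M C \<le> measure M (C' \<union> sym_diff C C')" by (intro finite_measure_mono) auto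
    also have "\<dots> \<le> measure M C' + measure M (sym_diff C C')" by (intro measure_Un_le) auto
    finally show ?thesis .
  qed
  from this[OF assms] this[OF assms(2,1)] show ?thesis by (simp add: Un_commute abs_le_iff)
qed

lemma multi_corr_diff_le:
  assumes A: "\<And>j. j \<in> {0..l} \<Longrightarrow> A j \<in> sets M" and B: "\<And>j. j \<in> {0..l} \<Longrightarrow> B j \<in> sets M"
  shows "\<bar>multi_corr M T l A h - multi_corr M T l B h\<bar> \<le> (\<Sum>j\<in>{0..l}. measure M (sym_diff (A j) (B j)))"
proof -
  define k where "k j = (if j = 0 then 0 else - h j)" for j
  have [measurable]: "A j \<in> sets M" "B j \<in> sets M" if "j \<in> {0..l}" for j using A B that by auto
  have ub: "unit_bounded M (\<lambda>x. \<Prod>j\<in>{0..l}. indicator (C j) (T (k j) x))" 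
    if C: "\<And>j. j \<in> {0..l} \<Longrightarrow> C j \<in> sets M" for C
  proof (rule unit_bounded_prod)
    fix j assume "j \<in> {0..l}"
    then have "unit_bounded M (indicator (C j))" using C by (auto simp: unit_bounded_def indicator_def)
    then show "unit_bounded M (\<lambda>x. indicator (C j) (T (k j) x))" by (rule unit_bounded_T)
  qed
  note int = unit_bounded_integrable[OF ub]
  have mc: "multi_corr M T l C h = (\<integral>x. (\<Prod>j\<in>{0..l}. indicator (C j) (T (k j) x)) \<partial>M)"
    if "\<And>j. j \<in> {0..l} \<Longrightarrow> C j \<in> sets M" for C
    unfolding k_def by (rule multi_corr_integral[OF that])
  have si: "integrable M (\<lambda>x. indicat_real (sym_diff (A j) (B j)) (T (k j) x))" if j: "j \<in> {0..l}" for j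
  proof -
    have "unit_bounded M (indicator (sym_diff (A j) (B j)))" using j A B by (auto simp: unit_bounded_def indicator_def)
    then show ?thesis by (intro unit_bounded_integrable unit_bounded_T)
  qed
  have "\<bar>multi_corr M T l A h - multi_corr M T l B h\<bar> =
    \<bar>\<integral>x. (\<Prod>j\<in>{0..l}. indicator (A j) (T (k j) x)) - (\<Prod>j\<in>{0..l}. indicator (B j) (T (k j) x)) \<partial>M\<bar>"
    unfolding mc[of A, OF A, simplified] mc[of B, OF B, simplified]
    by (subst Bochner_Integration.integral_diff) (use int A B in auto)
  also have "\<dots> \<le> (\<integral>x. (\<Sum>j\<in>{0..l}. indicat_real (sym_diff (A j) (B j)) (T (k j) x)) \<partial>M)"
  proof (rule order_trans[OF integral_abs_bound integral_mono])
    show "integrable M (\<lambda>x. \<bar>(\<Prod>j\<in>{0..l}. indicator (A j) (T (k j) x)) - (\<Prod>j\<in>{0..l}. indicat_real (B j) (T (k j) x))\<bar>)"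
      by (intro integrable_abs Bochner_Integration.integrable_diff int A B)
    show "integrable M (\<lambda>x. \<Sum>j\<in>{0..l}. indicat_real (sym_diff (A j) (B j)) (T (k j) x))"
      by (intro Bochner_Integration.integrable_sum si)
    fix x
    have "norm ((\<Prod>j\<in>{0..l}. indicator (A j) (T (k j) x)) - (\<Prod>j\<in>{0..l}. indicat_real (B j) (T (k j) x)))
       \<le> (\<Sum>j\<in>{0..l}. norm (indicator (A j) (T (k j) x) - indicat_real (B j) (T (k j) x)))"
      by (rule norm_prod_diff) (auto simp: indicator_def)
    also have "\<dots> = (\<Sum>j\<in>{0..l}. indicat_real (sym_diff (A j) (B j)) (T (k j) x))"
      by (intro sum.cong) (auto simp: indicator_def)
    finally show "\<bar>(\<Prod>j\<in>{0..l}. indicator (A j) (T (k j) x)) - (\<Prod>j\<in>{0..l}. indicat_real (B j) (T (k j) x))\<bar>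
       \<le> (\<Sum>j\<in>{0..l}. indicat_real (sym_diff (A j) (B j)) (T (k j) x))" by simp
  qed
  also have "\<dots> = (\<Sum>j\<in>{0..l}. \<integral>x. indicat_real (sym_diff (A j) (B j)) (T (k j) x) \<partial>M)"
    by (rule Bochner_Integration.integral_sum[OF si])
  also have "\<dots> = (\<Sum>j\<in>{0..l}. measure M (sym_diff (A j) (B j)))"
  proof (rule sum.cong[OF refl])
    fix j assume j: "j \<in> {0..l}"
    have "(\<integral>x. indicat_real (sym_diff (A j) (B j)) (T (k j) x) \<partial>M) = (\<integral>x. indicat_real (sym_diff (A j) (B j)) x \<partial>M)"
      using j by (intro integral_T) auto
    then show "(\<integral>x. indicat_real (sym_diff (A j) (B j)) (T (k j) x) \<partial>M) = measure M (sym_diff (A j) (B j))"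
      using j by simp
  qed
  finally show ?thesis .
qed

text \<open>
  There are only countably many tuples of approximating sets and tolerances \<open>1 / Suc k\<close>, so one
  IP-ring works for all of them; by continuity of the correlations in the sets it then works for
  all measurable tuples.
\<close>

lemma ring_of_IP_star:
  assumes star: "\<And>A \<epsilon>. (\<And>j. j \<in> {0..l} \<Longrightarrow> A j \<in> sets M) \<Longrightarrow> \<epsilon> > 0 \<Longrightarrow>
     IP_star {\<alpha>. \<bar>multi_corr M T l A (\<lambda>j. h j \<alpha>) - (\<Prod>j=0..l. measure M (A j))\<bar> < \<epsilon>}"
  shows "\<exists>a. block_seq a \<and> (\<forall>A. (\<forall>j\<in>{0..l}. A j \<in> sets M) \<longrightarrow>
     ((\<lambda>\<alpha>. multi_corr M T l A (\<lambda>j. h j \<alpha>)) \<longlongrightarrow> (\<Prod>j=0..l. measure M (A j))) (IP_filter (finite_unions a)))"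
proof -
  define p where "p A = (\<Prod>j=0..l. measure M (A j))" for A
  define c where "c A \<alpha> = multi_corr M T l A (\<lambda>j. h j \<alpha>)" for A \<alpha>
  obtain D where D: "countable D" "D \<noteq> {}" "D \<subseteq> sets M"
    "\<And>A \<epsilon>. A \<in> sets M \<Longrightarrow> 0 < \<epsilon> \<Longrightarrow> \<exists>B\<in>D. measure M (sym_diff A B) < \<epsilon>"
    using countable_dense_sets by blast
  define E where "E = ({0..l} \<rightarrow>\<^sub>E D) \<times> (UNIV :: nat set)"
  have E: "countable E" "E \<noteq> {}" 
    using D(1,2) by (auto simp: E_def PiE_eq_empty_iff intro!: countable_SIGMA countable_PiE)
  define e where "e = from_nat_into E"
  have eE: "e n \<in> E" for n using E by (simp add: e_def from_nat_into)
  define Good where "Good n = {\<alpha>. \<bar>c (fst (e n)) \<alpha> - p (fst (e n))\<bar> < 1 / Suc (snd (e n))}" for n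
  have "IP_star (Good n)" for n
  proof -
    show ?thesis unfolding Good_def c_def p_def
    proof (rule star)
      show "fst (e n) j \<in> sets M" if "j \<in> {0..l}" for j
        using eE[of n] D(3) that by (auto simp: E_def mem_Times_iff)
    qed simp
  qed
  from IP_star_diagonal[of Good, OF this] obtain a where a: "block_seq a"
    and aB: "\<And>n \<beta>. \<beta> \<in> fin_sets \<Longrightarrow> n < Min \<beta> \<Longrightarrow> \<bar>c (fst (e n)) (\<Union>k\<in>\<beta>. a k) - p (fst (e n))\<bar> < 1 / Suc (snd (e n))"
    unfolding Good_def by blast
  have "(c A \<longlongrightarrow> p A) (IP_filter (finite_unions a))" if A: "\<forall>j\<in>{0..l}. A j \<in> sets M" for A
  proof (rule tendstoI)
    fix \<epsilon> :: real assume \<epsilon>: "\<epsilon> > 0"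
    (* The l + 1 approximation errors add up to epsilon / 4. *)
    define \<delta> where "\<delta> = \<epsilon> / (4 * (l + 1))"
    have \<delta>: "\<delta> > 0" "(l + 1) * \<delta> = \<epsilon> / 4" using \<epsilon> by (auto simp: \<delta>_def field_simps)
    have "\<forall>j\<in>{0..l}. \<exists>B\<in>D. measure M (sym_diff (A j) B) < \<delta>" using A \<delta> D(4) by auto
    then obtain B0 where B0: "\<And>j. j \<in> {0..l} \<Longrightarrow> B0 j \<in> D \<and> measure M (sym_diff (A j) (B0 j)) < \<delta>"
      by metis
    define B where "B = restrict B0 {0..l}"
    have B: "B \<in> {0..l} \<rightarrow>\<^sub>E D" "\<And>j. j \<in> {0..l} \<Longrightarrow> measure M (sym_diff (A j) (B j)) < \<delta>"
      using B0 by (auto simp: B_def)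
    have BM: "B j \<in> sets M" if "j \<in> {0..l}" for j using B(1) D(3) that by auto
    obtain k where k: "1 / Suc k < \<epsilon> / 2" using \<epsilon> nat_approx_posE[of "\<epsilon> / 2"] by auto
    have "(B, k) \<in> range e" using B(1) range_from_nat_into[OF E(2,1)] by (simp add: e_def E_def)
    then obtain n where n: "e n = (B, k)" by (metis imageE)
    have S: "(\<Sum>j\<in>{0..l}. measure M (sym_diff (A j) (B j))) \<le> \<epsilon> / 4"
    proof -
      have "(\<Sum>j\<in>{0..l}. measure M (sym_diff (A j) (B j))) \<le> (\<Sum>j\<in>{0..l}. \<delta>)"
        using B(2) by (intro sum_mono) (auto intro: less_imp_le)
      also have "\<dots> = \<epsilon> / 4" using \<delta>(2) by (simp add: add.commute)
      finally show ?thesis .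
    qed
    have pd: "\<bar>p A - p B\<bar> \<le> \<epsilon> / 4"
    proof -
      have "norm (p A - p B) \<le> (\<Sum>j\<in>{0..l}. norm (measure M (A j) - measure M (B j)))"
        unfolding p_def by (rule norm_prod_diff) auto
      also have "\<dots> \<le> (\<Sum>j\<in>{0..l}. measure M (sym_diff (A j) (B j)))"
        using A BM by (intro sum_mono) (auto intro!: measure_diff_le_sym_diff)
      finally show ?thesis using S by simp
    qed
    show "eventually (\<lambda>\<alpha>. dist (c A \<alpha>) (p A) < \<epsilon>) (IP_filter (finite_unions a))"
    proof (rule eventually_IP_filter_finite_unions[OF a])
      fix \<beta> assume "\<beta> \<in> fin_sets" "n < Min \<beta>"
      from aB[OF this] k n have "\<bar>c B (\<Union>k\<in>\<beta>. a k) - p B\<bar> < \<epsilon> / 2" by simp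
      moreover have "\<bar>c A (\<Union>k\<in>\<beta>. a k) - c B (\<Union>k\<in>\<beta>. a k)\<bar> \<le> \<epsilon> / 4"
        using multi_corr_diff_le[of l A B] A BM S unfolding c_def by (meson order_trans)
      ultimately show "dist (c A (\<Union>k\<in>\<beta>. a k)) (p A) < \<epsilon>"
        using pd unfolding dist_real_def by linarith
    qed
  qed
  then show ?thesis using a unfolding c_def p_def by blast
qed

end

section \<open>From sets to square-integrable functions\<close>

definition L2norm :: "'x measure \<Rightarrow> ('x \<Rightarrow> complex) \<Rightarrow> real" where
  "L2norm M f = sqrt (\<integral>x. (cmod (f x))\<^sup>2 \<partial>M)"

lemma L2_measurable: "f \<in> L2 M \<Longrightarrow> f \<in> borel_measurable M"
  and L2_integrable: "f \<in> L2 M \<Longrightarrow> integrable M (\<lambda>x. (cmod (f x))\<^sup>2)"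
  by (auto simp: L2_def)

text \<open>
  The nonnegative quadratic polynomial \<open>t \<mapsto> \<integral> (t |f| - |h|)\<^sup>2\<close> has nonpositive discriminant.
\<close>

lemma L2_cauchy_schwarz:
  assumes f: "f \<in> L2 M" and h: "h \<in> L2 M"
  shows "integrable M (\<lambda>x. cmod (f x) * cmod (h x))"
    and "(\<integral>x. cmod (f x) * cmod (h x) \<partial>M) \<le> L2norm M f * L2norm M h"
proof -
  note [measurable] = L2_measurable[OF f] L2_measurable[OF h]
  note fi = L2_integrable[OF f] and hi = L2_integrable[OF h]
  have bound: "cmod (f x) * cmod (h x) \<le> (cmod (f x))\<^sup>2 + (cmod (h x))\<^sup>2" for x
    using sum_squares_bound[of "cmod (f x)" "cmod (h x)"] 
      mult_nonneg_nonneg[OF norm_ge_zero norm_ge_zero, of "f x" "h x"] by linarith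
  show int: "integrable M (\<lambda>x. cmod (f x) * cmod (h x))"
    by (rule Bochner_Integration.integrable_bound[OF Bochner_Integration.integrable_add[OF fi hi]])
      (use bound in \<open>auto simp: abs_mult\<close>)
  define a b c where "a = (\<integral>x. (cmod (f x))\<^sup>2 \<partial>M)" and "b = (\<integral>x. (cmod (h x))\<^sup>2 \<partial>M)"
    and "c = (\<integral>x. cmod (f x) * cmod (h x) \<partial>M)"
  have ab: "0 \<le> a" "0 \<le> b" "0 \<le> c" by (auto simp: a_def b_def c_def intro!: integral_nonneg_AE)
  have quad: "0 \<le> t\<^sup>2 * a - 2 * t * c + b" for t
  proof -
    have eq: "(t * cmod (f x) - cmod (h x))\<^sup>2 =
        t\<^sup>2 * (cmod (f x))\<^sup>2 - (2 * t) * (cmod (f x) * cmod (h x)) + (cmod (h x))\<^sup>2" for x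
      by (simp add: power2_eq_square algebra_simps)
    have "0 \<le> (\<integral>x. (t * cmod (f x) - cmod (h x))\<^sup>2 \<partial>M)" by (rule integral_nonneg_AE) auto
    also have "\<dots> = t\<^sup>2 * a - 2 * t * c + b"
      unfolding eq a_def b_def c_def using fi hi int by simp
    finally show ?thesis .
  qed
  have "c\<^sup>2 \<le> a * b"
  proof (cases "a = 0")
    case True
    have "c = 0"
    proof (rule ccontr)
      assume "c \<noteq> 0"
      with quad[of "(b + 1) / (2 * c)"] True show False by simp
    qed
    then show ?thesis using True by simp
  next
    case False
    with ab have "a > 0" by simp
    have "0 \<le> a * ((c / a)\<^sup>2 * a - 2 * (c / a) * c + b)"
      using quad[of "c / a"] \<open>a > 0\<close> by (intro mult_nonneg_nonneg) auto
    also have "\<dots> = a * b - c\<^sup>2"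
      using \<open>a > 0\<close> by (simp add: field_simps power2_eq_square)
    finally show ?thesis by simp
  qed
  then have "c \<le> sqrt (a * b)" using ab by (simp add: real_le_rsqrt)
  then show "(\<integral>x. cmod (f x) * cmod (h x) \<partial>M) \<le> L2norm M f * L2norm M h"
    by (simp add: L2norm_def a_def b_def c_def real_sqrt_mult)
qed

lemma L2_mult:
  assumes f: "f \<in> L2 M" and h: "h \<in> L2 M"
  shows "integrable M (\<lambda>x. f x * cnj (h x))"
    and "cmod (\<integral>x. f x * cnj (h x) \<partial>M) \<le> L2norm M f * L2norm M h"
proof -
  note [measurable] = L2_measurable[OF f] L2_measurable[OF h]
  have cnj: "cnj \<in> borel_measurable borel" by (intro borel_measurable_continuous_onI continuous_intros)
  have m [measurable]: "(\<lambda>x. f x * cnj (h x)) \<in> borel_measurable M"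
    using measurable_compose[OF L2_measurable[OF h] cnj] by simp
  show "integrable M (\<lambda>x. f x * cnj (h x))"
    by (rule Bochner_Integration.integrable_bound[OF L2_cauchy_schwarz(1)[OF f h] m]) (simp add: norm_mult)
  have "cmod (\<integral>x. f x * cnj (h x) \<partial>M) \<le> (\<integral>x. norm (f x * cnj (h x)) \<partial>M)" by (rule integral_norm_bound)
  also have "\<dots> \<le> L2norm M f * L2norm M h"
    using L2_cauchy_schwarz(2)[OF f h] by (simp add: norm_mult)
  finally show "cmod (\<integral>x. f x * cnj (h x) \<partial>M) \<le> L2norm M f * L2norm M h" .
qed

lemma L2_dominated:
  assumes f: "f \<in> L2 M" and s: "s \<in> borel_measurable M" and le: "\<And>x. cmod (s x) \<le> c * cmod (f x)"
    and c: "0 \<le> c"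
  shows "s \<in> L2 M" "L2norm M s \<le> c * L2norm M f"
proof -
  have le2: "(cmod (s x))\<^sup>2 \<le> c\<^sup>2 * (cmod (f x))\<^sup>2" for x
    using power_mono[OF le[of x], of 2] by (simp add: power_mult_distrib)
  have int: "integrable M (\<lambda>x. (cmod (s x))\<^sup>2)"
    by (rule Bochner_Integration.integrable_bound[OF integrable_mult_right[OF L2_integrable[OF f], of "c\<^sup>2"]])
      (use s le2 in \<open>auto simp: abs_mult\<close>)
  then show "s \<in> L2 M" using s by (simp add: L2_def)
  have "(\<integral>x. (cmod (s x))\<^sup>2 \<partial>M) \<le> (\<integral>x. c\<^sup>2 * (cmod (f x))\<^sup>2 \<partial>M)"
    using le2 int L2_integrable[OF f] by (intro integral_mono) auto
  then have "L2norm M s \<le> sqrt (c\<^sup>2 * (\<integral>x. (cmod (f x))\<^sup>2 \<partial>M))"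
    by (simp add: L2norm_def)
  then show "L2norm M s \<le> c * L2norm M f"
    using c by (simp add: L2norm_def real_sqrt_mult)
qed

lemma L2_simple_approx:
  assumes f: "f \<in> L2 M" and sp: "space M = UNIV" and \<epsilon>: "\<epsilon> > 0"
  shows "\<exists>s. simple_function M s \<and> s \<in> L2 M \<and> (\<lambda>x. f x - s x) \<in> L2 M \<and>
    L2norm M s \<le> 2 * L2norm M f \<and> L2norm M (\<lambda>x. f x - s x) < \<epsilon>"
proof -
  have fm [measurable]: "f \<in> borel_measurable M" using L2_measurable[OF f] .
  obtain F where F: "\<And>i. simple_function M (F i)" "\<And>x. (\<lambda>i. F i x) \<longlonglongrightarrow> f x"
    "\<And>i x. cmod (F i x) \<le> 2 * cmod (f x)"
    using borel_measurable_implies_sequence_metric[OF fm, of 0] sp by auto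
  have Fm [measurable]: "F i \<in> borel_measurable M" for i 
    using F(1) by (rule borel_measurable_simple_function)
  have FL: "F i \<in> L2 M" "L2norm M (F i) \<le> 2 * L2norm M f" for i
    using L2_dominated[OF f Fm F(3)] by auto
  have d: "cmod (f x - F i x) \<le> 3 * cmod (f x)" for i x
    using norm_triangle_ineq4[of "f x" "F i x"] F(3)[of i x] by linarith
  have fF [measurable]: "(\<lambda>x. f x - F i x) \<in> borel_measurable M" for i by measurable
  have dL: "(\<lambda>x. f x - F i x) \<in> L2 M" for i
    using L2_dominated(1)[OF f fF d] by auto
  have "(\<lambda>i. \<integral>x. (cmod (f x - F i x))\<^sup>2 \<partial>M) \<longlonglongrightarrow> (\<integral>x. 0 \<partial>M)"
  proof (rule integral_dominated_convergence[where w = "\<lambda>x. 9 * (cmod (f x))\<^sup>2"])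
    show "integrable M (\<lambda>x. 9 * (cmod (f x))\<^sup>2)" using L2_integrable[OF f] by simp
    show "AE x in M. (\<lambda>i. (cmod (f x - F i x))\<^sup>2) \<longlonglongrightarrow> 0"
    proof (rule AE_I2)
      fix x
      have "(\<lambda>i. (cmod (f x - F i x))\<^sup>2) \<longlonglongrightarrow> (cmod (f x - f x))\<^sup>2"
        by (intro tendsto_intros F(2))
      then show "(\<lambda>i. (cmod (f x - F i x))\<^sup>2) \<longlonglongrightarrow> 0" by simp
    qed
    show "AE x in M. norm ((cmod (f x - F i x))\<^sup>2) \<le> 9 * (cmod (f x))\<^sup>2" for i
      using power_mono[OF d, where n = 2] by (auto simp: power_mult_distrib)
  qed auto
  from tendsto_real_sqrt[OF this] have "(\<lambda>i. L2norm M (\<lambda>x. f x - F i x)) \<longlonglongrightarrow> 0"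
    by (simp add: L2norm_def)
  from order_tendstoD(2)[OF this \<epsilon>] obtain i where "L2norm M (\<lambda>x. f x - F i x) < \<epsilon>"
    by (auto simp: eventually_sequentially)
  with F(1) FL dL show ?thesis by blast
qed

lemma simple_function_sum_indicator:
  fixes s :: "'a \<Rightarrow> 'b::real_algebra_1"
  assumes "finite (range s)"
  shows "s x = (\<Sum>y\<in>range s. y * indicator (s -` {y}) x)"
proof -
  have "(\<Sum>y\<in>range s. y * indicator (s -` {y}) x) = (\<Sum>y\<in>range s. if y = s x then y else 0)"
    by (intro sum.cong) (auto simp: indicator_def)
  then show ?thesis using assms by (simp add: sum.delta')
qed

text \<open>
  Finite intersections and arbitrary unions preserve eventual membership.
\<close>

lemma limitin_topology_generated_by:
  assumes l: "l \<in> \<Union>\<S>" and ev: "\<And>V. V \<in> \<S> \<Longrightarrow> l \<in> V \<Longrightarrow> eventually (\<lambda>x. f x \<in> V) F"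
  shows "limitin (topology_generated_by \<S>) f l F"
  unfolding limitin_def openin_topology_generated_by_iff
proof (intro conjI allI impI)
  show "l \<in> topspace (topology_generated_by \<S>)" using l by simp
  fix U assume U: "generate_topology_on \<S> U \<and> l \<in> U"
  then have "generate_topology_on \<S> U" "l \<in> U" by auto
  then show "eventually (\<lambda>x. f x \<in> U) F"
  proof (induction rule: generate_topology_on.induct)
    case (Int a b)
    then show ?case by (auto intro: eventually_conj)
  next
    case (UN K)
    then obtain k where "k \<in> K" "l \<in> k" by auto
    with UN.IH[of k] show ?case by (auto elim: eventually_mono)
  qed (use ev in auto)
qed

context mp_sys begin

lemma L2_T: 
  assumes f: "f \<in> L2 M"
  shows "(\<lambda>x. f (T g x)) \<in> L2 M" "L2norm M (\<lambda>x. f (T g x)) = L2norm M f"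
proof -
  note [measurable] = L2_measurable[OF f]
  have "distr M M (T g) = M" using sys by (simp add: mp_system_def mp_transformation_def)
  then have "integrable M (\<lambda>x. (cmod (f (T g x)))\<^sup>2)"
    using integrable_distr[OF T_measurable, of g "\<lambda>x. (cmod (f x))\<^sup>2"] L2_integrable[OF f] by simp
  then show "(\<lambda>x. f (T g x)) \<in> L2 M" by (simp add: L2_def)
  have "(\<integral>x. (cmod (f (T g x)))\<^sup>2 \<partial>M) = (\<integral>x. (cmod (f x))\<^sup>2 \<partial>M)"
    by (intro integral_T[of "\<lambda>x. (cmod (f x))\<^sup>2"]) measurable
  then show "L2norm M (\<lambda>x. f (T g x)) = L2norm M f" by (simp add: L2norm_def)
qed

lemma const_L2: "(\<lambda>_. c) \<in> L2 M" and L2norm_1: "L2norm M (\<lambda>_. 1) = 1"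
  using prob_space by (auto simp: L2_def L2norm_def)

lemma L2_integral:
  assumes f: "f \<in> L2 M"
  shows "integrable M f" "cmod (\<integral>x. f x \<partial>M) \<le> L2norm M f"
  using L2_mult[OF f const_L2[of 1]] L2norm_1 by simp_all

lemma integral_sum_indicator:
  assumes "finite I" and C: "\<And>i. i \<in> I \<Longrightarrow> C i \<in> sets M"
  shows "integrable M (\<lambda>x. \<Sum>i\<in>I. c i * (indicator (C i) x :: complex))"
    and "(\<integral>x. (\<Sum>i\<in>I. c i * (indicator (C i) x :: complex)) \<partial>M) = (\<Sum>i\<in>I. c i * complex_of_real (measure M (C i)))"
proof -
  have eq: "(indicator B x :: complex) = complex_of_real (indicator B x)" for B and x :: 'x
    by (simp add: indicator_def)
  have int: "integrable M (\<lambda>x. c i * (indicator (C i) x :: complex))" if "i \<in> I" for i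
    using C[OF that] by (intro integrable_mult_right integrable_real_indicator integrable_of_real)
      (auto simp: eq emeasure_eq_measure intro!: integrable_of_real integrable_real_indicator)
  then show "integrable M (\<lambda>x. \<Sum>i\<in>I. c i * (indicator (C i) x :: complex))"
    by (intro Bochner_Integration.integrable_sum)
  have "(\<integral>x. (\<Sum>i\<in>I. c i * (indicator (C i) x :: complex)) \<partial>M) = (\<Sum>i\<in>I. \<integral>x. c i * (indicator (C i) x :: complex) \<partial>M)"
    using int by (rule Bochner_Integration.integral_sum)
  also have "\<dots> = (\<Sum>i\<in>I. c i * complex_of_real (measure M (C i)))"
    by (intro sum.cong refl) (use C in \<open>simp add: eq\<close>)
  finally show "(\<integral>x. (\<Sum>i\<in>I. c i * (indicator (C i) x :: complex)) \<partial>M) = (\<Sum>i\<in>I. c i * complex_of_real (measure M (C i)))" .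
qed

text \<open>
  Bilinearity passes from sets to simple functions. Replacing \<open>f\<close> and \<open>k\<close> by close simple functions
  changes the correlation little, uniformly in \<open>\<alpha>\<close>, because the transformations are isometric.
\<close>

lemma L2_mixing_of_sets:
  assumes sets: "\<And>A B. A \<in> sets M \<Longrightarrow> B \<in> sets M \<Longrightarrow>
      ((\<lambda>\<alpha>. measure M (T (h \<alpha>) -` A \<inter> B)) \<longlongrightarrow> measure M A * measure M B) F"
    and f: "f \<in> L2 M" and k: "k \<in> L2 M"
  shows "((\<lambda>\<alpha>. \<integral>x. f (T (h \<alpha>) x) * cnj (k x) \<partial>M) \<longlongrightarrow> (\<integral>x. f x \<partial>M) * (\<integral>x. cnj (k x) \<partial>M)) F"
proof -
  have simple: "((\<lambda>\<alpha>. \<integral>x. s (T (h \<alpha>) x) * cnj (s' x) \<partial>M) \<longlongrightarrow> (\<integral>x. s x \<partial>M) * (\<integral>x. cnj (s' x) \<partial>M)) F"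
    if s: "simple_function M s" "simple_function M s'" for s s'
  proof -
    have fin: "finite (range s)" "finite (range s')" using s by (auto simp: simple_function_def)
    have [measurable]: "s -` {y} \<in> sets M" "s' -` {y} \<in> sets M" for y
      using simple_functionD(2)[OF s(1), of "{y}"] simple_functionD(2)[OF s(2), of "{y}"] by auto
    let ?A = "\<lambda>y. s -` {y}" and ?B = "\<lambda>z. s' -` {z}"
    have s1: "s x = (\<Sum>y\<in>range s. y * indicator (?A y) x)" for x
      by (rule simple_function_sum_indicator[OF fin(1)])
    have s2: "cnj (s' x) = (\<Sum>z\<in>range s'. cnj z * indicator (?B z) x)" for x
      by (subst simple_function_sum_indicator[OF fin(2)]) (auto simp: indicator_def intro!: sum.cong)
    have prod: "s (T (h \<alpha>) x) * cnj (s' x) = 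
        (\<Sum>y\<in>range s. \<Sum>z\<in>range s'. (y * cnj z) * indicator (T (h \<alpha>) -` ?A y \<inter> ?B z) x)" for \<alpha> x
      unfolding s1[of "T (h \<alpha>) x"] s2 sum_product
      by (intro sum.cong refl) (auto simp: indicator_def)
    have i1: "(\<integral>x. s (T (h \<alpha>) x) * cnj (s' x) \<partial>M) =
        (\<Sum>y\<in>range s. \<Sum>z\<in>range s'. (y * cnj z) * complex_of_real (measure M (T (h \<alpha>) -` ?A y \<inter> ?B z)))" for \<alpha>
    proof -
      have "T (h \<alpha>) -` ?A y \<inter> ?B z \<in> sets M" for y z by measurable
      then have I: "integrable M (\<lambda>x. \<Sum>z\<in>range s'. (y * cnj z) * (indicator (T (h \<alpha>) -` ?A y \<inter> ?B z) x :: complex))"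
        "(\<integral>x. (\<Sum>z\<in>range s'. (y * cnj z) * (indicator (T (h \<alpha>) -` ?A y \<inter> ?B z) x :: complex)) \<partial>M) =
         (\<Sum>z\<in>range s'. (y * cnj z) * complex_of_real (measure M (T (h \<alpha>) -` ?A y \<inter> ?B z)))" for y
        using integral_sum_indicator[OF fin(2), of "\<lambda>z. T (h \<alpha>) -` ?A y \<inter> ?B z" "\<lambda>z. y * cnj z"] by simp_all
      have "(\<integral>x. s (T (h \<alpha>) x) * cnj (s' x) \<partial>M) = 
          (\<Sum>y\<in>range s. \<integral>x. (\<Sum>z\<in>range s'. (y * cnj z) * indicator (T (h \<alpha>) -` ?A y \<inter> ?B z) x) \<partial>M)"
        unfolding prod by (rule Bochner_Integration.integral_sum) (rule I(1))
      then show ?thesis by (simp only: I(2))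
    qed
    have i2: "(\<integral>x. s x \<partial>M) = (\<Sum>y\<in>range s. y * complex_of_real (measure M (?A y)))"
      by (rule trans[OF Bochner_Integration.integral_cong[OF refl s1] integral_sum_indicator(2)[OF fin(1)]]) measurable
    have i3: "(\<integral>x. cnj (s' x) \<partial>M) = (\<Sum>z\<in>range s'. cnj z * complex_of_real (measure M (?B z)))"
      by (rule trans[OF Bochner_Integration.integral_cong[OF refl s2] integral_sum_indicator(2)[OF fin(2)]]) measurable
    have eq: "(\<integral>x. s x \<partial>M) * (\<integral>x. cnj (s' x) \<partial>M) =
        (\<Sum>y\<in>range s. \<Sum>z\<in>range s'. (y * cnj z) * complex_of_real (measure M (?A y) * measure M (?B z)))"
      unfolding i2 i3 sum_product by (intro sum.cong refl) (simp add: algebra_simps)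
    show ?thesis
      unfolding eq i1
      by (intro tendsto_sum tendsto_mult tendsto_const tendsto_of_real sets) measurable
  qed
  show ?thesis
  proof (rule tendstoI)
    fix \<epsilon> :: real assume \<epsilon>: "\<epsilon> > 0"
    define nf nk where "nf = L2norm M f" and "nk = L2norm M k"
    have nn: "0 \<le> nf" "0 \<le> nk" by (auto simp: nf_def nk_def L2norm_def)
    (* The two replacements below cost delta * nf and delta * 2 * nk; the summand 1 keeps the
       denominator positive. *)
    define m where "m = nf + 2 * nk + 1"
    define \<delta> where "\<delta> = \<epsilon> / (3 * m)"
    have m: "m > 0" using nn by (simp add: m_def)
    have \<delta>: "\<delta> > 0" "\<delta> * (nf + 2 * nk) < \<epsilon> / 3"
    proof -
      show "\<delta> > 0" using \<epsilon> m by (simp add: \<delta>_def)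
      then have "\<delta> * (nf + 2 * nk) < \<delta> * m" by (simp add: m_def)
      also have "\<dots> = \<epsilon> / 3" using m by (simp add: \<delta>_def)
      finally show "\<delta> * (nf + 2 * nk) < \<epsilon> / 3" .
    qed
    obtain s where s: "simple_function M s" "s \<in> L2 M" "(\<lambda>x. f x - s x) \<in> L2 M" 
        "L2norm M s \<le> 2 * nf" "L2norm M (\<lambda>x. f x - s x) < \<delta>"
      using L2_simple_approx[OF f space_M \<delta>(1)] unfolding nf_def by blast
    obtain s' where s': "simple_function M s'" "s' \<in> L2 M" "(\<lambda>x. k x - s' x) \<in> L2 M" 
        "L2norm M s' \<le> 2 * nk" "L2norm M (\<lambda>x. k x - s' x) < \<delta>"
      using L2_simple_approx[OF k space_M \<delta>(1)] unfolding nk_def by blast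
    \<comment> \<open>Replacing \<open>f, k\<close> by \<open>s, s'\<close> costs at most \<open>\<epsilon>/3\<close>, uniformly in the transformation.\<close>
    have small: "nf * L2norm M (\<lambda>x. k x - s' x) + L2norm M (\<lambda>x. f x - s x) * L2norm M s' < \<epsilon> / 3"
    proof -
      have "nf * L2norm M (\<lambda>x. k x - s' x) \<le> nf * \<delta>" using s'(5) nn by (intro mult_left_mono) auto
      moreover have "L2norm M (\<lambda>x. f x - s x) * L2norm M s' \<le> \<delta> * (2 * nk)"
        using s(5) s'(4) \<delta>(1) by (intro mult_mono) (auto simp: L2norm_def nk_def)
      ultimately show ?thesis using \<delta>(2) by (simp add: algebra_simps)
    qed
    have e1: "cmod ((\<integral>x. f (T (h \<alpha>) x) * cnj (k x) \<partial>M) - (\<integral>x. s (T (h \<alpha>) x) * cnj (s' x) \<partial>M)) < \<epsilon> / 3" for \<alpha>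
    proof -
      note Tf = L2_T[OF f, of "h \<alpha>"] and Ts = L2_T[OF s(2), of "h \<alpha>"] and Td = L2_T[OF s(3), of "h \<alpha>"]
      have "(\<integral>x. f (T (h \<alpha>) x) * cnj (k x) \<partial>M) - (\<integral>x. s (T (h \<alpha>) x) * cnj (s' x) \<partial>M) = 
         (\<integral>x. f (T (h \<alpha>) x) * cnj (k x) - s (T (h \<alpha>) x) * cnj (s' x) \<partial>M)"
        by (rule Bochner_Integration.integral_diff[symmetric]) (intro L2_mult Tf Ts k s')+
      also have "\<dots> = (\<integral>x. f (T (h \<alpha>) x) * cnj (k x - s' x) + (f (T (h \<alpha>) x) - s (T (h \<alpha>) x)) * cnj (s' x) \<partial>M)"
        by (intro Bochner_Integration.integral_cong refl) (simp add: algebra_simps)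
      also have "\<dots> = (\<integral>x. f (T (h \<alpha>) x) * cnj (k x - s' x) \<partial>M) + (\<integral>x. (f (T (h \<alpha>) x) - s (T (h \<alpha>) x)) * cnj (s' x) \<partial>M)"
        by (rule Bochner_Integration.integral_add) (rule L2_mult(1)[OF Tf(1) s'(3)] L2_mult(1)[OF Td(1) s'(2)])+
      also have "cmod \<dots> \<le> cmod (\<integral>x. f (T (h \<alpha>) x) * cnj (k x - s' x) \<partial>M) + cmod (\<integral>x. (f (T (h \<alpha>) x) - s (T (h \<alpha>) x)) * cnj (s' x) \<partial>M)"
        by (rule norm_triangle_ineq)
      also have "\<dots> \<le> nf * L2norm M (\<lambda>x. k x - s' x) + L2norm M (\<lambda>x. f x - s x) * L2norm M s'"
        using L2_mult(2)[OF Tf(1) s'(3)] L2_mult(2)[OF Td(1) s'(2)] Tf(2) Td(2)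
        unfolding nf_def by (intro add_mono) simp_all
      also note small
      finally show ?thesis .
    qed
    have e2: "cmod ((\<integral>x. f x \<partial>M) * (\<integral>x. cnj (k x) \<partial>M) - (\<integral>x. s x \<partial>M) * (\<integral>x. cnj (s' x) \<partial>M)) < \<epsilon> / 3"
    proof -
      note I = L2_integral
      have "(\<integral>x. f x \<partial>M) * (\<integral>x. cnj (k x) \<partial>M) - (\<integral>x. s x \<partial>M) * (\<integral>x. cnj (s' x) \<partial>M) =
         (\<integral>x. f x \<partial>M) * cnj (\<integral>x. k x - s' x \<partial>M) + (\<integral>x. f x - s x \<partial>M) * cnj (\<integral>x. s' x \<partial>M)"
        using I(1)[OF f] I(1)[OF s(2)] I(1)[OF k] I(1)[OF s'(2)] by (simp add: algebra_simps)
      also have "cmod \<dots> \<le> cmod ((\<integral>x. f x \<partial>M) * cnj (\<integral>x. k x - s' x \<partial>M)) + cmod ((\<integral>x. f x - s x \<partial>M) * cnj (\<integral>x. s' x \<partial>M))"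
        by (rule norm_triangle_ineq)
      also have "\<dots> \<le> nf * L2norm M (\<lambda>x. k x - s' x) + L2norm M (\<lambda>x. f x - s x) * L2norm M s'"
        unfolding norm_mult complex_mod_cnj nf_def
        using I(2)[OF f] I(2)[OF s(3)] I(2)[OF s'(3)] I(2)[OF s'(2)]
        by (intro add_mono mult_mono) (auto simp: L2norm_def)
      also note small
      finally show ?thesis .
    qed
    show "eventually (\<lambda>\<alpha>. dist (\<integral>x. f (T (h \<alpha>) x) * cnj (k x) \<partial>M) ((\<integral>x. f x \<partial>M) * (\<integral>x. cnj (k x) \<partial>M)) < \<epsilon>) F"
      using tendstoD[OF simple[OF s(1) s'(1)], of "\<epsilon> / 3", simplified, OF \<epsilon>]
    proof eventually_elim
      case (elim \<alpha>)
      let ?a = "\<integral>x. f (T (h \<alpha>) x) * cnj (k x) \<partial>M" and ?b = "\<integral>x. s (T (h \<alpha>) x) * cnj (s' x) \<partial>M"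
        and ?c = "(\<integral>x. s x \<partial>M) * (\<integral>x. cnj (s' x) \<partial>M)" and ?d = "(\<integral>x. f x \<partial>M) * (\<integral>x. cnj (k x) \<partial>M)"
      have "dist ?a ?d \<le> dist ?a ?b + dist ?b ?c + dist ?d ?c"
        using dist_triangle[of ?a ?d ?b] dist_triangle[of ?b ?d ?c] dist_commute[of ?c ?d] by linarith
      with e1[of \<alpha>] e2 elim show ?case unfolding dist_norm by simp
    qed
  qed
qed

lemma mildly_mixing_of_pair_mixing:
  assumes pm: "\<And>g. fs_tends_infinity (\<lambda>\<alpha>. sum g \<alpha>) \<Longrightarrow> \<exists>a. block_seq a \<and> 
     (\<forall>A\<in>sets M. \<forall>B\<in>sets M. ((\<lambda>\<alpha>. measure M (A \<inter> T (sum g \<alpha>) ` B)) \<longlongrightarrow> measure M A * measure M B) (IP_filter (finite_unions a)))"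
  shows "mildly_mixing M T"
  unfolding mildly_mixing_def
proof (intro allI impI)
  fix g :: "nat \<Rightarrow> 'g" assume "fs_tends_infinity (\<lambda>\<alpha>. sum g \<alpha>)"
  from pm[OF this] obtain a where a: "block_seq a" 
    and lim: "\<And>A B. A \<in> sets M \<Longrightarrow> B \<in> sets M \<Longrightarrow> 
      ((\<lambda>\<alpha>. measure M (A \<inter> T (sum g \<alpha>) ` B)) \<longlongrightarrow> measure M A * measure M B) (IP_filter (finite_unions a))" by blast
  have sets: "((\<lambda>\<alpha>. measure M (T (sum g \<alpha>) -` A \<inter> B)) \<longlongrightarrow> measure M A * measure M B) (IP_filter (finite_unions a))"
    if "A \<in> sets M" "B \<in> sets M" for A B
  proof -
    have "measure M (T (sum g \<alpha>) -` A \<inter> B) = measure M (A \<inter> T (sum g \<alpha>) ` B)" for \<alpha>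
      using measure_preimage_eq_image[OF that(2,1), of "sum g \<alpha>"] by (simp add: Int_commute)
    with lim[OF that] show ?thesis by simp
  qed
  have "IP_limit (L2_weak M) (finite_unions a) (\<lambda>\<alpha>. f \<circ> T (sum g \<alpha>)) (\<lambda>_. LINT x|M. f x)" if f: "f \<in> L2 M" for f
    unfolding IP_limit_iff[OF IP_ring_finite_unions[OF a]] L2_weak_def
  proof (rule limitin_topology_generated_by)
    show "(\<lambda>_. LINT x|M. f x) \<in> \<Union>{{f \<in> L2 M. (LINT x|M. f x * cnj (h x)) \<in> V} |h V. h \<in> L2 M \<and> open V}"
      using const_L2 topspace_L2_weak[of M] unfolding L2_weak_def topology_generated_by_topspace by blast
    fix U assume "U \<in> {{f \<in> L2 M. (LINT x|M. f x * cnj (h x)) \<in> V} |h V. h \<in> L2 M \<and> open V}"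
      and fU: "(\<lambda>_. LINT x|M. f x) \<in> U"
    then obtain h V where h: "h \<in> L2 M" "open V" and U: "U = {f \<in> L2 M. (LINT x|M. f x * cnj (h x)) \<in> V}" by blast
    have "(\<integral>x. f x \<partial>M) * (\<integral>x. cnj (h x) \<partial>M) \<in> V" using fU by (simp add: U)
    moreover have "((\<lambda>\<alpha>. \<integral>x. f (T (sum g \<alpha>) x) * cnj (h x) \<partial>M) \<longlongrightarrow> (\<integral>x. f x \<partial>M) * (\<integral>x. cnj (h x) \<partial>M)) (IP_filter (finite_unions a))"
      using f h(1) by (intro L2_mixing_of_sets sets)
    ultimately have "eventually (\<lambda>\<alpha>. (\<integral>x. f (T (sum g \<alpha>) x) * cnj (h x) \<partial>M) \<in> V) (IP_filter (finite_unions a))"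
      using h(2) by (intro topological_tendstoD)
    then show "eventually (\<lambda>\<alpha>. f \<circ> T (sum g \<alpha>) \<in> U) (IP_filter (finite_unions a))"
      by eventually_elim (use L2_T(1)[OF f] in \<open>simp add: U o_def\<close>)
  qed
  then show "\<exists>R. IP_ring R \<and> (\<forall>f\<in>L2 M. IP_limit (L2_weak M) R (\<lambda>\<alpha>. f \<circ> T (sum g \<alpha>)) (\<lambda>_. LINT x|M. f x))"
    using IP_ring_finite_unions[OF a] by blast
qed

section \<open>Equivalence of the conditions\<close>

text \<open>
  One index set \<open>\<alpha>\<close> for each single test: the weakest form of mixing of \<open>l\<close> sequences.
\<close>

definition recurrent :: "nat \<Rightarrow> bool" where
  "recurrent l \<longleftrightarrow> (\<forall>A. (\<forall>j\<in>{0..l}. A j \<in> sets M) \<longrightarrow> (\<forall>\<epsilon>>0. \<forall>g. IP_tilde_gen l g \<longrightarrow>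
     (\<exists>\<alpha>\<in>fin_sets. \<bar>multi_corr M T l A (\<lambda>j. sum (g j) \<alpha>) - (\<Prod>j=0..l. measure M (A j))\<bar> < \<epsilon>)))"

lemma recurrent_iff_IP_tilde_star:
  "recurrent l \<longleftrightarrow> (\<forall>A. (\<forall>j\<in>{0..l}. A j \<in> sets M) \<longrightarrow>
        (\<forall>\<epsilon>>0. IP_tilde_star l
           {g \<in> {1..l} \<rightarrow>\<^sub>E UNIV. \<bar>multi_corr M T l A g - (\<Prod>j=0..l. measure M (A j))\<bar> < \<epsilon>}))"
proof -
  have star: "IP_tilde_star l {g \<in> {1..l} \<rightarrow>\<^sub>E UNIV. \<bar>multi_corr M T l A g - p\<bar> < \<epsilon>} \<longleftrightarrow>
     (\<forall>g. IP_tilde_gen l g \<longrightarrow> (\<exists>\<alpha>\<in>fin_sets. \<bar>multi_corr M T l A (\<lambda>j. sum (g j) \<alpha>) - p\<bar> < \<epsilon>))" for A p \<epsilon>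
  proof -
    define S where "S = {g \<in> {1..l} \<rightarrow>\<^sub>E UNIV. \<bar>multi_corr M T l A g - p\<bar> < \<epsilon>}"
    have sub: "S \<subseteq> ({1..l} \<rightarrow>\<^sub>E UNIV)" by (simp add: S_def)
    have mem: "(\<lambda>j\<in>{1..l}. sum (g j) \<alpha>) \<in> S \<longleftrightarrow> \<bar>multi_corr M T l A (\<lambda>j. sum (g j) \<alpha>) - p\<bar> < \<epsilon>"
      for g :: "nat \<Rightarrow> nat \<Rightarrow> 'g" and \<alpha>
      unfolding S_def mem_Collect_eq multi_corr_restrict by simp
    show ?thesis unfolding S_def[symmetric] IP_tilde_star_iff mem using sub by simp
  qed
  show ?thesis unfolding recurrent_def star ..
qed

lemma mildly_mixing_recurrent:
  assumes "mildly_mixing M T"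
  shows "recurrent l"
  unfolding recurrent_def
proof (intro allI impI)
  fix A \<epsilon> and g :: "nat \<Rightarrow> nat \<Rightarrow> 'g"
  assume A: "\<forall>j\<in>{0..l}. A j \<in> sets M" and \<epsilon>: "(\<epsilon>::real) > 0" and g: "IP_tilde_gen l g"
  have "IP_star {\<alpha>. \<bar>multi_corr M T l A (\<lambda>j. sum (g j) \<alpha>) - (\<Prod>j=0..l. measure M (A j))\<bar> < \<epsilon>}"
    using A \<epsilon> by (intro multiple_mixing_sets assms g) auto
  from IP_starD[OF this block_family_fin_sets, of 0]
  show "\<exists>\<alpha>\<in>fin_sets. \<bar>multi_corr M T l A (\<lambda>j. sum (g j) \<alpha>) - (\<Prod>j=0..l. measure M (A j))\<bar> < \<epsilon>"
    by auto
qed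

text \<open>
  The weak form of mixing for a single sequence that is still enough for mild mixing.
\<close>

definition pair_recurrent :: bool where
  "pair_recurrent \<longleftrightarrow> (\<forall>g. fs_tends_infinity (\<lambda>\<alpha>. sum g \<alpha>) \<longrightarrow> (\<forall>A\<in>sets M. \<forall>B\<in>sets M. \<forall>\<epsilon>>0.
     \<exists>\<alpha>\<in>fin_sets. \<bar>measure M (A \<inter> T (sum g \<alpha>) ` B) - measure M A * measure M B\<bar> < \<epsilon>))"

lemma T_image_UNIV [simp]: "T g ` UNIV = UNIV"
  by (simp add: T_image)

lemma multi_corr_1: "multi_corr M T 1 A h = measure M (A 0 \<inter> T (h 1) ` A 1)"
  by (simp add: multi_corr_def)

text \<open>
  Applied to the block sums of every sub-ring, the pointwise condition says that the good index sets
  are IP*.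
\<close>

lemma ring_of_mixing:
  assumes mix: "recurrent l" and g: "IP_tilde_gen l g"
  shows "\<exists>a. block_seq a \<and> (\<forall>A. (\<forall>j\<in>{0..l}. A j \<in> sets M) \<longrightarrow>
     ((\<lambda>\<alpha>. multi_corr M T l A (\<lambda>j. sum (g j) \<alpha>)) \<longlongrightarrow> (\<Prod>j=0..l. measure M (A j))) (IP_filter (finite_unions a)))"
proof (rule ring_of_IP_star, rule IP_starI)
  fix A \<epsilon> a
  assume A: "\<And>j. j \<in> {0..l} \<Longrightarrow> A j \<in> sets M" and \<epsilon>: "(\<epsilon>::real) > 0" and a: "block_seq a"
  have "\<exists>\<alpha>\<in>fin_sets. \<bar>multi_corr M T l A (\<lambda>j. \<Sum>k\<in>\<alpha>. sum (g j) (a k)) - (\<Prod>j=0..l. measure M (A j))\<bar> < \<epsilon>"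
    using mix A \<epsilon> IP_tilde_gen_blocks[OF a g] unfolding recurrent_def by simp
  then obtain \<alpha> where \<alpha>: "\<alpha> \<in> fin_sets" 
    "\<bar>multi_corr M T l A (\<lambda>j. \<Sum>k\<in>\<alpha>. sum (g j) (a k)) - (\<Prod>j=0..l. measure M (A j))\<bar> < \<epsilon>"
    by blast
  have "(\<Sum>k\<in>\<alpha>. sum (g j) (a k)) = sum (g j) (\<Union>k\<in>\<alpha>. a k)" for j
    using sum_UN_blocks[OF a \<alpha>(1), of "g j"] by simp
  with \<alpha> show "\<exists>\<alpha>\<in>fin_sets. (\<Union>k\<in>\<alpha>. a k) \<in> {\<alpha>. \<bar>multi_corr M T l A (\<lambda>j. sum (g j) \<alpha>) - (\<Prod>j=0..l. measure M (A j))\<bar> < \<epsilon>}"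
    by auto
qed

lemma mildly_mixing_of_pair_recurrent:
  assumes "pair_recurrent"
  shows "mildly_mixing M T"
proof (rule mildly_mixing_of_pair_mixing)
  fix g :: "nat \<Rightarrow> 'g" assume g: "fs_tends_infinity (\<lambda>\<alpha>. sum g \<alpha>)"
  have 1: "IP_tilde_gen 1 (\<lambda>_. g)" using g by (simp add: IP_tilde_gen_def)
  have p2: "(\<Prod>j=0..1. measure M (A j)) = measure M (A 0) * measure M (A 1)" for A :: "nat \<Rightarrow> 'x set"
  proof -
    have "{0..1::nat} = {0, 1}" by auto
    then show ?thesis by simp
  qed
  have "\<exists>a. block_seq a \<and> (\<forall>A. (\<forall>j\<in>{0..1}. A j \<in> sets M) \<longrightarrow>
     ((\<lambda>\<alpha>. multi_corr M T 1 A (\<lambda>j. sum g \<alpha>)) \<longlongrightarrow> (\<Prod>j=0..1. measure M (A j))) (IP_filter (finite_unions a)))"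
  proof (rule ring_of_mixing[OF _ 1], unfold recurrent_def, intro allI impI)
    fix A :: "nat \<Rightarrow> 'x set" and \<epsilon> and g :: "nat \<Rightarrow> nat \<Rightarrow> 'g"
    assume A: "\<forall>j\<in>{0..1}. A j \<in> sets M" and \<epsilon>: "(\<epsilon>::real) > 0" and "IP_tilde_gen 1 g"
    then have "fs_tends_infinity (\<lambda>\<alpha>. sum (g 1) \<alpha>)" by (simp add: IP_tilde_gen_def)
    then show "\<exists>\<alpha>\<in>fin_sets. \<bar>multi_corr M T 1 A (\<lambda>j. sum (g j) \<alpha>) - (\<Prod>j=0..1. measure M (A j))\<bar> < \<epsilon>"
      using assms A \<epsilon> unfolding pair_recurrent_def multi_corr_1 p2 by simp
  qed
  then obtain a where a: "block_seq a" and lim: "\<And>A. (\<forall>j\<in>{0..1}. A j \<in> sets M) \<Longrightarrow>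
     ((\<lambda>\<alpha>. multi_corr M T 1 A (\<lambda>j. sum g \<alpha>)) \<longlongrightarrow> (\<Prod>j=0..1. measure M (A j))) (IP_filter (finite_unions a))" by metis
  have "((\<lambda>\<alpha>. measure M (A \<inter> T (sum g \<alpha>) ` B)) \<longlongrightarrow> measure M A * measure M B) (IP_filter (finite_unions a))"
    if "A \<in> sets M" "B \<in> sets M" for A B
    using lim[of "\<lambda>j. if j = 0 then A else B"] that unfolding p2 multi_corr_1 by simp
  with a show "\<exists>a. block_seq a \<and> (\<forall>A\<in>sets M. \<forall>B\<in>sets M. 
      ((\<lambda>\<alpha>. measure M (A \<inter> T (sum g \<alpha>) ` B)) \<longlongrightarrow> measure M A * measure M B) (IP_filter (finite_unions a)))" by blast
qed

lemma multi_corr_padded: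
  assumes l: "l \<ge> 1"
  shows "multi_corr M T l (\<lambda>j. if j = 0 then A else if j = 1 then B else UNIV) h = measure M (A \<inter> T (h 1) ` B)"
    and "(\<Prod>j=0..l. measure M (if j = 0 then A else if j = 1 then B else UNIV)) = measure M A * measure M B"
proof -
  have "(\<Inter>j\<in>{1..l}. T (h j) ` (if j = 0 then A else if j = 1 then B else UNIV)) = T (h 1) ` B"
    using l by (auto split: if_splits)
  then show "multi_corr M T l (\<lambda>j. if j = 0 then A else if j = 1 then B else UNIV) h = measure M (A \<inter> T (h 1) ` B)"
    by (simp add: multi_corr_def)
  have "(\<Prod>j=0..l. measure M (if j = 0 then A else if j = 1 then B else UNIV)) =
     (\<Prod>j\<in>{0,1::nat}. measure M (if j = 0 then A else if j = 1 then B else UNIV))"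
    using l prob_space by (intro prod.mono_neutral_right) auto
  then show "(\<Prod>j=0..l. measure M (if j = 0 then A else if j = 1 then B else UNIV)) = measure M A * measure M B"
    by simp
qed

text \<open>
  The set on the left is the preimage under \<open>T u\<close> of the set on the right.
\<close>

lemma T_diff_preimage:
  assumes "A \<in> sets M" "B \<in> sets M"
  shows "measure M (A \<inter> T (u - v) -` B) = measure M (T v ` B \<inter> T u ` A)"
proof -
  have eq: "T u -` (T v ` B \<inter> T u ` A) = A \<inter> T (u - v) -` B"
    by (auto simp: T_image simp flip: T_add)
  have "T v ` B \<inter> T u ` A \<in> sets M" using assms by (auto simp: T_image)
  then show ?thesis by (subst eq[symmetric]) (rule measure_T)
qed

lemma mixing_blocks:
  assumes R: "IP_ring R" and lim: "\<forall>A. (\<forall>j\<in>{0..l}. A j \<in> sets M) \<longrightarrow>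
    IP_limit euclideanreal R (\<lambda>\<alpha>. multi_corr M T l A (\<lambda>j. sum (g j) \<alpha>)) (\<Prod>j=0..l. measure M (A j))"
  shows "\<exists>a. block_seq a \<and> (\<forall>A. (\<forall>j\<in>{0..l}. A j \<in> sets M) \<longrightarrow>
    (\<lambda>k. multi_corr M T l A (\<lambda>j. sum (g j) (a k))) \<longlonglongrightarrow> (\<Prod>j=0..l. measure M (A j)))"
proof -
  obtain a where a: "block_seq a" "\<And>k. a k \<in> R"
    using block_seq_in_family[OF block_family_IP_ring[OF R]] by metis
  have "(\<lambda>k. multi_corr M T l A (\<lambda>j. sum (g j) (a k))) \<longlonglongrightarrow> (\<Prod>j=0..l. measure M (A j))"
    if A: "\<forall>j\<in>{0..l}. A j \<in> sets M" for A
  proof (rule tendsto_along_blocks[OF a])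
    show "((\<lambda>\<alpha>. multi_corr M T l A (\<lambda>j. sum (g j) \<alpha>)) \<longlongrightarrow> (\<Prod>j=0..l. measure M (A j))) (IP_filter R)"
      using lim A by (simp add: IP_limit_iff[OF R])
  qed
  with a(1) show ?thesis by blast
qed

text \<open>
  Coordinate 0 stands for the group element 0, so this also covers correlations with the fixed set
  \<open>A 0\<close>.
\<close>

lemma multi_corr_two:
  fixes h :: "nat \<Rightarrow> 'g" and A B :: "'x set"
  assumes ij: "i \<in> {0..l}" "j \<in> {1..l}" "i \<noteq> j" and k: "k = (if i = 0 then 0 else h i)"
  defines "C \<equiv> \<lambda>t. if t = i then B else if t = j then A else UNIV"
  shows "multi_corr M T l C h = measure M (T k ` B \<inter> T (h j) ` A)"
    and "(\<Prod>t=0..l. measure M (C t)) = measure M A * measure M B"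
proof -
  have "C 0 \<inter> (\<Inter>t\<in>{1..l}. T (h t) ` C t) = T k ` B \<inter> T (h j) ` A"
  proof (cases "i = 0")
    case True
    have "(\<Inter>t\<in>{1..l}. T (h t) ` C t) = T (h j) ` A"
      using ij True by (auto simp: C_def split: if_splits)
    moreover have "T 0 ` B = B" by simp
    ultimately show ?thesis using True k by (simp add: C_def)
  next
    case False
    have two: "(\<Inter>t\<in>I. F t) = F i \<inter> F j" if "i \<in> I" "j \<in> I" "\<And>t. t \<in> I \<Longrightarrow> t \<noteq> i \<Longrightarrow> t \<noteq> j \<Longrightarrow> F t = UNIV"
      for I and F :: "nat \<Rightarrow> 'x set" using that by blast
    have "(\<Inter>t\<in>{1..l}. T (h t) ` C t) = T (h i) ` C i \<inter> T (h j) ` C j"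
      by (rule two) (use ij False in \<open>auto simp: C_def\<close>)
    then have "(\<Inter>t\<in>{1..l}. T (h t) ` C t) = T k ` B \<inter> T (h j) ` A"
      using ij False k by (simp add: C_def)
    then show ?thesis using ij False by (simp add: C_def)
  qed
  then show "multi_corr M T l C h = measure M (T k ` B \<inter> T (h j) ` A)" by (simp add: multi_corr_def)
  have "(\<Prod>t=0..l. measure M (C t)) = (\<Prod>t\<in>{i, j}. measure M (C t))"
    using ij prob_space by (intro prod.mono_neutral_right) (auto simp: C_def)
  then show "(\<Prod>t=0..l. measure M (C t)) = measure M A * measure M B"
    using ij by (simp add: C_def mult.commute)
qed

text \<open>
  Leave only two nontrivial sets in the multiple correlation; by invariance of the measure the
  correlation depends on the difference of the two group elements.
\<close>

lemma mixing_property_of_blocks: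
  assumes lim: "\<forall>A. (\<forall>j\<in>{0..l}. A j \<in> sets M) \<longrightarrow>
    (\<lambda>k. multi_corr M T l A (h k)) \<longlonglongrightarrow> (\<Prod>j=0..l. measure M (A j))"
  shows "j \<in> {1..l} \<Longrightarrow> mixing_property M (\<lambda>k. T (h k j))"
    and "i \<in> {1..l} \<Longrightarrow> j \<in> {1..l} \<Longrightarrow> i \<noteq> j \<Longrightarrow> mixing_property M (\<lambda>k. T (h k j - h k i))"
proof -
  have pair: "(\<lambda>k. measure M (T (if i = 0 then 0 else h k i) ` B \<inter> T (h k j) ` A)) \<longlonglongrightarrow> measure M A * measure M B"
    if "A \<in> sets M" "B \<in> sets M" and ij: "i \<in> {0..l}" "j \<in> {1..l}" "i \<noteq> j" for A B i j
    using lim[THEN spec, of "\<lambda>t. if t = i then B else if t = j then A else UNIV"] that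
    unfolding multi_corr_two(1)[OF ij refl] multi_corr_two(2)[OF ij refl] by simp
  show "mixing_property M (\<lambda>k. T (h k j))" if j: "j \<in> {1..l}"
    unfolding mixing_property_def
  proof (intro ballI)
    fix A B assume AB: "A \<in> sets M" "B \<in> sets M"
    have "T 0 ` B = B" by simp
    then show "(\<lambda>k. measure M (A \<inter> (T (h k j) -` B \<inter> space M))) \<longlonglongrightarrow> measure M A * measure M B"
      using pair[OF AB, of 0 j] j by (simp add: measure_preimage_eq_image[OF AB])
  qed
  show "mixing_property M (\<lambda>k. T (h k j - h k i))" if ij: "i \<in> {1..l}" "j \<in> {1..l}" "i \<noteq> j"
    unfolding mixing_property_def
  proof (intro ballI)
    fix A B assume AB: "A \<in> sets M" "B \<in> sets M"
    show "(\<lambda>k. measure M (A \<inter> (T (h k j - h k i) -` B \<inter> space M))) \<longlonglongrightarrow> measure M A * measure M B"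
      using pair[OF AB, of i j] ij by (simp add: T_diff_preimage[OF AB])
  qed
qed

text \<open>
  A sequence \<open>g\<close> is completed to \<open>l\<close> sequences; the first coordinate of an element of the resulting
  IP set is a finite sum of \<open>g\<close>.
\<close>

lemma pair_recurrent_of_mixing_elements:
  assumes l: "l \<ge> 1"
    and ex: "\<And>E A B \<epsilon>. IP_tilde_set l E \<Longrightarrow> A \<in> sets M \<Longrightarrow> B \<in> sets M \<Longrightarrow> \<epsilon> > 0 \<Longrightarrow>
      \<exists>e\<in>E. \<bar>measure M (A \<inter> T (e 1) ` B) - measure M A * measure M B\<bar> < \<epsilon>"
  shows pair_recurrent
  unfolding pair_recurrent_def
proof (intro allI impI ballI)
  fix g :: "nat \<Rightarrow> 'g" and A B \<epsilon>
  assume g: "fs_tends_infinity (\<lambda>\<alpha>. sum g \<alpha>)" and AB: "A \<in> sets M" "B \<in> sets M" and \<epsilon>: "(\<epsilon>::real) > 0"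
  obtain E where E: "IP_tilde_set l E" and Eg: "\<And>e. e \<in> E \<Longrightarrow> \<exists>\<alpha>\<in>fin_sets. e 1 = sum g \<alpha>"
    using IP_tilde_set_extending[OF g l] by metis
  from ex[OF E AB \<epsilon>] obtain e where e: "e \<in> E" 
    "\<bar>measure M (A \<inter> T (e 1) ` B) - measure M A * measure M B\<bar> < \<epsilon>" by blast
  from Eg[OF e(1)] e(2) show "\<exists>\<alpha>\<in>fin_sets. \<bar>measure M (A \<inter> T (sum g \<alpha>) ` B) - measure M A * measure M B\<bar> < \<epsilon>" by auto
qed

end

theorem theorem6p5:
  fixes l :: nat
    and M :: "'x::metric_space measure"
    and T :: "'g::{ab_group_add, countable} \<Rightarrow> 'x \<Rightarrow> 'x"
  assumes l: "l \<ge> 1"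
    and sys: "mp_system M T"
  defines "cond_ii \<equiv>
      (\<forall>E :: (nat \<Rightarrow> 'g) set. \<forall>m\<ge>1. IP_tilde_set l E \<longrightarrow>
        (\<exists>g :: nat \<Rightarrow> nat \<Rightarrow> nat \<Rightarrow> 'g.
           nondeg_ess_distinct_family l m g \<and>
           {(\<lambda>j\<in>{1..l}. ordered_sum (g j) \<alpha>) | \<alpha>. \<alpha> \<in> nat_subsets m} \<subseteq> E \<and>
           (\<forall>t\<in>{1..m}. \<forall>j\<in>{1..l}. mixing_property M (\<lambda>k. T (g j k t))) \<and>
           (\<forall>t\<in>{1..m}. \<forall>i\<in>{1..l}. \<forall>j\<in>{1..l}. i \<noteq> j \<longrightarrow>
              mixing_property M (\<lambda>k. T (g j k t - g i k t)))))"
    and "cond_iii \<equiv>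
      (\<forall>E :: (nat \<Rightarrow> 'g) set. IP_tilde_set l E \<longrightarrow>
        (\<exists>m\<ge>1. \<exists>g :: nat \<Rightarrow> nat \<Rightarrow> nat \<Rightarrow> 'g.
           nondeg_ess_distinct_family l m g \<and>
           {(\<lambda>j\<in>{1..l}. ordered_sum (g j) \<alpha>) | \<alpha>. \<alpha> \<in> nat_subsets m} \<subseteq> E \<and>
           (\<forall>A. (\<forall>j\<in>{0..l}. A j \<in> sets M) \<longrightarrow>
              R_limit m (\<lambda>\<alpha>. multi_corr M T l A (\<lambda>j. ordered_sum (g j) \<alpha>))
                (\<Prod>j=0..l. measure M (A j)))))"
    and "cond_iv \<equiv>
      (\<forall>g :: nat \<Rightarrow> nat \<Rightarrow> 'g. IP_tilde_gen l g \<longrightarrow>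
        (\<exists>\<R>. IP_ring \<R> \<and>
           (\<forall>A. (\<forall>j\<in>{0..l}. A j \<in> sets M) \<longrightarrow>
              IP_limit euclideanreal \<R> (\<lambda>\<alpha>. multi_corr M T l A (\<lambda>j. sum (g j) \<alpha>))
                (\<Prod>j=0..l. measure M (A j)))))"
    and "cond_v \<equiv>
      (\<forall>A. (\<forall>j\<in>{0..l}. A j \<in> sets M) \<longrightarrow>
        (\<forall>\<epsilon>>0. IP_tilde_star l
           {g \<in> {1..l} \<rightarrow>\<^sub>E UNIV.
              \<bar>multi_corr M T l A g - (\<Prod>j=0..l. measure M (A j))\<bar> < \<epsilon>}))"
  shows "(mildly_mixing M T \<longleftrightarrow> cond_ii) \<and>
         (mildly_mixing M T \<longleftrightarrow> cond_iii) \<and>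
         (mildly_mixing M T \<longleftrightarrow> cond_iv) \<and>
         (mildly_mixing M T \<longleftrightarrow> cond_v)"
proof -
  interpret mp_sys M T by standard (rule sys)
  have v_iff: "cond_v \<longleftrightarrow> recurrent l"
    unfolding cond_v_def recurrent_iff_IP_tilde_star ..
  have rec_iv: cond_iv if r: "recurrent l"
    unfolding cond_iv_def
  proof (intro allI impI)
    fix g :: "nat \<Rightarrow> nat \<Rightarrow> 'g" assume g: "IP_tilde_gen l g"
    obtain a where a: "block_seq a" and lim: "\<And>A. \<forall>j\<in>{0..l}. A j \<in> sets M \<Longrightarrow>
       ((\<lambda>\<alpha>. multi_corr M T l A (\<lambda>j. sum (g j) \<alpha>)) \<longlongrightarrow> (\<Prod>j=0..l. measure M (A j))) (IP_filter (finite_unions a))"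
      using ring_of_mixing[OF r g] by metis
    show "\<exists>\<R>. IP_ring \<R> \<and> (\<forall>A. (\<forall>j\<in>{0..l}. A j \<in> sets M) \<longrightarrow>
              IP_limit euclideanreal \<R> (\<lambda>\<alpha>. multi_corr M T l A (\<lambda>j. sum (g j) \<alpha>)) (\<Prod>j=0..l. measure M (A j)))"
      using lim by (intro exI[of _ "finite_unions a"]) (simp add: IP_limit_iff IP_ring_finite_unions[OF a])
  qed
  have blocks: "\<exists>a g. block_seq a \<and> IP_tilde_gen l g \<and> E = {(\<lambda>j\<in>{1..l}. sum (g j) \<alpha>) | \<alpha>. \<alpha> \<in> fin_sets} \<and>
      (\<forall>A. (\<forall>j\<in>{0..l}. A j \<in> sets M) \<longrightarrow>
        (\<lambda>k. multi_corr M T l A (\<lambda>j. sum (g j) (a k))) \<longlonglongrightarrow> (\<Prod>j=0..l. measure M (A j)))"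
    if iv: cond_iv and E: "IP_tilde_set l E" for E
  proof -
    obtain g where g: "IP_tilde_gen l g" "E = {(\<lambda>j\<in>{1..l}. sum (g j) \<alpha>) | \<alpha>. \<alpha> \<in> fin_sets}"
      using E unfolding IP_tilde_set_def by (elim exE conjE) (rule that)
    from iv g(1) have "\<exists>R. IP_ring R \<and> (\<forall>A. (\<forall>j\<in>{0..l}. A j \<in> sets M) \<longrightarrow>
        IP_limit euclideanreal R (\<lambda>\<alpha>. multi_corr M T l A (\<lambda>j. sum (g j) \<alpha>)) (\<Prod>j=0..l. measure M (A j)))"
      unfolding cond_iv_def by (elim allE impE)
    then obtain R where R: "IP_ring R" and lim: "\<forall>A. (\<forall>j\<in>{0..l}. A j \<in> sets M) \<longrightarrow>
        IP_limit euclideanreal R (\<lambda>\<alpha>. multi_corr M T l A (\<lambda>j. sum (g j) \<alpha>)) (\<Prod>j=0..l. measure M (A j))"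
      by (elim exE conjE) (rule that)
    from mixing_blocks[OF R lim] obtain a where a: "block_seq a"
      "\<forall>A. (\<forall>j\<in>{0..l}. A j \<in> sets M) \<longrightarrow>
        (\<lambda>k. multi_corr M T l A (\<lambda>j. sum (g j) (a k))) \<longlonglongrightarrow> (\<Prod>j=0..l. measure M (A j))"
      by (elim exE conjE) (rule that)
    show ?thesis
      by (intro exI[of _ a] exI[of _ g] conjI) (rule a g)+
  qed
  have iv_ii: cond_ii if iv: cond_iv
    unfolding cond_ii_def
  proof (intro allI impI)
    fix E :: "(nat \<Rightarrow> 'g) set" and m :: nat
    assume m: "1 \<le> m" and E: "IP_tilde_set l E"
    from blocks[OF iv E] obtain a g where a: "block_seq a" and g: "IP_tilde_gen l g"
      and Eg: "E = {(\<lambda>j\<in>{1..l}. sum (g j) \<alpha>) | \<alpha>. \<alpha> \<in> fin_sets}"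
      and lim: "\<forall>A. (\<forall>j\<in>{0..l}. A j \<in> sets M) \<longrightarrow>
        (\<lambda>k. multi_corr M T l A (\<lambda>j. sum (g j) (a k))) \<longlonglongrightarrow> (\<Prod>j=0..l. measure M (A j))"
      by (elim exE conjE) (rule that)
    note mix = mixing_property_of_blocks[of l "\<lambda>k j. sum (g j) (a k)", OF lim]
    show "\<exists>G. nondeg_ess_distinct_family l m G \<and>
           {(\<lambda>j\<in>{1..l}. ordered_sum (G j) \<alpha>) | \<alpha>. \<alpha> \<in> nat_subsets m} \<subseteq> E \<and>
           (\<forall>t\<in>{1..m}. \<forall>j\<in>{1..l}. mixing_property M (\<lambda>k. T (G j k t))) \<and>
           (\<forall>t\<in>{1..m}. \<forall>i\<in>{1..l}. \<forall>j\<in>{1..l}. i \<noteq> j \<longrightarrow>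
              mixing_property M (\<lambda>k. T (G j k t - G i k t)))"
    proof (intro exI[of _ "\<lambda>j k t. sum (g j) (a k)"] conjI ballI impI)
      show "nondeg_ess_distinct_family l m (\<lambda>j k t. sum (g j) (a k))" by (rule block_sequences[OF a g])
      show "{(\<lambda>j\<in>{1..l}. ordered_sum (\<lambda>k t. sum (g j) (a k)) \<alpha>) | \<alpha>. \<alpha> \<in> nat_subsets m} \<subseteq> E"
        unfolding Eg using m by (rule block_sequences[OF a g])
    qed (rule mix; assumption)+
  qed
  have iv_iii: cond_iii if iv: cond_iv
    unfolding cond_iii_def
  proof (intro allI impI)
    fix E :: "(nat \<Rightarrow> 'g) set"
    assume E: "IP_tilde_set l E"
    from blocks[OF iv E] obtain a g where a: "block_seq a" and g: "IP_tilde_gen l g"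
      and Eg: "E = {(\<lambda>j\<in>{1..l}. sum (g j) \<alpha>) | \<alpha>. \<alpha> \<in> fin_sets}"
      and lim: "\<forall>A. (\<forall>j\<in>{0..l}. A j \<in> sets M) \<longrightarrow>
        (\<lambda>k. multi_corr M T l A (\<lambda>j. sum (g j) (a k))) \<longlonglongrightarrow> (\<Prod>j=0..l. measure M (A j))"
      by (elim exE conjE) (rule that)
    let ?G = "\<lambda>j k (t::nat). sum (g j) (a k)"
    have "R_limit 1 (\<lambda>\<alpha>. multi_corr M T l A (\<lambda>j. ordered_sum (?G j) \<alpha>)) (\<Prod>j=0..l. measure M (A j))"
      if A: "\<forall>j\<in>{0..l}. A j \<in> sets M" for A
    proof -
      have "ordered_sum (?G j) \<alpha> = sum (g j) (a (Min \<alpha>))" if "\<alpha> \<in> nat_subsets 1" for j \<alpha>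
        using that by (auto simp: nat_subsets_def card_1_singleton_iff ordered_sum_def)
      then show ?thesis
        using R_limit_of_tendsto[OF lim[THEN spec, THEN mp, OF A]] unfolding R_limit_def by simp
    qed
    moreover have "{(\<lambda>j\<in>{1..l}. ordered_sum (?G j) \<alpha>) | \<alpha>. \<alpha> \<in> nat_subsets 1} \<subseteq> E"
      unfolding Eg by (rule block_sequences[OF a g]) simp
    moreover have "nondeg_ess_distinct_family l 1 ?G" by (rule block_sequences[OF a g])
    ultimately show "\<exists>m\<ge>1. \<exists>G. nondeg_ess_distinct_family l m G \<and>
           {(\<lambda>j\<in>{1..l}. ordered_sum (G j) \<alpha>) | \<alpha>. \<alpha> \<in> nat_subsets m} \<subseteq> E \<and>
           (\<forall>A. (\<forall>j\<in>{0..l}. A j \<in> sets M) \<longrightarrow>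
              R_limit m (\<lambda>\<alpha>. multi_corr M T l A (\<lambda>j. ordered_sum (G j) \<alpha>)) (\<Prod>j=0..l. measure M (A j)))"
      by (intro exI[of _ 1] exI[of _ ?G] conjI allI impI order_refl)
  qed
  have ii_i: "mildly_mixing M T" if ii: cond_ii
  proof (rule mildly_mixing_of_pair_recurrent, rule pair_recurrent_of_mixing_elements[OF l])
    fix E A B \<epsilon>
    assume E: "IP_tilde_set l (E :: (nat \<Rightarrow> 'g) set)" and A: "A \<in> sets M" and B: "B \<in> sets M" and \<epsilon>: "(\<epsilon>::real) > 0"
    from ii[unfolded cond_ii_def, THEN spec, THEN spec, THEN mp, THEN mp, OF order_refl E]
    obtain G where sub: "{(\<lambda>j\<in>{1..l}. ordered_sum (G j) \<alpha>) | \<alpha>. \<alpha> \<in> nat_subsets 1} \<subseteq> E"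
      and mix: "\<forall>t\<in>{1..1}. \<forall>j\<in>{1..l}. mixing_property M (\<lambda>k. T (G j k t))"
      by (elim exE conjE) (rule that)
    have "mixing_property M (\<lambda>k. T (G 1 k 1))" using mix l by simp
    then have "(\<lambda>k. measure M (B \<inter> (T (G 1 k 1) -` A \<inter> space M))) \<longlonglongrightarrow> measure M B * measure M A"
      using A B unfolding mixing_property_def by simp
    from tendstoD[OF this \<epsilon>] obtain N where N: "\<And>k. k \<ge> N \<Longrightarrow> 
        dist (measure M (B \<inter> (T (G 1 k 1) -` A \<inter> space M))) (measure M B * measure M A) < \<epsilon>"
      unfolding eventually_sequentially by metis
    have "{Suc N} \<in> nat_subsets 1" by (simp add: nat_subsets_def)
    then have "(\<lambda>j\<in>{1..l}. ordered_sum (G j) {Suc N}) \<in> E" using sub by blast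
    moreover have "(\<lambda>j\<in>{1..l}. ordered_sum (G j) {Suc N}) 1 = G 1 (Suc N) 1"
      using l by (simp add: ordered_sum_def)
    moreover have "\<bar>measure M (A \<inter> T (G 1 (Suc N) 1) ` B) - measure M A * measure M B\<bar> < \<epsilon>"
      using N[of "Suc N"] measure_preimage_eq_image[OF B A, of "G 1 (Suc N) 1"]
      by (simp add: dist_real_def mult.commute)
    ultimately show "\<exists>e\<in>E. \<bar>measure M (A \<inter> T (e 1) ` B) - measure M A * measure M B\<bar> < \<epsilon>"
      by metis
  qed
  have iii_i: "mildly_mixing M T" if iii: cond_iii
  proof (rule mildly_mixing_of_pair_recurrent, rule pair_recurrent_of_mixing_elements[OF l])
    fix E A B \<epsilon>
    assume E: "IP_tilde_set l (E :: (nat \<Rightarrow> 'g) set)" and A: "A \<in> sets M" and B: "B \<in> sets M" and \<epsilon>: "(\<epsilon>::real) > 0"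
    from iii[unfolded cond_iii_def, THEN spec, THEN mp, OF E]
    obtain m G where m: "m \<ge> 1" and sub: "{(\<lambda>j\<in>{1..l}. ordered_sum (G j) \<alpha>) | \<alpha>. \<alpha> \<in> nat_subsets m} \<subseteq> E"
      and lim: "\<forall>A. (\<forall>j\<in>{0..l}. A j \<in> sets M) \<longrightarrow>
         R_limit m (\<lambda>\<alpha>. multi_corr M T l A (\<lambda>j. ordered_sum (G j) \<alpha>)) (\<Prod>j=0..l. measure M (A j))"
      by (elim exE conjE) (rule that)
    have "R_limit m (\<lambda>\<alpha>. measure M (A \<inter> T (ordered_sum (G 1) \<alpha>) ` B)) (measure M A * measure M B)"
      using lim[THEN spec, of "\<lambda>j. if j = 0 then A else if j = 1 then B else UNIV"] A B
      unfolding multi_corr_padded[OF l] by simp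
    then obtain \<alpha>\<^sub>0 where \<alpha>\<^sub>0: "\<And>\<alpha>. \<alpha> \<in> nat_subsets m \<Longrightarrow> before \<alpha>\<^sub>0 \<alpha> \<Longrightarrow> 
        dist (measure M (A \<inter> T (ordered_sum (G 1) \<alpha>) ` B)) (measure M A * measure M B) < \<epsilon>"
      using \<epsilon> unfolding R_limit_def by blast
    define \<alpha> where "\<alpha> = {Max \<alpha>\<^sub>0 + 1..Max \<alpha>\<^sub>0 + m}"
    have \<alpha>: "\<alpha> \<in> nat_subsets m" "before \<alpha>\<^sub>0 \<alpha>"
      using m by (auto simp: \<alpha>_def nat_subsets_def before_def)
    have "(\<lambda>j\<in>{1..l}. ordered_sum (G j) \<alpha>) \<in> E" using sub \<alpha>(1) by blast
    moreover have "(\<lambda>j\<in>{1..l}. ordered_sum (G j) \<alpha>) 1 = ordered_sum (G 1) \<alpha>" using l by simp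
    moreover have "\<bar>measure M (A \<inter> T (ordered_sum (G 1) \<alpha>) ` B) - measure M A * measure M B\<bar> < \<epsilon>"
      using \<alpha>\<^sub>0[OF \<alpha>] by (simp add: dist_real_def)
    ultimately show "\<exists>e\<in>E. \<bar>measure M (A \<inter> T (e 1) ` B) - measure M A * measure M B\<bar> < \<epsilon>"
      by metis
  qed
  show ?thesis
    using v_iff mildly_mixing_recurrent rec_iv iv_ii iv_iii ii_i iii_i by blast
qed

end
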